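(* There exists a universal constant $c$ (a positive integer) such that the following holds. Whenever $p$ is a prime and $A$ and $B$ are non-empty subsets of $\mathbb{Z}_p$ with $|A|=|B|\leq p/3$, there exist $b_1, \dots, b_c \in B$ such that $$|A+\{b_1, \dots, b_c\} |\geq |A|+|B|-1.$$
   Context: $\mathbb{Z}_p$ is the cyclic group of prime order $p$. For subsets $X,Y$ of an abelian group, $X+Y=\{x+y : x\in X, y\in Y\}$. The elements $b_1,\dots,b_c$ are not required to be distinct. *)

theory Defs
  imports Complex_Main "HOL-Algebra.Elementary_Groups" "HOL-Computational_Algebra.Primes"
begin

end

(*
  Suppose no bounded set of translates suffices. Adding translates greedily gives a union S of boundedly
  many translates A + b with |S| < 2n (n = |A| = |B|) such that every A + b, b in B, lies in S up to
  epsilon n elements. Robust Dyson e-transforms (Pollard's inequality supplies shifts e for which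
  B and A - e meet in an intermediate proportion) replace (A, B) by a pair (A', B') with
  |A'| + |B'| = 2n, |B'| tiny and A' + B' still mostly inside S. Hence S is almost invariant under the
  differences of B': the balls N(w) = {g : |(S + g) - S| <= w} have size about at least 2w at a tiny scale.
  By Cauchy-Davenport their growth is at least linear, and a trivial count bounds it by a constant times w,
  so on some long run of scales |2^i N(w)| is almost 2^i |N(w)|. Such a set has a Fourier coefficient close to
  its size, so a dilate of it lies in a short interval of integers, where an elementary argument shows that it
  nearly fills an interval [-l, l]. Then S is close to an arc, and A and B are close to arcs of length n.
  Once A and B are mostly in arcs, three translates in the integers and a few more for the outliers of A give 2n - 1.

  Subsets of Z_p are modelled by p-periodic sets of integers (predicate per), counted on one
  period (msr); this keeps sums and translates free of reductions modulo p.
*)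
theory Submission
  imports Defs "HOL-Number_Theory.Cong" "HOL-Analysis.Convex"
begin

section \<open>Periodic sets of integers\<close>

text \<open>The obstacle is that A + B itself may be much larger than S: each translate A + b is
  almost inside S, but the few exceptions of different b may be spread everywhere. So inclusions are
  replaced by counts of bad pairs (\<open>misses\<close>). Pollard's inequality tolerates them, and
  a Dyson transform at most doubles them, which is affordable only because the number K of
  transforms is a constant. Making B' tiny is what creates structure: |S| - |A'| is then at most
  |B'|, so two translates of A' that almost lie in S force an almost period of S at a scale far
  below n. This leaves room for a run of dyadic scales long enough for pigeonholing. The bound |A|
  <= p/3 is used repeatedly: sizes adding up to 3n still fit into Pollard's inequality, balls of
  radius up to n/2 have at most 2.7 n < p elements and so cannot be everything, and S leaves about a
  third of Z_p uncovered, which produces a long almost empty arc. All constants are fixed before p;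
  for the finitely many small n all of B is taken.\<close>

locale prime_modulus =
  fixes p :: int
  assumes prime_p: "Factorial_Ring.prime p"
begin

declare sum_of_bool_eq [simp del] sum_mult_of_bool_eq [simp del] sum_of_bool_mult_eq [simp del]

definition per :: "int set \<Rightarrow> bool" where
  "per A \<longleftrightarrow> (\<forall>x. x + p \<in> A \<longleftrightarrow> x \<in> A)"

definition msr :: "int set \<Rightarrow> nat" where
  "msr A = card (A \<inter> {0..<p})"

lemma p_gt_1: "p > 1"
  using prime_p prime_gt_1_int by blast

lemma p_pos [simp]: "p > 0" "p \<ge> 0" "p \<noteq> 0"
  using p_gt_1 by auto

lemma periodic_fun_multiple:
  assumes "\<And>x. F (x + p) = F x"
  shows "F (x + k * p) = F x"
proof -
  have nat: "F (x + int j * p) = F x" for j x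
  proof (induction j)
    case (Suc j)
    have "F (x + int (Suc j) * p) = F ((x + int j * p) + p)" by (simp add: algebra_simps)
    then show ?case using assms Suc by simp
  qed simp
  show ?thesis
  proof (cases "k \<ge> 0")
    case True
    then show ?thesis using nat[of x "nat k"] by simp
  next
    case False
    then show ?thesis using nat[of "x + k * p" "nat (- k)"] by simp
  qed
qed

lemma periodic_fun_cong:
  assumes "\<And>x. F (x + p) = F x" "[x = y] (mod p)"
  shows "F x = F y"
proof -
  obtain k where "x = y + k * p"
    using assms(2) by (metis cong_iff_lin cong_sym mult.commute)
  then show ?thesis using periodic_fun_multiple[of F, OF assms(1)] by simp
qed

lemma periodic_fun_mod:
  assumes "\<And>x. F (x + p) = F x"
  shows "F (x mod p) = F x"
  by (rule periodic_fun_cong[of F, OF assms]) (auto simp: cong_def)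

lemma per_cong: "per A \<Longrightarrow> [x = y] (mod p) \<Longrightarrow> x \<in> A \<longleftrightarrow> y \<in> A"
  using periodic_fun_cong[of "\<lambda>x. x \<in> A" x y] by (auto simp: per_def)

lemma per_mod [simp]: "per A \<Longrightarrow> x mod p \<in> A \<longleftrightarrow> x \<in> A"
  by (rule per_cong) (auto simp: cong_def)

lemma per_multiple: "per A \<Longrightarrow> x + k * p \<in> A \<longleftrightarrow> x \<in> A"
  by (rule per_cong) (auto simp: cong_def)

lemma perI: "(\<And>x. x + p \<in> A \<longleftrightarrow> x \<in> A) \<Longrightarrow> per A"
  by (simp add: per_def)

lemma per_affine: "per A \<Longrightarrow> per {x. k * x + g \<in> A}"
proof (rule perI)
  fix x assume "per A"
  have "k * (x + p) + g = (k * x + g) + k * p" by (simp add: algebra_simps)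
  then show "x + p \<in> {x. k * x + g \<in> A} \<longleftrightarrow> x \<in> {x. k * x + g \<in> A}"
    using per_multiple[OF \<open>per A\<close>, of "k * x + g" k] by (simp add: add.assoc add.commute[of g])
qed

lemma per_shift [simp, intro]:
  assumes "per A"
  shows "per {x. x + g \<in> A}" "per {x. x - g \<in> A}" "per {x. g - x \<in> A}" "per {x. - x \<in> A}"
    "per {x. k * x \<in> A}" "per {x. g + x \<in> A}"
  using per_affine[OF assms, of 1 g] per_affine[OF assms, of 1 "-g"] per_affine[OF assms, of "-1" g]
    per_affine[OF assms, of "-1" 0] per_affine[OF assms, of k 0] by (simp_all add: add.commute)

lemma per_bool [simp, intro]:
  "per {}" "per UNIV"
  "per A \<Longrightarrow> per B \<Longrightarrow> per (A \<inter> B)" "per A \<Longrightarrow> per B \<Longrightarrow> per (A \<union> B)"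
  "per A \<Longrightarrow> per B \<Longrightarrow> per (A - B)" "per A \<Longrightarrow> per (- A)"
  by (auto simp: per_def)

lemma per_Collect [simp, intro]:
  "per {x. P x} \<Longrightarrow> per {x. Q x} \<Longrightarrow> per {x. P x \<and> Q x}"
  "per {x. P x} \<Longrightarrow> per {x. Q x} \<Longrightarrow> per {x. P x \<or> Q x}"
  "per {x. P x} \<Longrightarrow> per {x. \<not> P x}"
  by (auto simp: per_def)

lemma per_def_mem [simp]: "per A \<Longrightarrow> x + p \<in> A \<longleftrightarrow> x \<in> A"
  by (simp add: per_def)

section \<open>Invariance of sums over one period, and the counting measure\<close>

lemma bij_betw_affine_mod:
  assumes "coprime k p"
  shows "bij_betw (\<lambda>x. (k * x + g) mod p) {0..<p} {0..<p}"
proof -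
  have inj: "inj_on (\<lambda>x. (k * x + g) mod p) {0..<p}"
  proof (rule inj_onI)
    fix x y assume x: "x \<in> {0..<p}" and y: "y \<in> {0..<p}"
      and "(k * x + g) mod p = (k * y + g) mod p"
    then have "[k * x + g = k * y + g] (mod p)" by (simp add: cong_def)
    then have "[k * x = k * y] (mod p)" using cong_add_rcancel by blast
    then have "[x = y] (mod p)" using assms cong_mult_lcancel by blast
    then show "x = y" using x y by (simp add: cong_def)
  qed
  moreover have "(\<lambda>x. (k * x + g) mod p) ` {0..<p} \<subseteq> {0..<p}" by auto
  ultimately show ?thesis
    by (simp add: bij_betw_def endo_inj_surj)
qed

lemma sum_affine:
  fixes F :: "int \<Rightarrow> 'a::comm_monoid_add"
  assumes "\<And>x. F (x + p) = F x" "coprime k p"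
  shows "(\<Sum>x\<in>{0..<p}. F (k * x + g)) = (\<Sum>x\<in>{0..<p}. F x)"
proof -
  have "(\<Sum>x\<in>{0..<p}. F (k * x + g)) = (\<Sum>x\<in>{0..<p}. F ((k * x + g) mod p))"
    using periodic_fun_mod[of F, OF assms(1)] by simp
  also have "\<dots> = (\<Sum>x\<in>{0..<p}. F x)"
    by (rule sum.reindex_bij_betw[OF bij_betw_affine_mod[OF assms(2)]])
  finally show ?thesis .
qed

lemma sum_shift:
  fixes F :: "int \<Rightarrow> 'a::comm_monoid_add"
  assumes "\<And>x. F (x + p) = F x"
  shows "(\<Sum>x\<in>{0..<p}. F (x + g)) = (\<Sum>x\<in>{0..<p}. F x)"
    and "(\<Sum>x\<in>{0..<p}. F (x - g)) = (\<Sum>x\<in>{0..<p}. F x)"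
    and "(\<Sum>x\<in>{0..<p}. F (g - x)) = (\<Sum>x\<in>{0..<p}. F x)"
  using sum_affine[of F 1 g, OF assms] sum_affine[of F 1 "-g", OF assms]
    sum_affine[of F "-1" g, OF assms] by simp_all

text \<open>With sums of \<open>of_bool\<close>, double counting becomes \<open>sum.swap\<close> and
  translating becomes \<open>sum_shift\<close>. This is why the simp rules that collapse such sums
  to cardinalities are switched off at the start.\<close>

lemma msr_sum: "msr A = (\<Sum>x\<in>{0..<p}. of_bool (x \<in> A))"
  unfolding msr_def by (simp add: sum_of_bool_eq Int_def conj_commute)

lemma msr_affine:
  assumes "per A" "coprime k p"
  shows "msr {x. k * x + g \<in> A} = msr A"
  unfolding msr_sum using sum_affine[of "\<lambda>x. of_bool (x \<in> A)" k g] assms by simp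

lemma msr_shift [simp]:
  assumes "per A"
  shows "msr {x. x + g \<in> A} = msr A" "msr {x. x - g \<in> A} = msr A" "msr {x. g - x \<in> A} = msr A"
    "msr {x. - x \<in> A} = msr A" "msr {x. g + x \<in> A} = msr A"
  using msr_affine[OF assms, of 1 g] msr_affine[OF assms, of 1 "-g"] msr_affine[OF assms, of "-1" g]
    msr_affine[OF assms, of "-1" 0] by (simp_all add: add.commute)

lemma msr_mono: "A \<subseteq> B \<Longrightarrow> msr A \<le> msr B"
  unfolding msr_def by (intro card_mono) auto

lemma msr_Un_Int: "msr (A \<union> B) + msr (A \<inter> B) = msr A + msr B"
proof -
  have "card ((A \<inter> {0..<p}) \<union> (B \<inter> {0..<p})) + card ((A \<inter> {0..<p}) \<inter> (B \<inter> {0..<p})) = msr A + msr B"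
    unfolding msr_def by (metis card_Un_Int finite_Int finite_atLeastLessThan_int)
  moreover have "(A \<inter> {0..<p}) \<union> (B \<inter> {0..<p}) = (A \<union> B) \<inter> {0..<p}"
    "(A \<inter> {0..<p}) \<inter> (B \<inter> {0..<p}) = (A \<inter> B) \<inter> {0..<p}" by auto
  ultimately show ?thesis unfolding msr_def by simp
qed

lemma msr_Un_le: "msr (A \<union> B) \<le> msr A + msr B"
  using msr_Un_Int[of A B] by linarith

lemma msr_empty [simp]: "msr {} = 0"
  by (simp add: msr_def)

lemma msr_UNIV [simp]: "msr UNIV = nat p"
  by (simp add: msr_def)

lemma msr_le_p: "msr A \<le> nat p"
  using msr_mono[of A UNIV] by simp

lemma msr_Diff: "msr (A - B) + msr (A \<inter> B) = msr A"
  using msr_Un_Int[of "A - B" "A \<inter> B"] by (simp add: Un_Diff_Int Diff_Int2 Int_assoc) 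
    (metis Diff_disjoint Int_commute Un_Diff_Int add_cancel_right_right inf_bot_right inf_left_commute msr_empty)

lemma msr_Diff_le: "msr A \<le> msr B + msr (A - B)"
proof -
  have "msr (A \<inter> B) \<le> msr B" by (intro msr_mono) auto
  then show ?thesis using msr_Diff[of A B] by simp
qed

lemma msr_Diff_subset: "B \<subseteq> A \<Longrightarrow> msr (A - B) + msr B = msr A"
  using msr_Diff[of A B] by (simp add: inf_absorb2)

lemma msr_Compl: "msr (- A) + msr A = nat p"
  using msr_Diff_subset[of A UNIV] by (simp add: Compl_eq_Diff_UNIV)

lemma msr_pos: "per A \<Longrightarrow> x \<in> A \<Longrightarrow> msr A > 0"
  unfolding msr_def using per_mod[of A x] by (subst card_gt_0_iff) (auto simp del: per_mod dest: IntI[of "x mod p" A "{0..<p}"])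

lemma msr_0_iff: "per A \<Longrightarrow> msr A = 0 \<longleftrightarrow> A = {}"
  using msr_pos by fastforce

lemma msr_p_iff: "per A \<Longrightarrow> msr A = nat p \<Longrightarrow> A = UNIV"
  using msr_Compl[of A] msr_0_iff[of "- A"] by auto

lemma coprime_of_not_dvd: "\<not> p dvd d \<Longrightarrow> coprime d p"
  using prime_p by (meson coprime_commute prime_imp_coprime)

text \<open>Since \<open>d\<close> is invertible modulo \<open>p\<close>, its multiples run through
  all residues. Primality enters Pollard's inequality through this fact.\<close>

lemma closed_under_shift_UNIV:
  assumes "per A" "A \<noteq> {}" "\<not> p dvd d" "\<And>a. a \<in> A \<Longrightarrow> a + d \<in> A"
  shows "A = UNIV"
proof -
  obtain a where a: "a \<in> A" using assms(2) by auto
  have *: "a + int j * d \<in> A" for j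
  proof (induction j)
    case (Suc j)
    then show ?case using assms(4)[of "a + int j * d"] by (simp add: algebra_simps)
  qed (use a in simp)
  have "y \<in> A" for y
  proof -
    obtain k where k: "[d * k = 1] (mod p)"
      using coprime_of_not_dvd[OF assms(3)] cong_solve_coprime_int by blast
    define j where "j = nat ((k * (y - a)) mod p)"
    have "[int j = k * (y - a)] (mod p)" by (simp add: j_def cong_def)
    then have "[int j * d = (k * (y - a)) * d] (mod p)" by (rule cong_scalar_right)
    also have "(k * (y - a)) * d = (d * k) * (y - a)" by (simp add: algebra_simps)
    also have "[\<dots> = 1 * (y - a)] (mod p)" by (rule cong_scalar_right[OF k])
    finally have "[a + int j * d = a + (y - a)] (mod p)" by (intro cong_add) auto
    then show "y \<in> A" using per_cong[OF assms(1)] *[of j] by fastforce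
  qed
  then show ?thesis by auto
qed

section \<open>Pollard's inequality and the Cauchy--Davenport theorem\<close>

text \<open>The convolution of the indicator functions: representations of \<open>x\<close> as a
  sum, counted by the summand in \<open>B\<close>.\<close>

definition rep :: "int set \<Rightarrow> int set \<Rightarrow> int \<Rightarrow> nat" where
  "rep A B x = msr {y. y \<in> B \<and> x - y \<in> A}"

lemma rep_sum: "rep A B x = (\<Sum>y\<in>{0..<p}. of_bool (y \<in> B) * of_bool (x - y \<in> A))"
  unfolding rep_def msr_sum by (simp add: of_bool_conj)

lemma rep_le: "rep A B x \<le> msr B"
  unfolding rep_def by (rule msr_mono) auto

lemma rep_add_p [simp]: "per A \<Longrightarrow> rep A B (x + p) = rep A B x"
  unfolding rep_def
  by (rule arg_cong[of _ _ msr]) (simp add: add_diff_eq diff_add_eq[symmetric] cong: conj_cong)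

lemma sum_rep:
  assumes "per A"
  shows "(\<Sum>x\<in>{0..<p}. rep A B x) = msr A * msr B"
proof -
  have "(\<Sum>x\<in>{0..<p}. rep A B x) =
      (\<Sum>y\<in>{0..<p}. of_bool (y \<in> B) * (\<Sum>x\<in>{0..<p}. of_bool (x - y \<in> A)))"
    unfolding rep_sum by (subst sum.swap) (simp add: sum_distrib_left)
  also have "\<dots> = (\<Sum>y\<in>{0..<p}. of_bool (y \<in> B) * msr A)"
    using msr_shift(2)[OF assms] unfolding msr_sum by simp
  also have "\<dots> = msr A * msr B"
    unfolding msr_sum[of B] by (simp add: sum_distrib_left mult.commute)
  finally show ?thesis .
qed

text \<open>Let i, a, b be the indicators of the intersection and of the two differences. As
  convolutions, (i + a)(i + b) = i(i + a + b) + ab. So the Dyson transform (union, intersection)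
  loses exactly the representations of the pair of differences.\<close>

lemma rep_split:
  assumes "per A" "per B"
  shows "rep A B x = rep (A \<union> B) (A \<inter> B) x + rep (A - B) (B - A) x"
proof -
  define i a b where "i = (\<lambda>y. of_bool (y \<in> A \<inter> B) :: nat)" "a = (\<lambda>y. of_bool (y \<in> A - B) :: nat)"
    "b = (\<lambda>y. of_bool (y \<in> B - A) :: nat)"
  note defs = i_a_b_def
  have "rep A B x = (\<Sum>y\<in>{0..<p}. (i y + b y) * (i (x - y) + a (x - y)))"
    unfolding rep_sum defs by (intro sum.cong) auto
  also have "\<dots> = (\<Sum>y\<in>{0..<p}. i y * (i (x - y) + a (x - y))) + (\<Sum>y\<in>{0..<p}. b y * i (x - y))
      + (\<Sum>y\<in>{0..<p}. b y * a (x - y))"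
    by (simp add: sum.distrib algebra_simps)
  \<comment> \<open>Commutativity of convolution, by reflecting \<open>y\<close> to
    \<open>x - y\<close>.\<close>
  also have "(\<Sum>y\<in>{0..<p}. b y * i (x - y)) = (\<Sum>y\<in>{0..<p}. b (x - y) * i (x - (x - y)))"
    by (rule sum_shift(3)[of "\<lambda>y. b y * i (x - y)", symmetric])
      (use assms in \<open>simp add: defs add_diff_eq diff_add_eq[symmetric] diff_diff_add[symmetric]\<close>,
       metis assms diff_add_cancel diff_diff_eq per_def)
  also have "\<dots> = (\<Sum>y\<in>{0..<p}. i y * b (x - y))" by (simp add: mult.commute)
  also have "(\<Sum>y\<in>{0..<p}. i y * (i (x - y) + a (x - y))) + (\<Sum>y\<in>{0..<p}. i y * b (x - y))
      = rep (A \<union> B) (A \<inter> B) x"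
    unfolding rep_sum defs sum.distrib[symmetric] by (intro sum.cong) auto
  also have "(\<Sum>y\<in>{0..<p}. b y * a (x - y)) = rep (A - B) (B - A) x"
    unfolding rep_sum defs by simp
  finally show ?thesis .
qed

lemma rep_shift:
  "rep A {x. x - e \<in> B} (x + e) = rep A B x" if "per A" "per B"
proof -
  have "rep A B x = msr {y. y - e \<in> {y. y \<in> B \<and> x - y \<in> A}}"
    unfolding rep_def by (rule msr_shift(2)[symmetric]) (use that in auto)
  then show ?thesis unfolding rep_def by (simp add: algebra_simps)
qed

text \<open>Otherwise every translate of \<open>B\<close> that meets \<open>A\<close> lies in
  \<open>A\<close>, and \<open>A\<close> is closed under adding the difference of two distinct
  residues of \<open>B\<close>.\<close>

lemma ex_intermediate_intersection:
  assumes A: "per A" "A \<noteq> {}" "A \<noteq> UNIV" and B: "per B" "msr B \<ge> 2"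
  shows "\<exists>e. A \<inter> {x. x - e \<in> B} \<noteq> {} \<and> \<not> {x. x - e \<in> B} \<subseteq> A"
proof (rule ccontr)
  assume neg: "\<nexists>e. A \<inter> {x. x - e \<in> B} \<noteq> {} \<and> \<not> {x. x - e \<in> B} \<subseteq> A"
  have "\<not> is_singleton (B \<inter> {0..<p})" "B \<inter> {0..<p} \<noteq> {}"
    using B(2) by (auto simp: is_singleton_altdef msr_def)
  then obtain b c where bc: "b \<in> B" "c \<in> B" "b \<in> {0..<p}" "c \<in> {0..<p}" "b \<noteq> c"
    by (metis IntE equals0I is_singletonI')
  have "\<not> p dvd (c - b)"
    using bc by (metis atLeastLessThan_iff mod_eq_dvd_iff mod_pos_pos_trivial)
  moreover have "a + (c - b) \<in> A" if "a \<in> A" for a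
  proof -
    have "{x. x - (a - b) \<in> B} \<subseteq> A" using neg that bc(1) by force
    then show ?thesis using bc(2) by (auto simp: subset_iff)
  qed
  ultimately show False using closed_under_shift_UNIV[OF A(1,2), of "c - b"] A(3) by blast
qed

text \<open>Induction on |B| by Dyson transforms. After a translation the intersection has size i
  with 0 < i < |B|. If t <= i, the pair (union, intersection) suffices. If t > i, all
  representations of that pair count in full, as each x has at most i of them, and the pair of
  differences supplies the remaining level t - i.\<close>

theorem pollard:
  assumes "per A" "per B" "t \<le> msr A" "t \<le> msr B" "msr A + msr B \<le> nat p + t"
  shows "t * (msr A + msr B) \<le> (\<Sum>x\<in>{0..<p}. min t (rep A B x)) + t * t"
  using assms
proof (induction "msr B" arbitrary: A B t rule: less_induct)
  case less
  note A = less.prems(1) and B = less.prems(2)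
  consider "t = 0" | "t = msr B" | "0 < t" "t < msr B" using less.prems by linarith
  then show ?case
  proof cases
    case 2
    have "(\<Sum>x\<in>{0..<p}. min t (rep A B x)) = (\<Sum>x\<in>{0..<p}. rep A B x)"
      using 2 rep_le by (intro sum.cong) auto
    then show ?thesis using sum_rep[OF A] 2 by (simp add: algebra_simps)
  next
    case 3
    have "msr A < nat p" "msr A > 0" using 3 less.prems by linarith+
    then have "A \<noteq> {}" "A \<noteq> UNIV" by auto
    then obtain e where e: "A \<inter> {x. x - e \<in> B} \<noteq> {}" "\<not> {x. x - e \<in> B} \<subseteq> A"
      using ex_intermediate_intersection[OF A _ _ B] 3 by fastforce
    define C where "C = {x. x - e \<in> B}"
    have C: "per C" "msr C = msr B" using B by (auto simp: C_def)
    have sums: "(\<Sum>x\<in>{0..<p}. min t (rep A B x)) = (\<Sum>x\<in>{0..<p}. min t (rep A C x))"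
      using sum_shift(1)[of "\<lambda>x. min t (rep A C x)" e] rep_shift[OF A B, of e] A
      by (simp add: C_def)
    define i where "i = msr (A \<inter> C)"
    have "i > 0" unfolding i_def using msr_0_iff[of "A \<inter> C"] A C e(1) C_def by auto
    have mU: "msr (A \<union> C) + i = msr A + msr B" and mA: "msr (A - C) + i = msr A"
      and mC: "msr (C - A) + i = msr B"
      using msr_Un_Int[of A C] msr_Diff[of A C] msr_Diff[of C A] C(2)
      by (simp_all add: i_def Int_commute)
    have "msr (C - A) > 0" using msr_0_iff[of "C - A"] e(2) A C unfolding C_def by blast
    then have "i < msr B" using mC by linarith
    show ?thesis
    proof (cases "t \<le> i")
      case True
      have "t * (msr (A \<union> C) + msr (A \<inter> C)) \<le> (\<Sum>x\<in>{0..<p}. min t (rep (A \<union> C) (A \<inter> C) x)) + t * t"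
        using True mU \<open>i < msr B\<close> A C less.prems mA
        by (intro less.hyps) (auto simp: i_def)
      also have "(\<Sum>x\<in>{0..<p}. min t (rep (A \<union> C) (A \<inter> C) x)) \<le> (\<Sum>x\<in>{0..<p}. min t (rep A C x))"
        using rep_split[OF A C(1)] by (intro sum_mono) simp
      finally show ?thesis using mU sums by (simp add: i_def)
    next
      case False
      define s where "s = t - i"
      have s: "t = s + i" using False by (simp add: s_def)
      have "s * (msr (A - C) + msr (C - A)) \<le> (\<Sum>x\<in>{0..<p}. min s (rep (A - C) (C - A) x)) + s * s"
        using \<open>i > 0\<close> A C less.prems mA mC s by (intro less.hyps) auto
      moreover have "(\<Sum>x\<in>{0..<p}. rep (A \<union> C) (A \<inter> C) x) = msr (A \<union> C) * i"
        unfolding i_def by (rule sum_rep) (use A C in auto)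
      moreover have "(\<Sum>x\<in>{0..<p}. rep (A \<union> C) (A \<inter> C) x) + (\<Sum>x\<in>{0..<p}. min s (rep (A - C) (C - A) x))
          \<le> (\<Sum>x\<in>{0..<p}. min t (rep A C x))"
        unfolding sum.distrib[symmetric]
      proof (rule sum_mono)
        fix x
        have "rep (A \<union> C) (A \<inter> C) x \<le> i" unfolding i_def by (rule rep_le)
        then show "rep (A \<union> C) (A \<inter> C) x + min s (rep (A - C) (C - A) x) \<le> min t (rep A C x)"
          using rep_split[OF A C(1), of x] s by auto
      qed
      ultimately have "msr (A \<union> C) * i + s * (msr (A - C) + msr (C - A))
          \<le> (\<Sum>x\<in>{0..<p}. min t (rep A C x)) + s * s" by linarith
      moreover have "t * (msr A + msr B) + s * s = msr (A \<union> C) * i + s * (msr (A - C) + msr (C - A)) + t * t"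
      proof -
        have "msr A = msr (A - C) + i" "msr B = msr (C - A) + i" using mA mC by auto
        moreover from this have "msr (A \<union> C) = msr (A - C) + msr (C - A) + i" using mU by linarith
        ultimately show ?thesis unfolding s by (simp add: algebra_simps)
      qed
      ultimately show ?thesis using sums by linarith
    qed
  qed simp
qed

definition sumset :: "int set \<Rightarrow> int set \<Rightarrow> int set" where
  "sumset A B = {x. \<exists>y\<in>B. x - y \<in> A}"

lemma sumsetI: "a \<in> A \<Longrightarrow> b \<in> B \<Longrightarrow> a + b \<in> sumset A B"
  unfolding sumset_def by (auto intro!: bexI[of _ b])

lemma sumsetE: "x \<in> sumset A B \<Longrightarrow> (\<And>a b. a \<in> A \<Longrightarrow> b \<in> B \<Longrightarrow> x = a + b \<Longrightarrow> P) \<Longrightarrow> P"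
  unfolding sumset_def by force

lemma per_sumset [simp, intro]: "per A \<Longrightarrow> per (sumset A B)"
  unfolding sumset_def per_def by (simp add: add_diff_eq diff_add_eq[symmetric])

text \<open>Pollard's inequality with t = 1. When |A| + |B| > p + 1 its size condition fails, but
  then x - A and B meet for every x by pigeonhole.\<close>

theorem cauchy_davenport:
  assumes A: "per A" "A \<noteq> {}" and B: "per B" "B \<noteq> {}"
  shows "msr (sumset A B) \<ge> min (nat p) (msr A + msr B - 1)"
proof (cases "msr A + msr B \<le> nat p + 1")
  case True
  have pos: "msr A > 0" "msr B > 0" using A B msr_0_iff by auto
  have "1 * (msr A + msr B) \<le> (\<Sum>x\<in>{0..<p}. min 1 (rep A B x)) + 1 * 1"
    using A B True pos by (intro pollard) auto
  also have "(\<Sum>x\<in>{0..<p}. min 1 (rep A B x)) \<le> (\<Sum>x\<in>{0..<p}. of_bool (x \<in> sumset A B))"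
  proof (rule sum_mono)
    fix x
    show "min 1 (rep A B x) \<le> of_bool (x \<in> sumset A B)"
    proof (cases "x \<in> sumset A B")
      case False
      then have "{y. y \<in> B \<and> x - y \<in> A} = {}" by (auto simp: sumset_def)
      then have "rep A B x = 0" unfolding rep_def by (simp only: msr_empty)
      then show ?thesis by simp
    qed simp
  qed
  also have "\<dots> = msr (sumset A B)" by (simp add: msr_sum)
  finally show ?thesis by simp
next
  case False
  have "x \<in> sumset A B" for x
  proof (rule ccontr)
    assume "x \<notin> sumset A B"
    then have "{y. x - y \<in> A} \<inter> B = {}" by (auto simp: sumset_def)
    then have "msr ({y. x - y \<in> A} \<union> B) = msr A + msr B"
      using msr_Un_Int[of "{y. x - y \<in> A}" B] A by simp
    then show False using msr_le_p[of "{y. x - y \<in> A} \<union> B"] False by linarith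
  qed
  then have "sumset A B = UNIV" by auto
  then show ?thesis by simp
qed

end

section \<open>Robust Dyson transforms\<close>

lemma Cauchy_Schwarz_of_bool:
  fixes f :: "'a \<Rightarrow> real"
  assumes "finite X"
  shows "(\<Sum>x\<in>X. of_bool (P x) * f x)\<^sup>2 \<le> real (card {x\<in>X. P x}) * (\<Sum>x\<in>X. (f x)\<^sup>2)"
proof -
  have "(\<Sum>x\<in>X. of_bool (P x) :: real) = real (card {x\<in>X. P x})"
    using assms by (simp add: Int_def)
  then show ?thesis
    using Cauchy_Schwarz_ineq_sum[of "\<lambda>x. of_bool (P x)" f X] by (simp add: power2_eq_square of_bool_conj[symmetric])
qed

lemma sum_swap3: "(\<Sum>x\<in>X. \<Sum>y\<in>Y. \<Sum>z\<in>Z. H x y z) = (\<Sum>y\<in>Y. \<Sum>z\<in>Z. \<Sum>x\<in>X. H x y z)"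
  by (subst sum.swap) (intro sum.cong refl sum.swap)

context prime_modulus
begin

text \<open>The error measure that replaces the inclusion of A + B in \<open>S\<close>.\<close>

definition misses :: "int set \<Rightarrow> int set \<Rightarrow> int set \<Rightarrow> nat" where
  "misses S A B = (\<Sum>x\<in>{0..<p}. \<Sum>y\<in>{0..<p}. of_bool (x \<in> A \<and> y \<in> B \<and> x + y \<notin> S))"

lemma misses_alt:
  assumes "per A" "per S"
  shows "misses S A B = (\<Sum>x\<in>{0..<p}. of_bool (x \<notin> S) * rep A B x)"
proof -
  have "misses S A B = (\<Sum>y\<in>{0..<p}. \<Sum>x\<in>{0..<p}. of_bool (x \<in> A \<and> y \<in> B \<and> x + y \<notin> S))"
    unfolding misses_def by (rule sum.swap)
  also have "\<dots> = (\<Sum>y\<in>{0..<p}. \<Sum>x\<in>{0..<p}. of_bool (x - y \<in> A \<and> y \<in> B \<and> x \<notin> S))"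
  proof (rule sum.cong[OF refl])
    fix y
    show "(\<Sum>x\<in>{0..<p}. of_bool (x \<in> A \<and> y \<in> B \<and> x + y \<notin> S)) =
      (\<Sum>x\<in>{0..<p}. of_bool (x - y \<in> A \<and> y \<in> B \<and> x \<notin> S) :: nat)"
      using sum_shift(1)[of "\<lambda>x. of_bool (x - y \<in> A \<and> y \<in> B \<and> x \<notin> S) :: nat" y] assms
      by (simp add: add_diff_eq diff_add_eq[symmetric])
  qed
  also have "\<dots> = (\<Sum>x\<in>{0..<p}. \<Sum>y\<in>{0..<p}. of_bool (x - y \<in> A \<and> y \<in> B \<and> x \<notin> S))"
    by (rule sum.swap)
  also have "\<dots> = (\<Sum>x\<in>{0..<p}. of_bool (x \<notin> S) * rep A B x)"
    unfolding rep_sum sum_distrib_left by (intro sum.cong) auto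
  finally show ?thesis .
qed

lemma misses_fiber: "misses S A B = (\<Sum>y\<in>{0..<p}. of_bool (y \<in> B) * msr {x. x \<in> A \<and> x + y \<notin> S})"
  unfolding misses_def msr_sum sum_distrib_left by (subst sum.swap) (intro sum.cong, auto)

lemma misses_le:
  assumes "\<And>y. y \<in> B \<Longrightarrow> real (msr {x. x \<in> A \<and> x + y \<notin> S}) \<le> u"
  shows "real (misses S A B) \<le> u * msr B"
proof -
  have "real (misses S A B) = (\<Sum>y\<in>{0..<p}. of_bool (y \<in> B) * real (msr {x. x \<in> A \<and> x + y \<notin> S}))"
    unfolding misses_fiber by simp
  also have "\<dots> \<le> (\<Sum>y\<in>{0..<p}. u * of_bool (y \<in> B))"
    using assms by (intro sum_mono) auto
  also have "\<dots> = u * msr B" unfolding msr_sum by (simp add: sum_distrib_left)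
  finally show ?thesis .
qed

text \<open>The truncated count min(t, r) is at most t on \<open>S\<close> and at most r off
  \<open>S\<close>, and the values r off \<open>S\<close> add up to \<open>misses\<close>.\<close>

lemma pollard_robust:
  assumes "per A" "per B" "per S" "t \<le> msr A" "t \<le> msr B" "msr A + msr B \<le> nat p + t"
  shows "t * (msr A + msr B) \<le> t * msr S + misses S A B + t * t"
proof -
  have "(\<Sum>x\<in>{0..<p}. min t (rep A B x)) \<le>
      (\<Sum>x\<in>{0..<p}. t * of_bool (x \<in> S) + of_bool (x \<notin> S) * rep A B x)"
    by (intro sum_mono) auto
  also have "\<dots> = t * msr S + misses S A B"
    using assms unfolding misses_alt[OF assms(1,3)] msr_sum by (simp add: sum.distrib sum_distrib_left)
  finally show ?thesis using pollard[OF assms(1,2,4-6)] by linarith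
qed

text \<open>A bad pair (x, y) of the transformed sets is bad for (A, B) itself if x is in A. If x is
  in B + e, the exchanged pair (y + e, x - e) is bad with the same sum. Hence the factor 2.\<close>

lemma misses_dyson:
  assumes "per A" "per B" "per S"
  shows "misses S (A \<union> {x. x - e \<in> B}) {y. y \<in> B \<and> y + e \<in> A} \<le> 2 * misses S A B"
proof -
  define G :: "int \<Rightarrow> int \<Rightarrow> nat" where "G x y = of_bool (x \<in> A \<and> y \<in> B \<and> x + y \<notin> S)" for x y
  have perG: "G (x + p) y = G x y" "G x (y + p) = G x y" for x y
    using assms per_def_mem[of S "x + y"] by (simp_all add: G_def add.assoc add.commute[of p] add.left_commute[of p])
  have "misses S (A \<union> {x. x - e \<in> B}) {y. y \<in> B \<and> y + e \<in> A} \<le>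
      (\<Sum>x\<in>{0..<p}. \<Sum>y\<in>{0..<p}. G x y + G (y + e) (x - e))"
    unfolding misses_def G_def by (intro sum_mono) (auto simp: add.commute)
  also have "\<dots> = (\<Sum>x\<in>{0..<p}. \<Sum>y\<in>{0..<p}. G x y) + (\<Sum>x\<in>{0..<p}. \<Sum>y\<in>{0..<p}. G (y + e) (x - e))"
    by (simp add: sum.distrib)
  also have "(\<Sum>x\<in>{0..<p}. \<Sum>y\<in>{0..<p}. G (y + e) (x - e)) = (\<Sum>x\<in>{0..<p}. \<Sum>y\<in>{0..<p}. G y (x - e))"
    by (intro sum.cong refl sum_shift(1)[of "\<lambda>y. G y (_ - e)"] perG)
  also have "\<dots> = (\<Sum>y\<in>{0..<p}. \<Sum>x\<in>{0..<p}. G y (x - e))" by (rule sum.swap)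
  also have "\<dots> = (\<Sum>y\<in>{0..<p}. \<Sum>x\<in>{0..<p}. G y x)"
    by (intro sum.cong refl sum_shift(2)[of "\<lambda>x. G _ x"] perG)
  finally show ?thesis unfolding misses_def G_def by simp
qed

section \<open>Correlations, additive energy, and translates that meet in an intermediate
  proportion\<close>

definition corr :: "int set \<Rightarrow> int set \<Rightarrow> int \<Rightarrow> nat" where
  "corr A B e = msr {y. y \<in> B \<and> y + e \<in> A}"

lemma corr_rep: "corr A B e = rep A {y. - y \<in> B} e" if "per A" "per B"
proof -
  have "msr {y. - y \<in> {y. y \<in> B \<and> y + e \<in> A}} = msr {y. y \<in> B \<and> y + e \<in> A}"
    by (rule msr_shift(4)) (use that in auto)
  then show ?thesis unfolding corr_def rep_def by (simp add: algebra_simps)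
qed

lemma sum_corr:
  assumes "per A" "per B"
  shows "(\<Sum>e\<in>{0..<p}. corr A B e) = msr A * msr B"
  using sum_rep[OF assms(1), of "{y. - y \<in> B}"] assms by (simp add: corr_rep)

lemma corr_le: "corr A B e \<le> msr B"
  unfolding corr_def by (rule msr_mono) auto

lemma corr_add_p [simp]: "per A \<Longrightarrow> corr A B (e + p) = corr A B e"
  unfolding corr_def by (simp add: add.assoc[symmetric])

text \<open>Both sides are the additive energy: a + b = a' + b' exactly when a - b' = a' -
  b.\<close>

lemma sum_rep_square:
  assumes A: "per A"
  shows "(\<Sum>x\<in>{0..<p}. (rep A B x)\<^sup>2) = (\<Sum>e\<in>{0..<p}. (corr A B e)\<^sup>2)"
proof -
  define G :: "int \<Rightarrow> int \<Rightarrow> int \<Rightarrow> nat"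
    where "G x y z = of_bool (y \<in> B) * of_bool (z \<in> B) * (of_bool (x + y \<in> A) * of_bool (x + z \<in> A))" for x y z
  have perG: "G (x + p) y z = G x y z" for x y z
    using A by (simp add: G_def add.assoc add.commute[of p]) (simp add: add.assoc[symmetric])
  have "(\<Sum>x\<in>{0..<p}. (rep A B x)\<^sup>2) = (\<Sum>x\<in>{0..<p}. \<Sum>y\<in>{0..<p}. \<Sum>z\<in>{0..<p}. G (x - (y + z)) y z)"
    unfolding rep_sum power2_eq_square sum_product G_def
    by (intro sum.cong) (auto simp: algebra_simps)
  also have "\<dots> = (\<Sum>y\<in>{0..<p}. \<Sum>z\<in>{0..<p}. \<Sum>x\<in>{0..<p}. G (x - (y + z)) y z)"
    by (rule sum_swap3)
  also have "\<dots> = (\<Sum>y\<in>{0..<p}. \<Sum>z\<in>{0..<p}. \<Sum>x\<in>{0..<p}. G x y z)"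
    by (intro sum.cong refl sum_shift(2)[of "\<lambda>x. G x _ _"] perG)
  also have "\<dots> = (\<Sum>x\<in>{0..<p}. \<Sum>y\<in>{0..<p}. \<Sum>z\<in>{0..<p}. G x y z)"
    by (rule sum_swap3[symmetric])
  also have "\<dots> = (\<Sum>e\<in>{0..<p}. (corr A B e)\<^sup>2)"
    unfolding corr_def msr_sum power2_eq_square sum_product G_def
    by (intro sum.cong) (auto simp: algebra_simps)
  finally show ?thesis .
qed

text \<open>Cauchy-Schwarz over \<open>S\<close>, applied to the |A||B| - \<open>misses\<close>
  pairs whose sum lies in \<open>S\<close>.\<close>

lemma energy_lower_bound:
  assumes "per A" "per B" "per S"
  shows "(real (msr A) * real (msr B) - real (misses S A B))\<^sup>2
    \<le> real (msr S) * (\<Sum>e\<in>{0..<p}. (real (corr A B e))\<^sup>2)"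
proof -
  have "(\<Sum>x\<in>{0..<p}. rep A B x) = (\<Sum>x\<in>{0..<p}. of_bool (x \<in> S) * rep A B x + of_bool (x \<notin> S) * rep A B x)"
    by (intro sum.cong) auto
  then have "msr A * msr B = (\<Sum>x\<in>{0..<p}. of_bool (x \<in> S) * rep A B x) + misses S A B"
    unfolding sum_rep[OF assms(1)] misses_alt[OF assms(1,3)] by (simp add: sum.distrib)
  then have "real (msr A * msr B) = real ((\<Sum>x\<in>{0..<p}. of_bool (x \<in> S) * rep A B x) + misses S A B)"
    by (rule arg_cong)
  then have "real (msr A) * real (msr B) - real (misses S A B) = (\<Sum>x\<in>{0..<p}. of_bool (x \<in> S) * real (rep A B x))"
    by simp
  also have "\<dots>\<^sup>2 \<le> real (card {x\<in>{0..<p}. x \<in> S}) * (\<Sum>x\<in>{0..<p}. (real (rep A B x))\<^sup>2)"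
    by (rule Cauchy_Schwarz_of_bool) simp
  also have "card {x\<in>{0..<p}. x \<in> S} = msr S" unfolding msr_def by (rule arg_cong[of _ _ card]) auto
  also have "(\<Sum>x\<in>{0..<p}. (real (rep A B x))\<^sup>2) = real (\<Sum>x\<in>{0..<p}. (rep A B x)\<^sup>2)" by simp
  also have "\<dots> = (\<Sum>e\<in>{0..<p}. (real (corr A B e))\<^sup>2)" unfolding sum_rep_square[OF assms(1)] by simp
  finally show ?thesis .
qed


lemma per_corr_gt [simp, intro]: "per A \<Longrightarrow> per {e. real (corr A B e) > u}"
  by (rule perI) simp

text \<open>If no intersection \<open>B \<inter> (A - e)\<close> had intermediate size, the energy would force
  \<open>E = {e. B + e \<subseteq> A}\<close> (up to few exceptions) to have more than \<open>|A| - |B|\<close> elements by a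
  margin of order \<open>|B|\<^sup>2 / n\<close>, which Pollard's inequality for \<open>E + B\<close> in \<open>A\<close> forbids.\<close>

lemma ex_intermediate_corr:
  fixes n :: nat and \<eta> c :: real
  assumes per: "per A" "per B" "per S"
    and sizes: "msr A + msr B = 2 * n" "msr B \<le> n" "\<eta> * n \<le> msr B" "msr S \<le> 2 * n" "3 * n \<le> nat p"
    and eta: "0 < \<eta>" "\<eta> \<le> 1/2" and large: "32 \<le> \<eta>\<^sup>2 * n"
    and miss: "real (misses S A B) \<le> \<eta> ^ 3 * n\<^sup>2 / 16"
    and c: "c = \<eta> ^ 4 / 4096"
  shows "\<exists>e. c * msr B \<le> corr A B e \<and> corr A B e \<le> (1 - c) * msr B"
proof (rule ccontr)
  assume "\<not> ?thesis"
  then have gap: "corr A B e < c * msr B \<or> corr A B e > (1 - c) * msr B" for e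
    by (auto simp: not_le)
  define a b M N where "a = real (msr A)" "b = real (msr B)" "M = real (misses S A B)" "N = real n"
  note ab = this(1,2)
  note defs = a_b_M_N_def
  define E where "E = {e. real (corr A B e) > (1 - c) * b}"
  define x where "x = real (msr E)"
  have perE: "per E" using per by (auto simp: E_def)
  have "N > 0" using large eta by (cases n) (auto simp: defs)
  have "real (msr A + msr B) = real (2 * n)" using sizes(1) by (rule arg_cong)
  then have b1: "b \<ge> \<eta> * N" "b \<le> N" "a = 2 * N - b"
    using sizes unfolding defs by linarith+
  have "\<eta> * N > 0" using eta \<open>N > 0\<close> by simp
  then have b0: "b \<ge> \<eta> * N" "b > 0" "b \<le> N" "a = 2 * N - b" "a \<ge> N"
    using b1 by linarith+
  have c0: "0 < c" "c \<le> 1/4"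
  proof -
    have "\<eta> ^ 4 \<le> 1 ^ 4" using eta by (intro power_mono) auto
    then show "c \<le> 1/4" using c by simp
    show "0 < c" unfolding c using eta by simp
  qed
  have x_le: "x * ((1 - c) * b) \<le> a * b"
  proof -
    have "x * ((1 - c) * b) = (\<Sum>e\<in>{0..<p}. of_bool (e \<in> E) * ((1 - c) * b))"
      unfolding x_def msr_sum by (simp add: sum_distrib_right)
    also have "\<dots> \<le> (\<Sum>e\<in>{0..<p}. real (corr A B e))"
      by (intro sum_mono) (auto simp: E_def)
    also have "\<dots> = real (\<Sum>e\<in>{0..<p}. corr A B e)" by simp
    also have "\<dots> = a * b" using sum_corr[OF per(1,2)] by (simp add: defs)
    finally show ?thesis .
  qed
  then have "x * (1 - c) \<le> a" using b0 by (simp add: mult.assoc[symmetric])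
  moreover have "x * (3/4) \<le> x * (1 - c)" using c0 by (intro mult_left_mono) (auto simp: x_def)
  ultimately have x: "x * (3/4) \<le> a" by linarith
  then have xN: "x \<le> 4 * N" using b0 by linarith
  \<comment> \<open>Each e in E has B + e inside A up to c b elements, so E + B is almost contained
    in A.\<close>
  have missE: "real (misses A E B) \<le> c * b * x"
  proof -
    have "misses A E B = misses A B E"
      unfolding misses_def by (subst sum.swap) (intro sum.cong refl, auto simp: add.commute)
    also have "real (misses A B E) \<le> c * b * msr E"
    proof (rule misses_le)
      fix e assume "e \<in> E"
      have "msr {y. y \<in> B \<and> y + e \<notin> A} + corr A B e = msr B"
        using msr_Diff[of B "{y. y + e \<in> A}"] unfolding corr_def
        by (simp add: Int_def set_diff_eq)
      then have "real (msr {y. y \<in> B \<and> y + e \<notin> A}) + real (corr A B e) = b"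
        unfolding ab by (metis of_nat_add)
      then show "real (msr {y. y \<in> B \<and> y + e \<notin> A}) \<le> c * b"
        using \<open>e \<in> E\<close> by (simp add: E_def algebra_simps)
    qed
    finally show ?thesis by (simp add: x_def)
  qed
  \<comment> \<open>The level t balances two losses in Pollard's inequality, t itself and the bad
    pairs divided by t. As b >= \<eta> n, this choice keeps both small against b^2 / n (facts 4 and
    5).\<close>
  define t where "t = nat \<lfloor>\<eta>\<^sup>2 * N / 16\<rfloor>"
  define T where "T = real t"
  have T: "T \<le> \<eta>\<^sup>2 * N / 16" "\<eta>\<^sup>2 * N / 32 \<le> T"
    using large unfolding T_def t_def defs by linarith+
  have "T > 0" using T(2) large by (auto simp: defs)
  \<comment> \<open>Pollard's inequality for E + B in A, divided by t: |E| exceeds |A| - |B| by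
    little.\<close>
  have x_upper: "x \<le> a - b + T + c * b * x / T"
  proof (cases "t \<le> msr E")
    case True
    have "\<eta>\<^sup>2 * N / 16 \<le> \<eta> * N"
      using eta \<open>N > 0\<close> by (simp add: power2_eq_square)
    then have "T \<le> b" using T b0 by linarith
    then have "t \<le> msr B" by (simp add: T_def defs)
    moreover have "x + b \<le> 3 * N"
      using x b0 by linarith
    then have "real (msr E + msr B) \<le> real (3 * n)" by (simp add: x_def defs)
    then have "msr E + msr B \<le> nat p + t" using sizes(5) by linarith
    ultimately have "t * (msr E + msr B) \<le> t * msr A + misses A E B + t * t"
      using True per perE by (intro pollard_robust) auto
    then have "real (t * (msr E + msr B)) \<le> real (t * msr A + misses A E B + t * t)"
      by (rule of_nat_mono)
    then have "T * (x + b) \<le> T * a + c * b * x + T * T"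
      using missE by (simp add: T_def x_def defs)
    then show ?thesis using \<open>T > 0\<close> by (simp add: field_simps)
  next
    case False
    then have "x \<le> T" by (simp add: x_def T_def)
    moreover have "0 \<le> c * b * x / T" using c0 b0 \<open>T > 0\<close> by (simp add: x_def)
    ultimately show ?thesis using b0 by linarith
  qed
  \<comment> \<open>Elements of E contribute at most b^2 each. Elsewhere the correlation is below c
    b, so its square is at most c b times itself, and correlations add up to a b.\<close>
  have corr_sum: "(\<Sum>e\<in>{0..<p}. (real (corr A B e))\<^sup>2) \<le> x * b\<^sup>2 + c * b * (a * b)"
  proof -
    have "(\<Sum>e\<in>{0..<p}. (real (corr A B e))\<^sup>2) \<le>
        (\<Sum>e\<in>{0..<p}. of_bool (e \<in> E) * b\<^sup>2 + c * b * real (corr A B e))"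
    proof (rule sum_mono)
      fix e
      have r: "real (corr A B e) \<le> b" using corr_le[of A B e] by (simp add: defs)
      show "(real (corr A B e))\<^sup>2 \<le> of_bool (e \<in> E) * b\<^sup>2 + c * b * real (corr A B e)"
      proof (cases "e \<in> E")
        case True
        have "(real (corr A B e))\<^sup>2 \<le> b\<^sup>2" using r by (intro power_mono) auto
        then show ?thesis using True c0 b0 by (simp add: add_increasing2)
      next
        case False
        then have "real (corr A B e) \<le> c * b" using gap[of e] by (auto simp: E_def ab)
        then show ?thesis using False by (simp add: power2_eq_square mult_right_mono)
      qed
    qed
    also have "\<dots> = x * b\<^sup>2 + c * b * real (\<Sum>e\<in>{0..<p}. corr A B e)"
      unfolding x_def msr_sum by (simp add: sum.distrib sum_distrib_left sum_distrib_right)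
    also have "\<dots> = x * b\<^sup>2 + c * b * (a * b)"
      using sum_corr[OF per(1,2)] by (simp add: defs)
    finally show ?thesis .
  qed
  have "(a * b - M)\<^sup>2 \<le> real (msr S) * (x * b\<^sup>2 + c * b * (a * b))"
    using energy_lower_bound[OF per] corr_sum unfolding defs
    by (meson mult_left_mono of_nat_0_le_iff order_trans)
  also have "\<dots> \<le> (2 * N) * (x * b\<^sup>2 + c * b * (a * b))"
    using sizes c0 b0 by (intro mult_right_mono) (auto simp: defs x_def)
  also have "\<dots> = b\<^sup>2 * ((2 * N) * (x + c * a))" by (simp add: power2_eq_square algebra_simps)
  finally have 1: "(a * b - M)\<^sup>2 \<le> b\<^sup>2 * ((2 * N) * (x + c * a))" .
  have 2: "a\<^sup>2 * b\<^sup>2 - 2 * a * b * M \<le> (a * b - M)\<^sup>2"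
    by (simp add: power2_diff power_mult_distrib algebra_simps)
  have e2: "\<eta>\<^sup>2 * N\<^sup>2 \<le> b\<^sup>2"
    using b0 eta \<open>N > 0\<close> power_mono[of "\<eta> * N" b 2] by (simp add: power_mult_distrib)
  have 3: "2 * a * b * M \<le> b\<^sup>2 * (b\<^sup>2 / 4)"
  proof -
    have "2 * a * M \<le> 2 * (2 * N) * (\<eta> ^ 3 * N\<^sup>2 / 16)"
      using miss b0 by (intro mult_mono) (auto simp: defs)
    also have "\<dots> = (\<eta> * N) * (\<eta>\<^sup>2 * N\<^sup>2 / 4)" by (simp add: power2_eq_square power3_eq_cube)
    also have "\<dots> \<le> b * (b\<^sup>2 / 4)" using b0 e2 by (intro mult_mono) auto
    finally have "b * (2 * a * M) \<le> b * (b * (b\<^sup>2 / 4))" using b0 by (intro mult_left_mono) auto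
    then show ?thesis by (simp add: power2_eq_square algebra_simps)
  qed
  have 4: "2 * N * T \<le> b\<^sup>2 / 8"
  proof -
    have "2 * N * T \<le> 2 * N * (\<eta>\<^sup>2 * N / 16)" using T \<open>N > 0\<close> by (intro mult_left_mono) auto
    then show ?thesis using e2 by (simp add: power2_eq_square algebra_simps)
  qed
  \<comment> \<open>Origin of the value of \<open>c\<close>: 128 c N / \<eta>^2 has to be at most
    \<eta>^2 N / 32.\<close>
  have 5: "2 * N * (c * b * x / T) \<le> b\<^sup>2 / 16"
  proof -
    have "c * b * x / T \<le> (c * N * (4 * N)) / (\<eta>\<^sup>2 * N / 32)"
      using T b0 c0 xN large eta \<open>N > 0\<close> by (intro frac_le mult_mono mult_nonneg_nonneg) (auto simp: x_def)
    also have "\<dots> = \<eta>\<^sup>2 * N / 32" using \<open>N > 0\<close> eta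
      by (simp add: c power2_eq_square eval_nat_numeral field_simps)
    finally have "2 * N * (c * b * x / T) \<le> 2 * N * (\<eta>\<^sup>2 * N / 32)" using \<open>N > 0\<close> by (intro mult_left_mono) auto
    then show ?thesis using e2 by (simp add: power2_eq_square algebra_simps)
  qed
  have 6: "2 * N * (c * a) \<le> b\<^sup>2 / 8"
  proof -
    have "c \<le> \<eta>\<^sup>2 / 32"
    proof -
      have "\<eta>\<^sup>2 * \<eta>\<^sup>2 \<le> \<eta>\<^sup>2 * 1" using eta by (intro mult_left_mono) (auto intro: power_le_one)
      then have "\<eta> ^ 4 \<le> \<eta>\<^sup>2" by (simp add: power_add[symmetric])
      moreover have "0 \<le> \<eta>\<^sup>2" by simp
      ultimately show ?thesis unfolding c by linarith
    qed
    then have "c * a \<le> \<eta>\<^sup>2 / 32 * (2 * N)" using b0 c0 by (intro mult_mono) auto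
    then have "2 * N * (c * a) \<le> 2 * N * (\<eta>\<^sup>2 / 32 * (2 * N))" using \<open>N > 0\<close> by (intro mult_left_mono) auto
    then show ?thesis using e2 by (simp add: power2_eq_square algebra_simps)
  qed
  \<comment> \<open>With 2N = a + b, the energy requires 2N(x + ca) >= a^2 - b^2/4, whereas Pollard
    caps it at a^2 - b^2 + 5b^2/16. The two are 7b^2/16 apart.\<close>
  have "2 * N * (x + c * a) \<le> 2 * N * (a - b + T + c * b * x / T + c * a)"
    using x_upper \<open>N > 0\<close> by (intro mult_left_mono) auto
  also have "\<dots> \<le> 2 * N * (a - b) + 5 * b\<^sup>2 / 16"
    using 4 5 6 by (simp add: distrib_left)
  also have "2 * N = a + b" using b0 by simp
  also have "(a + b) * (a - b) = a\<^sup>2 - b\<^sup>2" by (simp add: power2_eq_square algebra_simps)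
  finally have "b\<^sup>2 * (2 * N * (x + c * a)) \<le> b\<^sup>2 * (a\<^sup>2 - b\<^sup>2 + 5 * b\<^sup>2 / 16)"
    using b0 by (intro mult_left_mono) auto
  with 1 2 3 have "a\<^sup>2 * b\<^sup>2 \<le> b\<^sup>2 * (b\<^sup>2 / 4) + b\<^sup>2 * (a\<^sup>2 - b\<^sup>2 + 5 * b\<^sup>2 / 16)"
    by linarith
  then have "b\<^sup>2 * b\<^sup>2 * (7/16) \<le> 0" by (simp add: algebra_simps)
  then show False using b0 by (simp add: mult_le_0_iff)
qed

text \<open>One transform multiplies |B'| by a factor between c and 1 - c. So when |B'| first drops
  to at most \<eta> n, it is still at least c \<eta> n and has not collapsed. Once (1 - c)^k <=
  \<eta>, either alternative gives |B'| <= \<eta> n.\<close>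

lemma dyson_shrink:
  fixes n k K :: nat and \<eta> c :: real
  assumes per: "per A" "per B" "per S"
    and sizes: "msr A = n" "msr B = n" "msr S \<le> 2 * n" "3 * n \<le> nat p"
    and eta: "0 < \<eta>" "\<eta> \<le> 1/2" and large: "32 \<le> \<eta>\<^sup>2 * n"
    and miss: "2 ^ K * real (misses S A B) \<le> \<eta> ^ 3 * n\<^sup>2 / 16"
    and c: "c = \<eta> ^ 4 / 4096" and "k \<le> K"
  shows "\<exists>A' B'. per A' \<and> per B' \<and> msr A' + msr B' = 2 * n \<and> msr B' \<le> n \<and>
    misses S A' B' \<le> 2 ^ k * misses S A B \<and>
    (c * \<eta> * n \<le> msr B' \<and> msr B' \<le> \<eta> * n \<or> \<eta> * n < msr B' \<and> msr B' \<le> (1 - c) ^ k * n)"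
  using \<open>k \<le> K\<close>
proof (induction k)
  case 0
  have "n > 0" using large eta by (cases n) auto
  then have "\<eta> * n < n" using eta by simp
  then show ?case using per sizes by (intro exI[of _ A] exI[of _ B]) auto
next
  case (Suc k)
  then obtain A' B' where IH: "per A'" "per B'" "msr A' + msr B' = 2 * n" "msr B' \<le> n"
    "misses S A' B' \<le> 2 ^ k * misses S A B"
    "c * \<eta> * n \<le> msr B' \<and> msr B' \<le> \<eta> * n \<or> \<eta> * n < msr B' \<and> msr B' \<le> (1 - c) ^ k * n" by auto
  have c0: "0 < c" "c < 1"
  proof -
    have "\<eta> ^ 4 \<le> 1 ^ 4" using eta by (intro power_mono) auto
    then show "c < 1" using c by simp
    show "0 < c" unfolding c using eta by simp
  qed
  show ?case
  proof (cases "msr B' \<le> \<eta> * n")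
    case True
    have "misses S A' B' \<le> 2 ^ Suc k * misses S A B" using IH(5) by simp
    then show ?thesis using IH True by (intro exI[of _ A'] exI[of _ B']) auto
  next
    case False
    have "real (misses S A' B') \<le> real (2 ^ k * misses S A B)" using IH(5) by (rule of_nat_mono)
    also have "\<dots> \<le> 2 ^ K * real (misses S A B)"
      using Suc.prems by (simp add: mult_right_mono)
    finally have miss': "real (misses S A' B') \<le> \<eta> ^ 3 * n\<^sup>2 / 16" using miss by linarith
    obtain e where e: "c * msr B' \<le> corr A' B' e" "corr A' B' e \<le> (1 - c) * msr B'"
      using ex_intermediate_corr[OF IH(1,2) per(3) IH(3,4) _ sizes(3,4) eta large miss' c] False by auto
    define A'' B'' where "A'' = A' \<union> {x. x - e \<in> B'}" and "B'' = {y. y \<in> B' \<and> y + e \<in> A'}"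
    have perAB: "per A''" "per B''" unfolding A''_def B''_def using IH by auto
    have mB: "msr B'' = corr A' B' e" by (simp add: B''_def corr_def)
    have "msr {y. y + e \<in> A' \<inter> {x. x - e \<in> B'}} = msr (A' \<inter> {x. x - e \<in> B'})"
      by (rule msr_shift(1)) (use IH in auto)
    then have "msr (A' \<inter> {x. x - e \<in> B'}) = msr B''" by (simp add: B''_def conj_commute)
    then have m: "msr A'' + msr B'' = 2 * n"
      using msr_Un_Int[of A' "{x. x - e \<in> B'}"] IH by (simp add: A''_def)
    have "misses S A'' B'' \<le> 2 * misses S A' B'"
      unfolding A''_def B''_def using IH per by (intro misses_dyson) auto
    then have mm: "misses S A'' B'' \<le> 2 ^ Suc k * misses S A B" using IH(5) by simp
    have up: "msr B'' \<le> (1 - c) ^ Suc k * n"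
    proof -
      have "real (msr B'') \<le> (1 - c) * msr B'" using e mB by simp
      also have "\<dots> \<le> (1 - c) * ((1 - c) ^ k * n)" using IH(6) False c0 by (intro mult_left_mono) auto
      finally show ?thesis by simp
    qed
    have "msr B'' \<le> msr B'" unfolding B''_def by (rule msr_mono) auto
    then have "msr B'' \<le> n" using IH by simp
    moreover have "c * \<eta> * n \<le> msr B''"
    proof -
      have "c * (\<eta> * n) \<le> c * msr B'" using False c0 by (intro mult_left_mono) auto
      then show ?thesis using e mB by (simp add: mult.assoc)
    qed
    ultimately show ?thesis using perAB m mm up
      by (intro exI[of _ A''] exI[of _ B'']) auto
  qed
qed

section \<open>Almost periods\<close>

text \<open>Half the size of the symmetric difference of \<open>S\<close> and its translate. It is
  symmetric and subadditive in \<open>g\<close>, so it defines an invariant pseudometric on Z_p,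
  with the sets \<open>near\<close> as balls around 0.\<close>

definition defect :: "int set \<Rightarrow> int \<Rightarrow> nat" where
  "defect S g = msr {x. x \<in> S \<and> x + g \<notin> S}"

lemma corr_plus_defect: "corr S S g + defect S g = msr S"
  using msr_Diff[of S "{x. x + g \<in> S}"] unfolding corr_def defect_def
  by (simp add: Int_def set_diff_eq)

lemma defect_add_p [simp]: "per S \<Longrightarrow> defect S (g + p) = defect S g"
  unfolding defect_def by (simp add: add.assoc[symmetric])

lemma defect_0 [simp]: "defect S 0 = 0"
  by (simp add: defect_def)

lemma defect_minus: "per S \<Longrightarrow> defect S (- g) = defect S g"
proof -
  assume S: "per S"
  have "msr {x. x + g \<in> {x. x \<in> S \<and> x + (- g) \<in> S}} = msr {x. x \<in> S \<and> x + (- g) \<in> S}"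
    by (rule msr_shift(1)) (use S in auto)
  then have "corr S S (- g) = corr S S g"
    by (simp add: corr_def conj_commute)
  then show ?thesis using corr_plus_defect[of S g] corr_plus_defect[of S "- g"] by linarith
qed

lemma defect_triangle: "per S \<Longrightarrow> defect S (g + h) \<le> defect S g + defect S h"
proof -
  assume S: "per S"
  have "defect S (g + h) \<le> msr ({x. x \<in> S \<and> x + g \<notin> S} \<union> {x. x + g \<in> {x. x \<in> S \<and> x + h \<notin> S}})"
    unfolding defect_def by (intro msr_mono) (auto simp: add.assoc)
  also have "\<dots> \<le> defect S g + msr {x. x + g \<in> {x. x \<in> S \<and> x + h \<notin> S}}"
    unfolding defect_def by (rule msr_Un_le)
  also have "msr {x. x + g \<in> {x. x \<in> S \<and> x + h \<notin> S}} = defect S h"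
    unfolding defect_def by (rule msr_shift(1)) (use S in auto)
  finally show ?thesis .
qed

definition near :: "int set \<Rightarrow> real \<Rightarrow> int set" where
  "near S w = {g. real (defect S g) \<le> w}"

lemma per_near [simp, intro]: "per S \<Longrightarrow> per (near S w)"
  by (rule perI) (simp add: near_def)

lemma zero_in_near: "w \<ge> 0 \<Longrightarrow> 0 \<in> near S w"
  by (simp add: near_def)

lemma minus_in_near: "per S \<Longrightarrow> - g \<in> near S w \<longleftrightarrow> g \<in> near S w"
  by (simp add: near_def defect_minus)

lemma near_mono: "v \<le> w \<Longrightarrow> near S v \<subseteq> near S w"
  by (auto simp: near_def)

lemma sumset_near: "per S \<Longrightarrow> sumset (near S v) (near S w) \<subseteq> near S (v + w)"
proof
  fix x assume S: "per S" and "x \<in> sumset (near S v) (near S w)"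
  then obtain a b where "a \<in> near S v" "b \<in> near S w" "x = a + b" by (blast elim: sumsetE)
  then show "x \<in> near S (v + w)"
    using defect_triangle[OF S, of a b] unfolding near_def by simp
qed

text \<open>Each element of the ball has correlation at least |S| - w, and all correlations add up
  to |S|^2.\<close>

lemma msr_near_upper:
  assumes "per S" "w \<le> real (msr S)"
  shows "msr (near S w) * (real (msr S) - w) \<le> (real (msr S))\<^sup>2"
proof -
  have "msr (near S w) * (real (msr S) - w) = (\<Sum>g\<in>{0..<p}. of_bool (g \<in> near S w) * (real (msr S) - w))"
    unfolding msr_sum[of "near S w"] by (simp add: sum_distrib_right)
  also have "\<dots> \<le> (\<Sum>g\<in>{0..<p}. real (corr S S g))"
  proof (rule sum_mono)
    fix g
    have "real (corr S S g) + real (defect S g) = real (msr S)"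
      using corr_plus_defect[of S g] by (metis of_nat_add)
    then show "of_bool (g \<in> near S w) * (real (msr S) - w) \<le> real (corr S S g)"
      by (auto simp: near_def)
  qed
  also have "\<dots> = real (\<Sum>g\<in>{0..<p}. corr S S g)" by simp
  also have "\<dots> = (real (msr S))\<^sup>2" using sum_corr[OF assms(1,1)] by (simp add: power2_eq_square)
  finally show ?thesis .
qed

text \<open>Cauchy-Davenport for the sum of the ball with itself. It is the size minus 1 that at
  least doubles.\<close>

lemma msr_near_double:
  assumes "per S" "w \<ge> 0" "near S (2 * w) \<noteq> UNIV"
  shows "2 * msr (near S w) \<le> msr (near S (2 * w)) + 1"
proof -
  have "near S w \<noteq> {}" using zero_in_near assms(2) by auto
  then have "min (nat p) (msr (near S w) + msr (near S w) - 1) \<le> msr (sumset (near S w) (near S w))"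
    using assms by (intro cauchy_davenport) auto
  also have "\<dots> \<le> msr (near S (2 * w))"
    using sumset_near[OF assms(1), of w w] by (intro msr_mono) simp
  finally show ?thesis
    using msr_p_iff[of "near S (2 * w)"] msr_le_p[of "near S (2 * w)"] assms by fastforce
qed

text \<open>If A + y and A + z lie in S up to \<delta> b elements each, then S and its translate by
  y - z share at least |A| - 2 \<delta> b = 2n - b - 2 \<delta> b elements, while |S| <= 2n. By
  Markov's inequality this applies to all but \<delta> b of the elements of B, and Cauchy-Davenport
  bounds the number of their differences from below.\<close>

lemma near_lower_bound:
  fixes \<delta> :: real and n :: nat
  assumes per: "per A" "per B" "per S"
    and sizes: "msr A + msr B = 2 * n" "msr S \<le> 2 * n"
    and b: "b = real (msr B)" "b > 0" and delta: "0 < \<delta>" "\<delta> < 1"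
    and miss: "real (misses S A B) \<le> \<delta>\<^sup>2 * b\<^sup>2"
  shows "real (msr (near S ((1 + 2 * \<delta>) * b))) \<ge> min (real_of_int p) (2 * (1 - \<delta>) * b - 1)"
    and "real (msr S) \<ge> 2 * n - (1 + \<delta>) * b"
proof -
  define u where "u y = real (msr {x. x \<in> A \<and> x + y \<notin> S})" for y
  define B1 where "B1 = {y. y \<in> B \<and> u y \<le> \<delta> * b}"
  have peru: "u (y + p) = u y" for y
    using per unfolding u_def by (simp add: add.assoc[symmetric])
  have perB1: "per B1" using per by (intro perI) (simp add: B1_def peru)
  have "(\<delta> * b) * msr (B - B1) = (\<Sum>y\<in>{0..<p}. of_bool (y \<in> B - B1) * (\<delta> * b))"
    unfolding msr_sum by (simp add: sum_distrib_left mult.commute)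
  also have "\<dots> \<le> (\<Sum>y\<in>{0..<p}. of_bool (y \<in> B) * u y)"
    by (intro sum_mono) (auto simp: B1_def u_def)
  also have "\<dots> = real (misses S A B)" unfolding misses_fiber u_def by simp
  also have "\<dots> \<le> (\<delta> * b) * (\<delta> * b)" using miss by (simp add: power2_eq_square mult_ac)
  finally have "real (msr (B - B1)) \<le> \<delta> * b"
    using delta b by (simp add: mult_le_cancel_left)
  moreover have "msr (B - B1) + msr B1 = msr B" by (rule msr_Diff_subset) (auto simp: B1_def)
  then have "real (msr (B - B1)) + real (msr B1) = b" unfolding b(1) by (metis of_nat_add)
  ultimately have mB1: "real (msr B1) \<ge> (1 - \<delta>) * b" by (simp add: algebra_simps)
  have "(1 - \<delta>) * b > 0" using delta b by simp
  then have "msr B1 > 0" using mB1 by linarith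
  then have ne: "B1 \<noteq> {}" by (metis msr_empty less_irrefl)
  have mA: "real (msr A) = 2 * n - b" using arg_cong[OF sizes(1), of real] b by simp
  have shifted: "msr {x. x \<in> A \<and> x + y \<in> S} \<ge> 2 * n - (1 + \<delta>) * b" if "y \<in> B1" for y
  proof -
    have "msr {x. x \<in> A \<and> x + y \<notin> S} + msr {x. x \<in> A \<and> x + y \<in> S} = msr A"
      using msr_Diff[of A "{x. x + y \<in> S}"] by (simp add: Int_def set_diff_eq)
    then have "u y + real (msr {x. x \<in> A \<and> x + y \<in> S}) = real (msr A)"
      unfolding u_def by (simp flip: of_nat_add)
    moreover have "u y \<le> \<delta> * b" using that by (simp add: B1_def)
    ultimately show ?thesis unfolding mA by (simp add: algebra_simps)
  qed
  obtain y where y: "y \<in> B1" using ne by auto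
  have "msr {x. x \<in> A \<and> x + y \<in> S} \<le> msr {x. x + y \<in> S}" by (rule msr_mono) auto
  also have "\<dots> = msr S" using per by simp
  finally show "real (msr S) \<ge> 2 * n - (1 + \<delta>) * b" using shifted[OF y] by linarith
  have "sumset B1 {x. - x \<in> B1} \<subseteq> near S ((1 + 2 * \<delta>) * b)"
  proof
    fix g assume "g \<in> sumset B1 {x. - x \<in> B1}"
    then obtain y z' where yz': "y \<in> B1" "z' \<in> {x. - x \<in> B1}" "g = y + z'" by (rule sumsetE)
    define z where "z = - z'"
    have yz: "y \<in> B1" "z \<in> B1" "g = y - z" using yz' by (simp_all add: z_def)
    have uu: "u z + u y \<ge> real (msr ({x. x \<in> A \<and> x + z \<notin> S} \<union> {x. x \<in> A \<and> x + y \<notin> S}))"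
      unfolding u_def of_nat_add[symmetric] of_nat_le_iff by (rule msr_Un_le)
    have le: "msr A \<le> msr {x. x + z \<in> {x. x \<in> S \<and> x + g \<in> S}} +
        msr (A - {x. x + z \<in> {x. x \<in> S \<and> x + g \<in> S}})" by (rule msr_Diff_le)
    have e1: "A - {x. x + z \<in> {x. x \<in> S \<and> x + g \<in> S}} =
        {x. x \<in> A \<and> x + z \<notin> S} \<union> {x. x \<in> A \<and> x + y \<notin> S}" using yz by auto
    have e2: "msr {x. x + z \<in> {x. x \<in> S \<and> x + g \<in> S}} = corr S S g"
      unfolding corr_def by (rule msr_shift(1)) (use per in auto)
    have "real (msr A) \<le> real (corr S S g) + (u z + u y)"
      using le uu unfolding e1 e2 by linarith
    moreover have "real (corr S S g) + real (defect S g) = real (msr S)"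
      using corr_plus_defect[of S g] by (metis of_nat_add)
    ultimately have "real (defect S g) \<le> real (msr S) - real (msr A) + (u z + u y)" by linarith
    also have "\<dots> \<le> 2 * n - (2 * n - b) + (\<delta> * b + \<delta> * b)"
      using yz sizes(2) mA by (intro add_mono diff_mono) (auto simp: B1_def)
    finally show "g \<in> near S ((1 + 2 * \<delta>) * b)" by (simp add: near_def algebra_simps)
  qed
  then have "msr (sumset B1 {x. - x \<in> B1}) \<le> msr (near S ((1 + 2 * \<delta>) * b))" by (rule msr_mono)
  moreover have "min (nat p) (msr B1 + msr {x. - x \<in> B1} - 1) \<le> msr (sumset B1 {x. - x \<in> B1})"
    using perB1 ne by (intro cauchy_davenport) (auto intro: exI[of _ "- _"])
  moreover have "msr {x. - x \<in> B1} = msr B1" using perB1 by simp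
  ultimately have "min (nat p) (2 * msr B1 - 1) \<le> msr (near S ((1 + 2 * \<delta>) * b))" by simp
  then have "min (real (nat p)) (2 * real (msr B1) - 1) \<le> real (msr (near S ((1 + 2 * \<delta>) * b)))"
    using \<open>msr B1 > 0\<close> by linarith
  then show "real (msr (near S ((1 + 2 * \<delta>) * b))) \<ge> min (real_of_int p) (2 * (1 - \<delta>) * b - 1)"
    using mB1 by (simp add: algebra_simps min_def split: if_splits)
qed

text \<open>While some translate brings more than \<open>u\<close> new elements, it is added; k
  additions give a union of size at least k u. A bound on all such unions therefore forces the first
  alternative for large k.\<close>

lemma greedy_cover:
  assumes "per A" "u \<ge> 0"
  shows "\<exists>D\<subseteq>B. finite D \<and> card D \<le> k \<and>
    ((\<forall>b\<in>B. real (msr ({x. x - b \<in> A} - sumset A D)) \<le> u) \<or> real k * u \<le> msr (sumset A D))"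
proof (induction k)
  case 0
  then show ?case by (intro exI[of _ "{}"]) auto
next
  case (Suc k)
  then obtain D where D: "D \<subseteq> B" "finite D" "card D \<le> k"
    "(\<forall>b\<in>B. real (msr ({x. x - b \<in> A} - sumset A D)) \<le> u) \<or> real k * u \<le> msr (sumset A D)" by blast
  show ?case
  proof (cases "\<forall>b\<in>B. real (msr ({x. x - b \<in> A} - sumset A D)) \<le> u")
    case True
    then show ?thesis using D by (intro exI[of _ D]) auto
  next
    case False
    then obtain b where b: "b \<in> B" "real (msr ({x. x - b \<in> A} - sumset A D)) > u" by (auto simp: not_le)
    have eq: "sumset A (insert b D) = ({x. x - b \<in> A} - sumset A D) \<union> sumset A D"
      by (auto simp: sumset_def)
    have "msr (({x. x - b \<in> A} - sumset A D) \<inter> sumset A D) = msr {}" by (rule arg_cong[of _ _ msr]) auto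
    then have "msr (sumset A (insert b D)) = msr ({x. x - b \<in> A} - sumset A D) + msr (sumset A D)"
      using msr_Un_Int[of "{x. x - b \<in> A} - sumset A D" "sumset A D"] unfolding eq by simp
    then have "real (Suc k) * u \<le> msr (sumset A (insert b D))"
      using b D(4) False by (simp add: algebra_simps)
    moreover have "card (insert b D) \<le> Suc k" using D by (simp add: card_insert_if)
    ultimately show ?thesis using D b by (intro exI[of _ "insert b D"]) auto
  qed
qed

section \<open>Fourier bias of sets of linear growth\<close>

definition ec :: "int \<Rightarrow> complex" where
  "ec x = cis (2 * pi * real_of_int x / real_of_int p)"

lemma ec_add: "ec (x + y) = ec x * ec y"
  unfolding ec_def cis_mult by (simp add: algebra_simps add_divide_distrib)

lemma ec_0 [simp]: "ec 0 = 1"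
  by (simp add: ec_def)

lemma norm_ec [simp]: "cmod (ec x) = 1"
  by (simp add: ec_def)

lemma cnj_ec: "cnj (ec x) = ec (- x)"
  by (simp add: ec_def cis_cnj)

lemma ec_eq_1_iff: "ec x = 1 \<longleftrightarrow> p dvd x"
proof
  assume "ec x = 1"
  then have "cos (2 * pi * real_of_int x / real_of_int p) = 1"
    unfolding ec_def by (metis cis.simps(1) one_complex.simps(1))
  then obtain k :: int where "2 * pi * real_of_int x / real_of_int p = real_of_int k * 2 * pi"
    by (metis cos_one_2pi_int mult.assoc)
  then have "real_of_int x = real_of_int (k * p)" by (simp add: field_simps)
  then show "p dvd x" using of_int_eq_iff by (metis dvd_triv_right)
next
  assume "p dvd x"
  then obtain k where "x = p * k" by auto
  then have "2 * pi * real_of_int x / real_of_int p = 2 * pi * real_of_int k" by simp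
  then have "ec x = cis (2 * pi * real_of_int k)" by (simp only: ec_def)
  then show "ec x = 1" by simp
qed

lemma ec_add_multiple [simp]: "ec (x + k * p) = ec x" "ec (x + p * k) = ec x" "ec (x + p) = ec x"
  using ec_eq_1_iff[of "k * p"] ec_eq_1_iff[of "p * k"] ec_eq_1_iff[of p] by (simp_all add: ec_add)

lemma sum_ec: "(\<Sum>\<xi>\<in>{0..<p}. ec (\<xi> * d)) = (if p dvd d then of_int p else 0)"
proof (cases "p dvd d")
  case True
  then have "ec (\<xi> * d) = 1" for \<xi> by (simp add: ec_eq_1_iff)
  then show ?thesis using True by simp
next
  case False
  have "(\<Sum>\<xi>\<in>{0..<p}. ec (\<xi> * d)) = (\<Sum>\<xi>\<in>{0..<p}. ec ((\<xi> + 1) * d))"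
    by (rule sum_shift(1)[of "\<lambda>\<xi>. ec (\<xi> * d)", symmetric]) (simp add: distrib_right)
  also have "\<dots> = (\<Sum>\<xi>\<in>{0..<p}. ec (\<xi> * d)) * ec d"
    by (simp add: distrib_right ec_add sum_distrib_right)
  finally have "(\<Sum>\<xi>\<in>{0..<p}. ec (\<xi> * d)) * (ec d - 1) = 0" by (simp add: algebra_simps)
  then show ?thesis using False by (simp add: ec_eq_1_iff)
qed

definition ft :: "(int \<Rightarrow> complex) \<Rightarrow> int \<Rightarrow> complex" where
  "ft F \<xi> = (\<Sum>x\<in>{0..<p}. F x * ec (\<xi> * x))"

definition conv :: "(int \<Rightarrow> complex) \<Rightarrow> (int \<Rightarrow> complex) \<Rightarrow> int \<Rightarrow> complex" where
  "conv F G y = (\<Sum>z\<in>{0..<p}. F z * G (y - z))"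

lemma ft_conv:
  assumes "\<And>x. G (x + p) = G x"
  shows "ft (conv F G) \<xi> = ft F \<xi> * ft G \<xi>"
proof -
  have "ft (conv F G) \<xi> = (\<Sum>z\<in>{0..<p}. \<Sum>y\<in>{0..<p}. F z * ec (\<xi> * z) * (G (y - z) * ec (\<xi> * (y - z))))"
    unfolding ft_def conv_def sum_distrib_right
    by (subst sum.swap) (intro sum.cong refl, simp add: ec_add[symmetric] algebra_simps)
  also have "\<dots> = (\<Sum>z\<in>{0..<p}. F z * ec (\<xi> * z) * (\<Sum>y\<in>{0..<p}. G (y - z) * ec (\<xi> * (y - z))))"
    by (simp add: sum_distrib_left)
  also have "\<dots> = (\<Sum>z\<in>{0..<p}. F z * ec (\<xi> * z) * ft G \<xi>)"
  proof (rule sum.cong[OF refl])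
    fix z
    show "F z * ec (\<xi> * z) * (\<Sum>y\<in>{0..<p}. G (y - z) * ec (\<xi> * (y - z))) = F z * ec (\<xi> * z) * ft G \<xi>"
      using sum_shift(2)[of "\<lambda>y. G y * ec (\<xi> * y)" z] assms by (simp add: ft_def distrib_left)
  qed
  finally show ?thesis by (simp add: ft_def sum_distrib_right)
qed

lemma parseval: "(\<Sum>\<xi>\<in>{0..<p}. (cmod (ft F \<xi>))\<^sup>2) = real_of_int p * (\<Sum>x\<in>{0..<p}. (cmod (F x))\<^sup>2)"
proof -
  have "complex_of_real (\<Sum>\<xi>\<in>{0..<p}. (cmod (ft F \<xi>))\<^sup>2) = (\<Sum>\<xi>\<in>{0..<p}. ft F \<xi> * cnj (ft F \<xi>))"
    by (simp only: of_real_sum complex_norm_square)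
  also have "\<dots> = (\<Sum>\<xi>\<in>{0..<p}. \<Sum>x\<in>{0..<p}. \<Sum>y\<in>{0..<p}. F x * cnj (F y) * ec (\<xi> * (x - y)))"
    unfolding ft_def cnj_sum sum_product
  proof (intro sum.cong refl)
    fix \<xi> x y
    have "ec (\<xi> * (x - y)) = ec (\<xi> * x) * cnj (ec (\<xi> * y))"
      unfolding cnj_ec ec_add[symmetric] by (simp add: right_diff_distrib)
    then show "F x * ec (\<xi> * x) * cnj (F y * ec (\<xi> * y)) = F x * cnj (F y) * ec (\<xi> * (x - y))"
      by simp
  qed
  also have "\<dots> = (\<Sum>x\<in>{0..<p}. \<Sum>y\<in>{0..<p}. \<Sum>\<xi>\<in>{0..<p}. F x * cnj (F y) * ec (\<xi> * (x - y)))"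
    by (rule sum_swap3)
  also have "\<dots> = (\<Sum>x\<in>{0..<p}. \<Sum>y\<in>{0..<p}. if y = x then F x * cnj (F x) * of_int p else 0)"
  proof (intro sum.cong refl)
    fix x y assume "x \<in> {0..<p}" "y \<in> {0..<p}"
    then have "p dvd x - y \<longleftrightarrow> y = x" by (metis atLeastLessThan_iff mod_eq_dvd_iff mod_pos_pos_trivial)
    then show "(\<Sum>\<xi>\<in>{0..<p}. F x * cnj (F y) * ec (\<xi> * (x - y))) = (if y = x then F x * cnj (F x) * of_int p else 0)"
      by (simp add: sum_distrib_left[symmetric] sum_ec)
  qed
  also have "\<dots> = (\<Sum>x\<in>{0..<p}. F x * cnj (F x) * of_int p)" by simp
  also have "\<dots> = complex_of_real (real_of_int p * (\<Sum>x\<in>{0..<p}. (cmod (F x))\<^sup>2))"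
    by (simp only: complex_norm_square sum_distrib_left of_real_mult of_real_sum of_real_of_int_eq mult.commute)
  finally show ?thesis unfolding of_real_eq_iff .
qed

text \<open>The 2^i-fold convolution of the indicator of \<open>X\<close> with itself. Repeated
  squaring fits the dyadic scales: the support moves from \<open>W j\<close> to
  \<open>W (Suc j)\<close> at each step.\<close>

fun convpow :: "int set \<Rightarrow> nat \<Rightarrow> int \<Rightarrow> complex" where
  "convpow X 0 = (\<lambda>x. of_bool (x \<in> X))"
| "convpow X (Suc i) = conv (convpow X i) (convpow X i)"

lemma convpow_per: "per X \<Longrightarrow> convpow X i (x + p) = convpow X i x"
  by (induction i arbitrary: x) (auto simp: conv_def add_diff_eq diff_add_eq[symmetric])

lemma ft_convpow: "per X \<Longrightarrow> ft (convpow X i) \<xi> = ft (convpow X 0) \<xi> ^ (2 ^ i)"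
  by (induction i) (auto simp: ft_conv convpow_per power2_eq_square mult_2 power_add simp del: convpow.simps(1))

lemma convpow_support:
  assumes "X \<subseteq> W 0" "\<And>j. j < i \<Longrightarrow> sumset (W j) (W j) \<subseteq> W (Suc j)" "x \<notin> W i"
  shows "convpow X i x = 0"
  using assms
proof (induction i arbitrary: x)
  case (Suc i)
  have "convpow X i z * convpow X i (x - z) = 0" for z
  proof (cases "z \<in> W i \<and> x - z \<in> W i")
    case True
    then have "x \<in> sumset (W i) (W i)" using sumsetI[of z "W i" "x - z" "W i"] by simp
    then show ?thesis using Suc.prems by auto
  next
    case False
    then show ?thesis using Suc.IH[of z] Suc.IH[of "x - z"] Suc.prems(1,2) by auto
  qed
  then show ?case unfolding convpow.simps conv_def by (intro sum.neutral) auto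
qed auto

text \<open>Put x = |X| and K = 2^i. The K-fold convolution has mass x^K on \<open>W i\<close>, so
  its squared L2 norm is at least x^(2K) / |W i|. If all nontrivial coefficients were at most \<nu>
  x, Parseval would bound that norm by x^(2K) / p + \<nu>^(2K-2) x^(2K-1). The first term is at most
  half of the lower bound because 2 |W i| <= p, and the second is too small by hypothesis.\<close>

lemma ex_large_ft:
  fixes W :: "nat \<Rightarrow> int set" and \<nu> :: real
  assumes X: "per X" "msr X > 0" and W: "W 0 = X" "\<And>j. j < i \<Longrightarrow> sumset (W j) (W j) \<subseteq> W (Suc j)"
    and small: "2 * real (msr (W i)) \<le> p"
    and \<nu>: "0 \<le> \<nu>" "2 * real (msr (W i)) * \<nu> ^ (2 * 2 ^ i - 2) < msr X"
  shows "\<exists>\<xi>\<in>{0<..<p}. cmod (ft (convpow X 0) \<xi>) > \<nu> * msr X"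
proof (rule ccontr)
  assume "\<not> ?thesis"
  then have le: "cmod (ft (convpow X 0) \<xi>) \<le> \<nu> * msr X" if "\<xi> \<in> {0<..<p}" for \<xi>
    using that by (auto simp: not_less)
  define x H K where "x = real (msr X)" "H = real (msr (W i))" "K = (2::nat) ^ i"
  note defs = x_H_K_def
  have "K \<ge> 1" by (simp add: defs)
  then obtain k where k: "2 * K = k + 2" by (metis add.commute le_Suc_ex mult_le_mono2 mult.right_neutral)
  have "x > 0" using X by (simp add: defs)
  define T where "T = (\<Sum>y\<in>{0..<p}. (cmod (convpow X i y))\<^sup>2)"
  have ft0: "ft (convpow X 0) 0 = of_real x"
    by (auto simp: ft_def defs msr_sum intro!: sum.cong)
  have "x ^ K = cmod (ft (convpow X i) 0)"
    using \<open>x > 0\<close> by (simp add: ft_convpow[OF X(1), of i] ft0 norm_power defs del: convpow.simps)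
  also have "\<dots> \<le> (\<Sum>y\<in>{0..<p}. cmod (convpow X i y))"
    unfolding ft_def by (rule order_trans[OF norm_sum]) simp
  also have "\<dots> = (\<Sum>y\<in>{0..<p}. of_bool (y \<in> W i) * cmod (convpow X i y))"
    using convpow_support[of X W i] W by (intro sum.cong) auto
  finally have "(x ^ K)\<^sup>2 \<le> (\<Sum>y\<in>{0..<p}. of_bool (y \<in> W i) * cmod (convpow X i y))\<^sup>2"
    using \<open>x > 0\<close> by (intro power_mono) auto
  also have "\<dots> \<le> real (card {y\<in>{0..<p}. y \<in> W i}) * T"
    unfolding T_def by (rule Cauchy_Schwarz_of_bool) simp
  also have "card {y\<in>{0..<p}. y \<in> W i} = msr (W i)"
    unfolding msr_def by (rule arg_cong[of _ _ card]) auto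
  finally have 1: "x ^ (2 * K) \<le> H * T" by (simp add: defs power_mult[symmetric] mult.commute)
  have "real_of_int p * T = (\<Sum>\<xi>\<in>{0..<p}. (cmod (ft (convpow X i) \<xi>))\<^sup>2)"
    unfolding T_def by (rule parseval[symmetric])
  also have "\<dots> = (\<Sum>\<xi>\<in>{0..<p}. (cmod (ft (convpow X 0) \<xi>)) ^ (2 * K))"
    by (simp add: ft_convpow[OF X(1), of i] norm_power power_mult[symmetric] defs mult.commute del: convpow.simps)
  also have "\<dots> = x ^ (2 * K) + (\<Sum>\<xi>\<in>{0<..<p}. (cmod (ft (convpow X 0) \<xi>)) ^ (2 * K))"
  proof -
    have "{0..<p} = insert 0 {0<..<p}" by auto
    then show ?thesis using \<open>x > 0\<close> by (simp add: ft0 del: convpow.simps)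
  qed
  \<comment> \<open>Two of the 2K factors are kept for Parseval; the other k = 2K - 2 are bounded by
    \<nu> x.\<close>
  also have "(\<Sum>\<xi>\<in>{0<..<p}. (cmod (ft (convpow X 0) \<xi>)) ^ (2 * K))
      \<le> (\<Sum>\<xi>\<in>{0<..<p}. (\<nu> * x) ^ k * (cmod (ft (convpow X 0) \<xi>))\<^sup>2)"
    unfolding k power_add using le by (intro sum_mono mult_right_mono power_mono) (auto simp: defs)
  also have "\<dots> \<le> (\<nu> * x) ^ k * (\<Sum>\<xi>\<in>{0..<p}. (cmod (ft (convpow X 0) \<xi>))\<^sup>2)"
    unfolding sum_distrib_left[symmetric] using \<nu> \<open>x > 0\<close>
    by (intro mult_left_mono sum_mono2) auto
  also have "(\<Sum>\<xi>\<in>{0..<p}. (cmod (ft (convpow X 0) \<xi>))\<^sup>2) = real_of_int p * x"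
    unfolding parseval by (auto simp: defs msr_sum intro!: sum.cong)
  finally have 2: "p * T \<le> x ^ (2 * K) + (\<nu> * x) ^ k * (p * x)" by simp
  have "p * x ^ (2 * K) \<le> p * (H * T)" using 1 by (intro mult_left_mono) auto
  also have "\<dots> = H * (p * T)" by simp
  also have "\<dots> \<le> H * (x ^ (2 * K) + (\<nu> * x) ^ k * (p * x))" using 2 by (intro mult_left_mono) (auto simp: defs)
  also have "\<dots> = x ^ (k + 1) * (H * x + H * p * \<nu> ^ k)"
    unfolding k by (simp add: algebra_simps power_mult_distrib power2_eq_square)
  finally have "x ^ (k + 1) * (p * x) \<le> x ^ (k + 1) * (H * x + H * p * \<nu> ^ k)"
    unfolding k by (simp add: algebra_simps power2_eq_square)
  then have 3: "p * x \<le> H * x + H * p * \<nu> ^ k" using \<open>x > 0\<close> by simp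
  have "2 * H * x \<le> p * x" using small \<open>x > 0\<close> by (intro mult_right_mono) (auto simp: defs)
  then have "p * x \<le> 2 * (H * p * \<nu> ^ k)" using 3 by linarith
  also have "\<dots> = p * (2 * H * \<nu> ^ k)" by simp
  finally have "x \<le> 2 * H * \<nu> ^ k" by simp
  moreover have "2 * 2 ^ i - 2 = k" using k by (simp add: defs)
  ultimately show False using \<nu>(2) by (simp add: defs)
qed

text \<open>By symmetry of \<open>X\<close> the large coefficient is a real cosine sum, but it may
  be negative. Passing to the doubled frequency removes the sign: cos 2t = 2 (cos t)^2 - 1, and
  Cauchy-Schwarz bounds the sum of squared cosines below by \<nu>^2 |X|. Doubling a frequency
  requires p to be odd.\<close>

lemma ex_concentrating_dilation:
  fixes W :: "nat \<Rightarrow> int set" and \<nu> :: real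
  assumes X: "per X" "msr X > 0" "\<And>x. x \<in> X \<Longrightarrow> - x \<in> X"
    and W: "W 0 = X" "\<And>j. j < i \<Longrightarrow> sumset (W j) (W j) \<subseteq> W (Suc j)"
    and small: "2 * real (msr (W i)) \<le> p" and "p \<noteq> 2"
    and \<nu>: "0 \<le> \<nu>" "2 * real (msr (W i)) * \<nu> ^ (2 * 2 ^ i - 2) < msr X"
  shows "\<exists>\<mu>. \<not> p dvd \<mu> \<and>
    (\<Sum>y\<in>{0..<p}. of_bool (\<mu> * y \<in> X) * (1 - cos (2 * pi * y / p))) \<le> 2 * (1 - \<nu>\<^sup>2) * msr X"
proof -
  obtain \<xi> where \<xi>: "0 < \<xi>" "\<xi> < p" "cmod (ft (convpow X 0) \<xi>) > \<nu> * msr X"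
    using ex_large_ft[OF X(1,2) W small \<nu>] by auto
  define x where "x = real (msr X)"
  have "x > 0" using X by (simp add: x_def)
  have card: "card {y \<in> {0..<p}. y \<in> X} = msr X"
    unfolding msr_def by (rule arg_cong[of _ _ card]) auto
  define cs where "cs j y = cos (2 * pi * real_of_int (j * y) / real_of_int p)" for j y :: int
  define sn where "sn y = sin (2 * pi * real_of_int (\<xi> * y) / real_of_int p)" for y :: int
  have csec: "cs j y = Re (ec (j * y))" and snec: "sn y = Im (ec (\<xi> * y))" for j y
    by (simp_all add: cs_def sn_def ec_def)
  have perX: "y + p \<in> X \<longleftrightarrow> y \<in> X" "- y \<in> X \<longleftrightarrow> y \<in> X" for y
    using X X(3)[of y] X(3)[of "- y"] by auto
  have "(\<Sum>y\<in>{0..<p}. of_bool (y \<in> X) * sn y) = (\<Sum>y\<in>{0..<p}. of_bool (0 - y \<in> X) * sn (0 - y))"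
    by (rule sum_shift(3)[of "\<lambda>y. of_bool (y \<in> X) * sn y", symmetric]) (simp add: perX snec distrib_left)
  also have "\<dots> = (\<Sum>y\<in>{0..<p}. - (of_bool (y \<in> X) * sn y))"
    by (intro sum.cong refl) (simp add: perX sn_def)
  finally have sn0: "(\<Sum>y\<in>{0..<p}. of_bool (y \<in> X) * sn y) = 0" by (simp add: sum_negf)
  have bool_times: "Im (of_bool b) = 0" "Re (of_bool b) = of_bool b" for b
    by (cases b; simp)+
  have ImRe: "Im (ft (convpow X 0) \<xi>) = (\<Sum>y\<in>{0..<p}. of_bool (y \<in> X) * sn y)"
    "Re (ft (convpow X 0) \<xi>) = (\<Sum>y\<in>{0..<p}. of_bool (y \<in> X) * cs \<xi> y)"
    by (simp_all add: ft_def csec snec bool_times)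
  have "cmod (ft (convpow X 0) \<xi>) = \<bar>\<Sum>y\<in>{0..<p}. of_bool (y \<in> X) * cs \<xi> y\<bar>"
    by (simp only: cmod_def ImRe sn0) simp
  then have "\<nu> * x \<le> \<bar>\<Sum>y\<in>{0..<p}. of_bool (y \<in> X) * cs \<xi> y\<bar>" using \<xi>(3) unfolding x_def by linarith
  then have "(\<nu> * x)\<^sup>2 \<le> (\<Sum>y\<in>{0..<p}. of_bool (y \<in> X) * cs \<xi> y)\<^sup>2"
    using \<nu> \<open>x > 0\<close> by (intro abs_le_square_iff[THEN iffD1]) simp
  also have "(\<Sum>y\<in>{0..<p}. of_bool (y \<in> X) * cs \<xi> y) =
      (\<Sum>y\<in>{0..<p}. of_bool (y \<in> X) * (of_bool (y \<in> X) * cs \<xi> y))"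
    by (intro sum.cong refl) simp
  also have "\<dots>\<^sup>2 \<le> x * (\<Sum>y\<in>{0..<p}. (of_bool (y \<in> X) * cs \<xi> y)\<^sup>2)"
    using Cauchy_Schwarz_of_bool[of "{0..<p}" "\<lambda>y. y \<in> X"] unfolding card x_def by simp
  finally have 1: "\<nu>\<^sup>2 * x \<le> (\<Sum>y\<in>{0..<p}. (of_bool (y \<in> X) * cs \<xi> y)\<^sup>2)"
    using \<open>x > 0\<close> by (simp add: power2_eq_square)
  define j where "j = 2 * \<xi>"
  have "\<not> p dvd 2" "\<not> p dvd \<xi>"
    using \<open>p \<noteq> 2\<close> p_gt_1 \<xi> zdvd_imp_le[of p 2] zdvd_imp_le[of p \<xi>] by auto
  then have "\<not> p dvd j" unfolding j_def using prime_p prime_dvd_mult_iff by blast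
  have "cs j y = 2 * (cs \<xi> y)\<^sup>2 - 1" for y
    unfolding cs_def j_def by (subst cos_double_cos[symmetric]) (simp add: algebra_simps)
  then have "(\<Sum>y\<in>{0..<p}. of_bool (y \<in> X) * (1 - cs j y)) =
      (\<Sum>y\<in>{0..<p}. 2 * of_bool (y \<in> X) - 2 * (of_bool (y \<in> X) * cs \<xi> y)\<^sup>2)"
    by (intro sum.cong refl) (auto simp: algebra_simps)
  also have "\<dots> = 2 * x - 2 * (\<Sum>y\<in>{0..<p}. (of_bool (y \<in> X) * cs \<xi> y)\<^sup>2)"
    by (simp add: sum_subtractf sum_distrib_left x_def msr_sum)
  also have "\<dots> \<le> 2 * (1 - \<nu>\<^sup>2) * x" using 1 by (simp add: algebra_simps)
  finally have 2: "(\<Sum>y\<in>{0..<p}. of_bool (y \<in> X) * (1 - cs j y)) \<le> 2 * (1 - \<nu>\<^sup>2) * x" .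
  \<comment> \<open>Dilating by the inverse of \<open>j\<close> turns frequency \<open>j\<close>
    into frequency 1.\<close>
  obtain \<mu> where \<mu>: "[j * \<mu> = 1] (mod p)"
    using coprime_of_not_dvd[OF \<open>\<not> p dvd j\<close>] cong_solve_coprime_int by blast
  then have cop: "coprime \<mu> p" using coprime_iff_invertible_int by (metis mult.commute)
  then have nd: "\<not> p dvd \<mu>" using p_gt_1 prime_p by (metis coprime_absorb_left coprime_commute not_prime_unit)
  have "(\<Sum>y\<in>{0..<p}. of_bool (\<mu> * y \<in> X) * (1 - cos (2 * pi * y / p))) =
      (\<Sum>y\<in>{0..<p}. of_bool (\<mu> * y + 0 \<in> X) * (1 - cs j (\<mu> * y + 0)))"
  proof (intro sum.cong refl)
    fix y :: int
    have "[(j * \<mu>) * y = 1 * y] (mod p)" using \<mu> by (rule cong_scalar_right)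
    then obtain k where "j * (\<mu> * y) = y + k * p"
      by (metis cong_iff_lin cong_sym mult.assoc mult.commute mult_1)
    then have "cs j (\<mu> * y) = cs 1 y" unfolding csec by simp
    then show "of_bool (\<mu> * y \<in> X) * (1 - cos (2 * pi * y / p)) = of_bool (\<mu> * y + 0 \<in> X) * (1 - cs j (\<mu> * y + 0))"
      by (simp add: cs_def)
  qed
  also have "\<dots> = (\<Sum>y\<in>{0..<p}. of_bool (y \<in> X) * (1 - cs j y))"
    by (rule sum_affine[of "\<lambda>y. of_bool (y \<in> X) * (1 - cs j y)"]) (use cop in \<open>simp_all add: perX csec distrib_left\<close>)
  finally show ?thesis using 2 nd unfolding x_def by (intro exI[of _ \<mu>]) simp
qed

end

section \<open>Sets of integers with small tripling\<close>

text \<open>For finite \<open>U\<close> and positive \<open>L\<close>, the elements max + L of the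
  residue classes modulo \<open>L\<close> that \<open>U\<close> occupies: what a shift by
  \<open>L\<close> is certain to add.\<close>

definition tops :: "int \<Rightarrow> int set \<Rightarrow> int set" where
  "tops L U = {y. y - L \<in> U \<and> (\<forall>u\<in>U. u mod L = y mod L \<longrightarrow> u < y)}"

lemma card_tops:
  assumes "finite U" "L > 0"
  shows "finite (tops L U)" "tops L U \<inter> U = {}" "card ((\<lambda>z. z mod L) ` U) \<le> card (tops L U)"
proof -
  have sub: "tops L U \<subseteq> (\<lambda>z. z + L) ` U"
    by (auto simp: tops_def intro!: image_eqI[of _ _ "_ - L"])
  show fin: "finite (tops L U)" by (rule finite_subset[OF sub]) (use assms in auto)
  show "tops L U \<inter> U = {}" by (auto simp: tops_def)
  have "(\<lambda>z. z mod L) ` U \<subseteq> (\<lambda>z. z mod L) ` tops L U"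
  proof
    fix c assume "c \<in> (\<lambda>z. z mod L) ` U"
    define F where "F = {u\<in>U. u mod L = c}"
    have F: "finite F" "F \<noteq> {}" using assms \<open>c \<in> _\<close> by (auto simp: F_def)
    define t where "t = Max F"
    have t: "t \<in> F" "\<And>u. u \<in> F \<Longrightarrow> u \<le> t" using F by (auto simp: t_def)
    have "t + L \<in> tops L U"
      using t assms unfolding tops_def F_def by fastforce
    moreover have "(t + L) mod L = c" using t by (simp add: F_def)
    ultimately show "c \<in> (\<lambda>z. z mod L) ` tops L U" by (metis image_eqI)
  qed
  then have "card ((\<lambda>z. z mod L) ` U) \<le> card ((\<lambda>z. z mod L) ` tops L U)"
    using fin by (intro card_mono) auto
  also have "\<dots> \<le> card (tops L U)" using fin by (rule card_image_le)
  finally show "card ((\<lambda>z. z mod L) ` U) \<le> card (tops L U)" .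
qed

lemma card_Un_shift:
  fixes U :: "int set" and L :: int
  assumes "finite U" "L > 0"
  shows "card U + card ((\<lambda>z. z mod L) ` U) \<le> card (U \<union> (\<lambda>z. z + L) ` U)"
proof -
  have "card U + card ((\<lambda>z. z mod L) ` U) \<le> card U + card (tops L U)"
    using card_tops[OF assms] by simp
  also have "\<dots> = card (U \<union> tops L U)"
    using card_tops[OF assms] assms by (subst card_Un_disjoint) auto
  also have "\<dots> \<le> card (U \<union> (\<lambda>z. z + L) ` U)"
    using assms by (intro card_mono) (auto simp: tops_def intro!: image_eqI[of _ _ "_ - L"])
  finally show ?thesis .
qed

text \<open>By symmetry the shift by -L adds the negatives of the tops. They differ from the tops:
  if t and -t were both tops, then t + L would be an element of \<open>U\<close> above t in its
  class.\<close>

lemma card_Un_shift_both: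
  fixes U :: "int set" and L :: int
  assumes U: "finite U" "L > 0" and sym: "\<And>u. u \<in> U \<Longrightarrow> - u \<in> U"
  shows "card U + 2 * card ((\<lambda>z. z mod L) ` U) \<le> card (U \<union> (\<lambda>z. z + L) ` U \<union> (\<lambda>z. z - L) ` U)"
proof -
  define T where "T = tops L U"
  note T = card_tops[OF U, folded T_def]
  have disj: "uminus ` T \<inter> U = {}"
  proof (rule ccontr)
    assume "uminus ` T \<inter> U \<noteq> {}"
    then obtain t where "t \<in> T" "- t \<in> U" by auto
    then have "t \<in> U" using sym[of "- t"] by simp
    then show False using T(2) \<open>t \<in> T\<close> by auto
  qed
  have disj2: "T \<inter> uminus ` T = {}"
  proof (rule ccontr)
    assume "T \<inter> uminus ` T \<noteq> {}"
    then obtain t where t: "t \<in> T" "- t \<in> T" by auto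
    then have "- (- t - L) \<in> U" by (intro sym) (simp add: T_def tops_def)
    moreover have "(t + L) mod L = t mod L" by simp
    ultimately have "t + L < t" using t(1) by (auto simp: T_def tops_def add.commute)
    then show False using U by simp
  qed
  have cardm: "card (uminus ` T) = card T" by (intro card_image) auto
  have "card U + 2 * card ((\<lambda>z. z mod L) ` U) \<le> card U + card T + card (uminus ` T)"
    using T cardm by simp
  also have "\<dots> = card (U \<union> T \<union> uminus ` T)"
    using T U disj disj2 card_Un_disjoint[of U T] card_Un_disjoint[of "U \<union> T" "uminus ` T"]
    by (simp add: Int_commute Int_Un_distrib2)
  also have "\<dots> \<le> card (U \<union> (\<lambda>z. z + L) ` U \<union> (\<lambda>z. z - L) ` U)"
  proof (intro card_mono)
    show "U \<union> T \<union> uminus ` T \<subseteq> U \<union> (\<lambda>z. z + L) ` U \<union> (\<lambda>z. z - L) ` U"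
    proof -
      have "t \<in> (\<lambda>z. z + L) ` U" "- t \<in> (\<lambda>z. z - L) ` U" if "t \<in> T" for t
      proof -
        have "t - L \<in> U" using that by (simp add: T_def tops_def)
        then show "t \<in> (\<lambda>z. z + L) ` U" by (intro image_eqI[of _ _ "t - L"]) auto
        have "- (t - L) \<in> U" using \<open>t - L \<in> U\<close> by (rule sym)
        then show "- t \<in> (\<lambda>z. z - L) ` U" by (intro image_eqI[of _ _ "- (t - L)"]) auto
      qed
      then show ?thesis by auto
    qed
  qed (use U in auto)
  finally show ?thesis .
qed

lemma int_subgroup_generator:
  fixes W :: "int set"
  assumes "L \<in> W" "L > 0" "\<And>u v. u \<in> W \<Longrightarrow> v \<in> W \<Longrightarrow> u + v \<in> W" "\<And>u. u \<in> W \<Longrightarrow> - u \<in> W"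
  shows "\<exists>d>0. \<forall>z. z \<in> W \<longleftrightarrow> d dvd z"
proof -
  define d where "d = int (LEAST k. k > 0 \<and> int k \<in> W)"
  have "nat L > 0 \<and> int (nat L) \<in> W" using assms by simp
  then have "0 < (LEAST k. k > 0 \<and> int k \<in> W) \<and> int (LEAST k. k > 0 \<and> int k \<in> W) \<in> W"
    by (rule LeastI)
  then have d: "d > 0" "d \<in> W" by (auto simp: d_def)
  have least: "d \<le> z" if "z > 0" "z \<in> W" for z
  proof -
    have "(LEAST k. k > 0 \<and> int k \<in> W) \<le> nat z" using that by (intro Least_le) simp
    then show ?thesis using that unfolding d_def by linarith
  qed
  have 0: "0 \<in> W" using assms(3)[OF d(2) assms(4)[OF d(2)]] by simp
  have natmul: "int k * d \<in> W" for k
    by (induction k) (use 0 assms(3) d in \<open>auto simp: distrib_right\<close>)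
  have mul: "k * d \<in> W" for k
  proof (cases "k \<ge> 0")
    case True
    then show ?thesis using natmul[of "nat k"] by simp
  next
    case False
    then show ?thesis using assms(4)[OF natmul[of "nat (- k)"]] by simp
  qed
  have "d dvd z" if "z \<in> W" for z
  proof -
    have "z + (- (z div d)) * d \<in> W" using that mul by (rule assms(3))
    then have "z mod d \<in> W" by (simp add: minus_div_mult_eq_mod[symmetric])
    then have "z mod d = 0" using least[of "z mod d"] d(1) pos_mod_sign[of d z] pos_mod_bound[of d z] by fastforce
    then show ?thesis by auto
  qed
  moreover have "z \<in> W" if "d dvd z" for z using mul that by (metis dvd_div_mult_self)
  ultimately show ?thesis using d(1) by blast
qed

text \<open>If \<open>|V + V| < 3/2 |V|\<close> then every element of \<open>V + V\<close> has more than \<open>|V|/2\<close>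
  representations as a difference, so \<open>V + V\<close> is a subgroup.\<close>

lemma small_doubling_mod:
  fixes Z :: "int set" and L :: int
  assumes Z: "finite Z" "0 \<in> Z" "\<And>z. z \<in> Z \<Longrightarrow> - z \<in> Z" and L: "L > 0"
    and small: "2 * card ((\<lambda>(a, b). (a + b) mod L) ` (Z \<times> Z)) < 3 * card ((\<lambda>z. z mod L) ` Z)"
  shows "\<exists>d>0. d dvd L \<and> (\<forall>z\<in>Z. d dvd z) \<and> L = d * int (card ((\<lambda>(a, b). (a + b) mod L) ` (Z \<times> Z)))"
proof -
  define V where "V = (\<lambda>z. z mod L) ` Z"
  define VV where "VV = (\<lambda>(a, b). (a + b) mod L) ` (Z \<times> Z)"
  have fin: "finite V" "finite VV" using Z by (auto simp: V_def VV_def)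
  have memVV: "(a + b) mod L \<in> VV" "(a - b) mod L \<in> VV" if aV: "a mod L \<in> V" "b mod L \<in> V" for a b
  proof -
    obtain a' b' where ab: "a' \<in> Z" "b' \<in> Z" "a mod L = a' mod L" "b mod L = b' mod L"
      using aV by (auto simp: V_def)
    have "(a + b) mod L = (a' + b') mod L" using ab by (metis mod_add_eq)
    then show "(a + b) mod L \<in> VV" using ab by (auto simp: VV_def)
    have "(a - b) mod L = (a' + - b') mod L" using ab by (metis mod_diff_eq add_uminus_conv_diff)
    then show "(a - b) mod L \<in> VV" using ab Z(3)[of b'] by (force simp: VV_def)
  qed
  define R where "R u = {v\<in>V. (v + u) mod L \<in> V}" for u
  \<comment> \<open>Write u = a + b. Then V + a and V - b are two sets of size |V| inside V + V, so
    they overlap in more than |V|/2 points, and an overlap v + a = w - b is a pair with w - v =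
    u.\<close>
  have R: "2 * card (R u) > card V" if u: "u mod L \<in> VV" for u
  proof -
    obtain a b where ab: "a \<in> Z" "b \<in> Z" "u mod L = (a + b) mod L" using u by (auto simp: VV_def)
    define P1 P2 where "P1 = (\<lambda>v. (v + a) mod L) ` V" and "P2 = (\<lambda>v. (v - b) mod L) ` V"
    have modV: "v mod L = v" if "v \<in> V" for v using that by (auto simp: V_def)
    have aV: "a mod L \<in> V" "b mod L \<in> V" using ab by (auto simp: V_def)
    have sub: "P1 \<subseteq> VV" "P2 \<subseteq> VV"
      using memVV aV modV unfolding P1_def P2_def by auto
    have inj1: "inj_on (\<lambda>v. (v + a) mod L) V"
    proof (rule inj_onI)
      fix x y assume xy: "x \<in> V" "y \<in> V" "(x + a) mod L = (y + a) mod L"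
      then have "((x + a) - a) mod L = ((y + a) - a) mod L" by (metis mod_diff_left_eq)
      then show "x = y" using modV xy by simp
    qed
    have inj2: "inj_on (\<lambda>v. (v - b) mod L) V"
    proof (rule inj_onI)
      fix x y assume xy: "x \<in> V" "y \<in> V" "(x - b) mod L = (y - b) mod L"
      then have "((x - b) + b) mod L = ((y - b) + b) mod L" by (metis mod_add_left_eq)
      then show "x = y" using modV xy by simp
    qed
    have "card P1 = card V" "card P2 = card V" unfolding P1_def P2_def using inj1 inj2 by (auto simp: card_image)
    moreover have "card (P1 \<union> P2) + card (P1 \<inter> P2) = card P1 + card P2"
      using fin unfolding P1_def P2_def by (intro card_Un_Int[symmetric]) auto
    moreover have "card (P1 \<union> P2) \<le> card VV" using sub fin by (intro card_mono) auto
    ultimately have *: "2 * card (P1 \<inter> P2) > card V" using small unfolding V_def[symmetric] VV_def[symmetric] by linarith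
    have "P1 \<inter> P2 \<subseteq> (\<lambda>v. (v + a) mod L) ` R u"
    proof
      fix t assume t: "t \<in> P1 \<inter> P2"
      then obtain v w where vw: "v \<in> V" "w \<in> V" "t = (v + a) mod L" "t = (w - b) mod L"
        by (auto simp: P1_def P2_def)
      have "(v + u) mod L = (v + (a + b)) mod L" using ab by (metis mod_add_right_eq)
      also have "\<dots> = ((v + a) mod L + b) mod L" by (simp add: mod_add_left_eq add.assoc)
      also have "\<dots> = ((w - b) mod L + b) mod L" using vw by simp
      also have "\<dots> = w" using modV[OF vw(2)] by (simp add: mod_add_left_eq)
      finally show "t \<in> (\<lambda>v. (v + a) mod L) ` R u" using vw by (auto simp: R_def)
    qed
    then have "card (P1 \<inter> P2) \<le> card (R u)"
      using fin by (intro surj_card_le) (auto simp: R_def)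
    then show ?thesis using * by linarith
  qed
  define W where "W = {z. z mod L \<in> VV}"
  have Wneg: "- u \<in> W" if uW: "u \<in> W" for u
  proof -
    obtain a b where ab: "a \<in> Z" "b \<in> Z" "u mod L = (a + b) mod L" using uW by (auto simp: W_def VV_def)
    then have "(- u) mod L = (- a + - b) mod L" by (metis mod_minus_eq minus_add_distrib)
    moreover have "(- a + - b) mod L \<in> VV"
      unfolding VV_def using ab Z(3) by (intro image_eqI[of _ _ "(- a, - b)"]) (auto simp: minus_diff_commute[of a b])
    ultimately show ?thesis unfolding W_def by (simp only: mem_Collect_eq)
  qed
  \<comment> \<open>\<open>R u\<close> and \<open>R (- v)\<close> each fill more than half of V, so
    they share some t. Then u + v = (t + u) - (t - v) is a difference of elements of V.\<close>
  have Wadd: "u + v \<in> W" if uv: "u \<in> W" "v \<in> W" for u v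
  proof -
    have "card V < card (R u) + card (R (- v))"
      using R[of u] R[of "- v"] uv Wneg[of v] by (simp add: W_def)
    moreover have "card (R u \<union> R (- v)) \<le> card V" using fin by (intro card_mono) (auto simp: R_def)
    moreover have "card (R u) + card (R (- v)) = card (R u \<union> R (- v)) + card (R u \<inter> R (- v))"
      using fin by (intro card_Un_Int) (auto simp: R_def)
    ultimately have "card (R u \<inter> R (- v)) \<noteq> 0" by linarith
    then obtain t where t: "t \<in> R u" "t \<in> R (- v)" by (metis IntE card.empty ex_in_conv)
    then have "((t + u) - (t + - v)) mod L \<in> VV" by (intro memVV(2)) (auto simp: R_def)
    then show ?thesis by (simp add: W_def)
  qed
  have "0 mod L \<in> VV" using memVV(1)[of 0 0] Z(2) by (force simp: V_def)
  then have "L \<in> W" by (simp add: W_def)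
  then obtain d where d: "d > 0" "\<And>z. z \<in> W \<longleftrightarrow> d dvd z"
    using int_subgroup_generator[OF _ L Wadd Wneg] by blast
  have "d dvd L" using d \<open>L \<in> W\<close> by simp
  then obtain l where l: "L = d * l" by auto
  have "l > 0" using l L d by (simp add: zero_less_mult_iff)
  have "VV = (\<lambda>k. d * k) ` {0..<l}"
  proof (intro equalityI subsetI)
    fix t assume t: "t \<in> VV"
    then have tL: "0 \<le> t" "t < L" using L by (auto simp: VV_def)
    then have "t \<in> W" using t by (simp add: W_def)
    then obtain k where "t = d * k" using d by auto
    then show "t \<in> (\<lambda>k. d * k) ` {0..<l}" using tL l d by (auto simp: zero_le_mult_iff)
  next
    fix t assume "t \<in> (\<lambda>k. d * k) ` {0..<l}"
    then obtain k where "t = d * k" "k \<in> {0..<l}" by (rule imageE)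
    then have k: "t = d * k" "0 \<le> k" "k < l" by auto
    then have "t mod L = t" using l d by simp
    moreover have "t \<in> W" using d k by simp
    ultimately show "t \<in> VV" by (simp add: W_def)
  qed
  then have "card VV = card {0..<l}" using d by (simp add: card_image inj_on_def)
  then have "L = d * int (card VV)" using \<open>l > 0\<close> l by simp
  moreover have "d dvd z" if "z \<in> Z" for z
  proof -
    have "(z + 0) mod L \<in> VV" by (rule memVV(1)) (use that Z in \<open>force simp: V_def\<close>)+
    then show ?thesis using d by (simp add: W_def)
  qed
  ultimately show ?thesis using d(1) \<open>d dvd L\<close> unfolding VV_def by blast
qed

text \<open>Put L = max Z and let W be the number of classes of Z + Z modulo L. Shifting Z + Z by L
  and -L adds at least 2W elements, and |Z + Z| >= 2|Z| - 1, so tripling 3.05 gives 2W <= 1.05 |Z| +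
  1. As Z itself occupies at least (|Z| - 1)/2 classes, its doubling modulo L is below 3/2 and
  \<open>small_doubling_mod\<close> applies, with l = W and d = L / W.\<close>

lemma small_tripling_int:
  fixes Z :: "int set"
  assumes Z: "finite Z" "0 \<in> Z" "\<And>z. z \<in> Z \<Longrightarrow> - z \<in> Z" and big: "card Z \<ge> 10"
    and trip: "card ((\<lambda>(a, b, c). a + b + c) ` (Z \<times> Z \<times> Z)) \<le> 61 / 20 * real (card Z)"
  shows "\<exists>d>0. \<exists>l>0. d * l \<in> Z \<and> (\<forall>z\<in>Z. d dvd z \<and> \<bar>z\<bar> \<le> d * l) \<and> 2 * real_of_int l \<le> 21 / 20 * card Z + 1"
proof -
  define L where "L = Max Z"
  have L: "L \<in> Z" "\<And>z. z \<in> Z \<Longrightarrow> z \<le> L" using Z by (auto simp: L_def intro: Max_in)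
  have abs: "\<bar>z\<bar> \<le> L" if "z \<in> Z" for z using L(2)[OF that] L(2)[OF Z(3)[OF that]] by auto
  have "L > 0"
  proof (rule ccontr)
    assume "\<not> L > 0"
    then have "Z \<subseteq> {0}" using abs by force
    then have "card Z \<le> 1" using card_mono[of "{0::int}" Z] by simp
    then show False using big by simp
  qed
  define Z2 where "Z2 = (\<lambda>(a, b). a + b) ` (Z \<times> Z)"
  define Z3 where "Z3 = (\<lambda>(a, b, c). a + b + c) ` (Z \<times> Z \<times> Z)"
  have fin: "finite Z2" "finite Z3" using Z by (auto simp: Z2_def Z3_def)
  have sym2: "- u \<in> Z2" if u: "u \<in> Z2" for u
  proof -
    obtain a b where "a \<in> Z" "b \<in> Z" "u = a + b" using u by (auto simp: Z2_def)
    then have "- u = - a + - b" "- a \<in> Z" "- b \<in> Z" using Z(3) by auto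
    then show ?thesis unfolding Z2_def by (intro image_eqI[of _ _ "(- a, - b)"]) auto
  qed
  have "Z2 \<union> (\<lambda>z. z + L) ` Z2 \<union> (\<lambda>z. z - L) ` Z2 \<subseteq> Z3"
  proof -
    have "a + b + c \<in> Z3" if "a \<in> Z" "b \<in> Z" "c \<in> Z" for a b c
      using that by (force simp: Z3_def)
    from this[of _ _ 0] this[of _ _ L] this[of _ _ "- L"] show ?thesis
      using Z(2) L(1) Z(3)[OF L(1)] by (auto simp: Z2_def)
  qed
  then have "card (Z2 \<union> (\<lambda>z. z + L) ` Z2 \<union> (\<lambda>z. z - L) ` Z2) \<le> card Z3" using fin by (intro card_mono)
  then have c3: "card Z2 + 2 * card ((\<lambda>z. z mod L) ` Z2) \<le> card Z3"
    using card_Un_shift_both[OF fin(1) \<open>L > 0\<close> sym2] by linarith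
  have img: "(\<lambda>(a, b). (a + b) mod L) ` (Z \<times> Z) = (\<lambda>z. z mod L) ` Z2"
    unfolding Z2_def image_image by (intro image_cong) auto
  have c2: "2 * card Z \<le> card Z2 + 1"
  proof -
    have "(\<lambda>z. z + L) ` Z \<inter> (\<lambda>z. z - L) ` Z \<subseteq> {0}"
    proof
      fix x assume "x \<in> (\<lambda>z. z + L) ` Z \<inter> (\<lambda>z. z - L) ` Z"
      then obtain y z where "y \<in> Z" "z \<in> Z" "x = y + L" "x = z - L" by auto
      then show "x \<in> {0}" using abs[of y] abs[of z] by auto
    qed
    then have "card ((\<lambda>z. z + L) ` Z \<inter> (\<lambda>z. z - L) ` Z) \<le> 1"
      using card_mono[of "{0::int}"] by fastforce
    moreover have "card ((\<lambda>z. z + L) ` Z) = card Z" "card ((\<lambda>z. z - L) ` Z) = card Z"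
      by (simp_all add: card_image inj_on_def)
    moreover have "card ((\<lambda>z. z + L) ` Z \<union> (\<lambda>z. z - L) ` Z) \<le> card Z2"
      using fin L(1) Z(3)[OF L(1)] by (intro card_mono) (force simp: Z2_def)+
    ultimately show ?thesis
      using card_Un_Int[of "(\<lambda>z. z + L) ` Z" "(\<lambda>z. z - L) ` Z"] Z(1) by simp
  qed
  \<comment> \<open>The elements in [0, L) lie in distinct classes; by symmetry they make up half of
    Z, up to 0 and the endpoints L and -L.\<close>
  have cV: "card Z \<le> 2 * card ((\<lambda>z. z mod L) ` Z) + 1"
  proof -
    define A where "A = Z \<inter> {0..<L}"
    have A: "finite A" "0 \<in> A" using Z \<open>L > 0\<close> by (auto simp: A_def)
    have "A \<subseteq> (\<lambda>z. z mod L) ` Z" by (force simp: A_def)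
    then have "card A \<le> card ((\<lambda>z. z mod L) ` Z)" using Z by (intro card_mono) auto
    moreover have "card Z \<le> 2 * card A + 1"
    proof -
      have "Z \<subseteq> A \<union> uminus ` (A - {0}) \<union> {L, - L}"
      proof
        fix z assume z: "z \<in> Z"
        show "z \<in> A \<union> uminus ` (A - {0}) \<union> {L, - L}"
        proof (cases "0 \<le> z")
          case True
          then show ?thesis using z L(2)[OF z] by (auto simp: A_def)
        next
          case False
          then have "- z \<in> A - {0} \<or> z = - L" using Z(3)[OF z] abs[OF z] by (auto simp: A_def)
          then show ?thesis by (metis Un_iff image_eqI insert_iff minus_minus)
        qed
      qed
      then have "card Z \<le> card (A \<union> uminus ` (A - {0}) \<union> {L, - L})" using A by (intro card_mono) auto
      also have "\<dots> \<le> card A + card (uminus ` (A - {0})) + card {L, - L}"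
        using card_Un_le[of "A \<union> uminus ` (A - {0})" "{L, - L}"] card_Un_le[of A "uminus ` (A - {0})"] by linarith
      also have "\<dots> \<le> card A + (card A - 1) + 2"
        using A \<open>L > 0\<close> by (intro add_mono) (auto intro: order_trans[OF card_image_le])
      finally show ?thesis using A card_gt_0_iff[of A] by auto
    qed
    ultimately show ?thesis by linarith
  qed
  define W where "W = card ((\<lambda>(a, b). (a + b) mod L) ` (Z \<times> Z))"
  have W: "2 * real W \<le> 21 / 20 * card Z + 1"
    using c3 c2 trip unfolding W_def img Z3_def[symmetric] by linarith
  have "2 * W < 3 * card ((\<lambda>z. z mod L) ` Z)"
    using W cV big by linarith
  then obtain d where d: "d > 0" "\<forall>z\<in>Z. d dvd z" "L = d * int W"
    using small_doubling_mod[OF Z \<open>L > 0\<close>] unfolding W_def by blast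
  have "int W > 0" using d \<open>L > 0\<close> by (cases "W = 0") auto
  then show ?thesis using d L(1) abs W by (intro exI[of _ d] conjI exI[of _ "int W"]) auto
qed

section \<open>Rectification: from sets in Z_p to sets of integers\<close>

context prime_modulus
begin

lemma card_le_msr:
  assumes "per A" "finite Z" "Z \<subseteq> A" "\<And>x y. x \<in> Z \<Longrightarrow> y \<in> Z \<Longrightarrow> \<bar>x - y\<bar> < p"
  shows "card Z \<le> msr A"
proof -
  have "inj_on (\<lambda>z. z mod p) Z"
  proof (rule inj_onI)
    fix x y assume xy: "x \<in> Z" "y \<in> Z" "x mod p = y mod p"
    then have "p dvd x - y" by (simp add: mod_eq_dvd_iff)
    then show "x = y" using assms(4)[OF xy(1,2)] zdvd_imp_le[of p "\<bar>x - y\<bar>"] by fastforce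
  qed
  then have "card Z = card ((\<lambda>z. z mod p) ` Z)" by (simp add: card_image)
  also have "\<dots> \<le> msr A" unfolding msr_def using assms by (intro card_mono) auto
  finally show ?thesis .
qed

text \<open>Farther than p/18 from 0 the angle is at least pi/9, so every such element costs at
  least 1 - cos(pi/9), and the sum can pay only for a tenth of \<open>Y\<close>.\<close>

lemma concentrated_near_zero:
  assumes Y: "per Y"
    and conc: "(\<Sum>y\<in>{0..<p}. of_bool (y \<in> Y) * (1 - cos (2 * pi * y / p))) \<le> (1 - cos (pi / 9)) / 10 * msr Y"
  shows "10 * msr (Y - {y. \<exists>z. 18 * \<bar>z\<bar> \<le> p \<and> [y = z] (mod p)}) \<le> msr Y"
proof -
  define \<gamma> where "\<gamma> = 1 - cos (pi / 9)"
  have "cos (pi / 9) < cos 0" by (rule cos_monotone_0_pi) auto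
  then have \<gamma>: "\<gamma> > 0" by (simp add: \<gamma>_def)
  define Y0 where "Y0 = {y. \<exists>z. 18 * \<bar>z\<bar> \<le> p \<and> [y = z] (mod p)}"
  have cos_le: "\<gamma> \<le> 1 - cos (2 * pi * y / p)" if y: "y \<in> {0..<p}" "y \<notin> Y0" for y :: int
  proof -
    have "\<not> 18 * \<bar>y\<bar> \<le> p" using y(2) by (auto simp: Y0_def)
    then have 1: "18 * y > p" using y(1) by simp
    have 2: "18 * (p - y) > p"
    proof (rule ccontr)
      assume "\<not> 18 * (p - y) > p"
      moreover have "[y = y - p] (mod p)" by (simp add: cong_def)
      ultimately show False using y unfolding Y0_def by force
    qed
    define \<theta> where "\<theta> = 2 * pi * y / p"
    have "real_of_int p < real_of_int (18 * y)" using 1 by (rule of_int_less_iff[THEN iffD2])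
    then have t1: "pi / 9 \<le> \<theta>" unfolding \<theta>_def by (simp add: field_simps)
    have "real_of_int p < real_of_int (18 * (p - y))" using 2 by (rule of_int_less_iff[THEN iffD2])
    then have "pi / 9 \<le> 2 * pi * (real_of_int p - y) / p" by (simp add: field_simps)
    also have "\<dots> = 2 * pi - \<theta>" unfolding \<theta>_def by (simp add: field_simps)
    finally have t2: "pi / 9 \<le> 2 * pi - \<theta>" .
    have "cos \<theta> \<le> cos (pi / 9)"
    proof (cases "\<theta> \<le> pi")
      case True
      then show ?thesis using t1 by (intro cos_monotone_0_pi_le) auto
    next
      case False
      then have "cos (2 * pi - \<theta>) \<le> cos (pi / 9)" using t2 by (intro cos_monotone_0_pi_le) auto
      then show ?thesis by simp
    qed
    then show ?thesis by (simp add: \<gamma>_def \<theta>_def)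
  qed
  have "real (msr (Y - Y0)) * \<gamma> = (\<Sum>y\<in>{0..<p}. of_bool (y \<in> Y - Y0) * \<gamma>)"
    unfolding msr_sum by (simp add: sum_distrib_right)
  also have "\<dots> \<le> (\<Sum>y\<in>{0..<p}. of_bool (y \<in> Y) * (1 - cos (2 * pi * y / p)))"
    using cos_le by (intro sum_mono) auto
  also have "\<dots> \<le> \<gamma> / 10 * msr Y" using conc by (simp add: \<gamma>_def)
  finally have "\<gamma> * real (10 * msr (Y - Y0)) \<le> \<gamma> * real (msr Y)" by (simp add: mult_ac)
  then show ?thesis using \<gamma> unfolding Y0_def of_nat_le_iff[symmetric, where ?'a = real] by simp
qed

text \<open>At least nine tenths of Y, called Y0, lie within p/18 of 0. An element y farther than
  p/6 = 3 p/18 would make y + Y0 disjoint from Y0 + Y0 and force |Y + Y| >= 3 |Y0| - 1 > 5/2 |Y|. So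
  all of Y lies within p/6, triple sums have representatives below p/2 in absolute value, and Y has
  the tripling of a set of integers.\<close>

lemma rectify_concentrated:
  assumes Y: "per Y" "0 \<in> Y" "\<And>y. y \<in> Y \<Longrightarrow> - y \<in> Y" and big: "msr Y \<ge> 100"
    and conc: "(\<Sum>y\<in>{0..<p}. of_bool (y \<in> Y) * (1 - cos (2 * pi * y / p))) \<le> (1 - cos (pi / 9)) / 10 * msr Y"
    and doub: "real (msr (sumset Y Y)) \<le> 5 / 2 * msr Y" "msr (sumset Y Y) < nat p"
    and trip: "real (msr (sumset (sumset Y Y) Y)) \<le> 61 / 20 * msr Y"
  shows "\<exists>d l. \<not> p dvd d \<and> 0 < l \<and> d * l \<in> Y \<and> (\<forall>y. d * y \<in> Y \<longrightarrow> (\<exists>z. \<bar>z\<bar> \<le> l \<and> [y = z] (mod p)))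
    \<and> 2 * real_of_int l \<le> 21 / 20 * msr Y + 1"
proof -
  define N where "N = {y. \<exists>z. 18 * \<bar>z\<bar> \<le> p \<and> [y = z] (mod p)}"
  define Y0 where "Y0 = Y \<inter> N"
  have perN: "per N" unfolding N_def per_def by (simp add: cong_def)
  have perY0: "per Y0" unfolding Y0_def using Y perN by auto
  have "10 * msr (Y - N) \<le> msr Y" using concentrated_near_zero[OF Y(1) conc] by (simp add: N_def)
  then have m0: "10 * msr Y0 \<ge> 9 * msr Y" using msr_Diff[of Y N] by (simp add: Y0_def)
  have "0 \<in> N" unfolding N_def by (auto intro!: exI[of _ 0])
  then have ne: "Y0 \<noteq> {}" using Y(2) by (auto simp: Y0_def)
  have near: "\<exists>z. 6 * \<bar>z\<bar> \<le> p \<and> [y = z] (mod p)" if y: "y \<in> Y" for y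
  proof (rule ccontr)
    assume far: "\<not> ?thesis"
    have disj: "sumset Y0 Y0 \<inter> {x. x - y \<in> Y0} = {}"
    proof (rule ccontr)
      assume "\<not> ?thesis"
      then obtain x where x: "x \<in> sumset Y0 Y0" "x - y \<in> Y0" by auto
      then obtain a b where ab: "a \<in> N" "b \<in> N" "x = a + b" by (auto simp: Y0_def elim: sumsetE)
      obtain u v w where uvw: "18 * \<bar>u\<bar> \<le> p" "18 * \<bar>v\<bar> \<le> p" "18 * \<bar>w\<bar> \<le> p"
        "[a = u] (mod p)" "[b = v] (mod p)" "[x - y = w] (mod p)"
        using ab x by (auto simp: Y0_def N_def)
      have "[(a + b) - (x - y) = (u + v) - w] (mod p)" using uvw by (intro cong_diff cong_add)
      then have "[y = u + v - w] (mod p)" using ab by simp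
      have "\<bar>u + v - w\<bar> \<le> \<bar>u\<bar> + \<bar>v\<bar> + \<bar>w\<bar>" by linarith
      moreover have "6 * A \<le> p" if "A \<le> U + V + W" "18 * U \<le> p" "18 * V \<le> p" "18 * W \<le> p" for A U V W
        using that by linarith
      ultimately have "6 * \<bar>u + v - w\<bar> \<le> p" using uvw(1-3) by blast
      with \<open>[y = u + v - w] (mod p)\<close> show False using far by blast
    qed
    have "msr (sumset Y0 Y0 \<union> {x. x - y \<in> Y0}) = msr (sumset Y0 Y0) + msr Y0"
      using msr_Un_Int[of "sumset Y0 Y0" "{x. x - y \<in> Y0}"] disj perY0 by simp
    moreover have "sumset Y0 Y0 \<union> {x. x - y \<in> Y0} \<subseteq> sumset Y Y"
      using y by (auto simp: sumset_def Y0_def)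
    then have "msr (sumset Y0 Y0 \<union> {x. x - y \<in> Y0}) \<le> msr (sumset Y Y)" by (rule msr_mono)
    moreover have "min (nat p) (msr Y0 + msr Y0 - 1) \<le> msr (sumset Y0 Y0)"
      using perY0 ne by (intro cauchy_davenport)
    ultimately have "3 * msr Y0 - 1 \<le> msr (sumset Y Y)" using doub(2) by linarith
    then have "3 * real (msr Y0) - 1 \<le> 5 / 2 * real (msr Y)" using doub(1) by linarith
    then show False using m0 big by linarith
  qed
  define Z where "Z = {z. 6 * \<bar>z\<bar> \<le> p \<and> z \<in> Y}"
  have "Z \<subseteq> {-p..p}" by (auto simp: Z_def)
  then have finZ: "finite Z" using finite_subset by blast
  \<comment> \<open>Strictness keeps triple sums strictly inside (-p/2, p/2), where reduction modulo
    p is injective.\<close>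
  have Zlt: "6 * \<bar>z\<bar> < p" if "z \<in> Z" for z
  proof -
    have "6 * \<bar>z\<bar> \<noteq> p"
    proof
      assume "6 * \<bar>z\<bar> = p"
      then have "p = 2 * (3 * \<bar>z\<bar>)" by simp
      then have "2 dvd p" by (metis dvd_triv_left)
      moreover have "Factorial_Ring.prime (2::int)" by simp
      ultimately have "p = 2" using prime_p primes_dvd_imp_eq by blast
      then show False using \<open>6 * \<bar>z\<bar> = p\<close> by presburger
    qed
    then show ?thesis using that by (auto simp: Z_def)
  qed
  have cardZ: "msr Y \<le> card Z"
  proof -
    have "Y \<inter> {0..<p} \<subseteq> (\<lambda>z. z mod p) ` Z"
    proof
      fix y assume y: "y \<in> Y \<inter> {0..<p}"
      then obtain z where z: "6 * \<bar>z\<bar> \<le> p" "[y = z] (mod p)" using near by auto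
      then have "z \<in> Z" using y per_cong[OF Y(1), of y z] by (auto simp: Z_def)
      moreover have "y = z mod p" using y z by (simp add: cong_def)
      ultimately show "y \<in> (\<lambda>z. z mod p) ` Z" by auto
    qed
    then show ?thesis unfolding msr_def using finZ by (meson card_image_le card_mono finite_imageI order_trans)
  qed
  define Z3 where "Z3 = (\<lambda>(a, b, c). a + b + c) ` (Z \<times> Z \<times> Z)"
  have "card Z3 \<le> msr (sumset (sumset Y Y) Y)"
  proof (rule card_le_msr)
    show "Z3 \<subseteq> sumset (sumset Y Y) Y"
      by (auto simp: Z3_def Z_def intro!: sumsetI)
    have Z3lt: "2 * \<bar>x\<bar> < p" if x: "x \<in> Z3" for x
    proof -
      obtain a b c where abc: "a \<in> Z" "b \<in> Z" "c \<in> Z" "x = a + b + c" using x by (auto simp: Z3_def)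
      have "\<bar>x\<bar> \<le> \<bar>a\<bar> + \<bar>b\<bar> + \<bar>c\<bar>" using abc(4) by linarith
      then show ?thesis using Zlt[OF abc(1)] Zlt[OF abc(2)] Zlt[OF abc(3)] by linarith
    qed
    fix x y assume "x \<in> Z3" "y \<in> Z3"
    then have "2 * \<bar>x\<bar> < p" "2 * \<bar>y\<bar> < p" using Z3lt by auto
    then show "\<bar>x - y\<bar> < p" by linarith
  qed (use Y finZ in \<open>auto simp: Z3_def\<close>)
  then have c3: "real (card Z3) \<le> 61 / 20 * real (card Z)" using trip cardZ by linarith
  have cardZ': "card Z \<le> msr Y"
  proof (rule card_le_msr)
    fix x y assume "x \<in> Z" "y \<in> Z"
    then show "\<bar>x - y\<bar> < p" using Zlt[of x] Zlt[of y] by linarith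
  qed (use Y finZ in \<open>auto simp: Z_def\<close>)
  have "0 \<in> Z" "\<And>z. z \<in> Z \<Longrightarrow> - z \<in> Z" using Y by (auto simp: Z_def)
  then obtain d l where dl: "d > 0" "l > 0" "d * l \<in> Z" "\<forall>z\<in>Z. d dvd z \<and> \<bar>z\<bar> \<le> d * l"
    "2 * real_of_int l \<le> 21 / 20 * card Z + 1"
    using small_tripling_int[OF finZ _ _ _ c3[unfolded Z3_def]] cardZ big by force
  have "d \<le> d * l" using dl by simp
  then have "d < p" using Zlt[OF dl(3)] dl(1) by linarith
  then have nd: "\<not> p dvd d" using dl(1) zdvd_imp_le[of p d] by linarith
  have "\<exists>z. \<bar>z\<bar> \<le> l \<and> [y = z] (mod p)" if y: "d * y \<in> Y" for y
  proof -
    obtain z where z: "6 * \<bar>z\<bar> \<le> p" "[d * y = z] (mod p)" using near[OF y] by auto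
    then have "z \<in> Z" using y per_cong[OF Y(1)] by (auto simp: Z_def)
    then have "d dvd z" "\<bar>z\<bar> \<le> d * l" using dl(4) by auto
    moreover from this obtain k where "z = d * k" by auto
    ultimately have k: "z = d * k" "\<bar>d * k\<bar> \<le> d * l" by auto
    then have "\<bar>k\<bar> \<le> l" using dl(1) by (simp add: abs_mult)
    moreover have "[y = k] (mod p)"
      using z(2) unfolding k using cong_mult_lcancel coprime_of_not_dvd[OF nd] by blast
    ultimately show ?thesis by auto
  qed
  moreover have "2 * real_of_int l \<le> 21 / 20 * msr Y + 1" using dl(5) cardZ' by linarith
  ultimately show ?thesis using nd dl by (intro exI[of _ d] exI[of _ l]) (auto simp: Z_def)
qed

section \<open>Almost invariant sets and arcs\<close>

lemma msr_window:
  assumes "per A"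
  shows "card (A \<inter> {y..<y + p}) = msr A"
proof -
  have "bij_betw (\<lambda>x. (1 * x + 0) mod p) {y..<y + p} {0..<p}"
  proof -
    have inj: "inj_on (\<lambda>x. x mod p) {y..<y + p}"
    proof (rule inj_onI)
      fix a b assume ab: "a \<in> {y..<y + p}" "b \<in> {y..<y + p}" "a mod p = b mod p"
      then have "p dvd a - b" by (simp add: mod_eq_dvd_iff)
      then show "a = b" using ab zdvd_imp_le[of p "\<bar>a - b\<bar>"] by fastforce
    qed
    moreover have "(\<lambda>x. x mod p) ` {y..<y + p} = {0..<p}"
      using inj by (intro card_subset_eq) (auto simp: card_image)
    ultimately show ?thesis by (simp add: bij_betw_def)
  qed
  then have "(\<Sum>x\<in>{y..<y + p}. of_bool (x mod p \<in> A)) = (\<Sum>x\<in>{0..<p}. of_bool (x \<in> A) :: nat)"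
    using sum.reindex_bij_betw[of _ _ _ "\<lambda>x. of_bool (x \<in> A) :: nat"] by fastforce
  then have "(\<Sum>x\<in>{y..<y + p}. of_bool (x \<in> A)) = msr A" using assms by (simp add: msr_sum)
  then show ?thesis by (simp add: sum_of_bool_eq Int_def conj_commute)
qed

text \<open>Sliding the window by one step loses an element only when y is in \<open>S\<close> and y
  + l is not.\<close>

lemma window_drop:
  fixes y1 y2 l :: int
  assumes "y1 \<le> y2" "l \<ge> 0"
  shows "card (S \<inter> {y1..<y1 + l}) \<le> card (S \<inter> {y2..<y2 + l}) + card ({x. x \<in> S \<and> x + l \<notin> S} \<inter> {y1..<y2})"
  using assms(1)
proof (induction y2 rule: int_ge_induct)
  case (step y)
  have e1: "card (S \<inter> {y..<y + l}) + of_bool (y + l \<in> S) = card (S \<inter> {y + 1..<y + 1 + l}) + of_bool (y \<in> S)"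
  proof -
    have "card (S \<inter> {y..<y + l}) + of_bool (y + l \<in> S) = card (S \<inter> {y..y + l})"
    proof -
      have "S \<inter> {y..y + l} = (if y + l \<in> S then insert (y + l) (S \<inter> {y..<y + l}) else S \<inter> {y..<y + l})"
        using \<open>l \<ge> 0\<close> by (auto simp: order_le_less)
      then show ?thesis by simp
    qed
    also have "\<dots> = card (S \<inter> {y + 1..<y + 1 + l}) + of_bool (y \<in> S)"
    proof -
      have "S \<inter> {y..y + l} = (if y \<in> S then insert y (S \<inter> {y + 1..<y + 1 + l}) else S \<inter> {y + 1..<y + 1 + l})"
        using \<open>l \<ge> 0\<close> by (auto simp: order_le_less)
      then show ?thesis by simp
    qed
    finally show ?thesis .
  qed
  have e2: "card ({x. x \<in> S \<and> x + l \<notin> S} \<inter> {y1..<y + 1}) =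
      card ({x. x \<in> S \<and> x + l \<notin> S} \<inter> {y1..<y}) + of_bool (y \<in> S \<and> y + l \<notin> S)"
  proof -
    have "{x. x \<in> S \<and> x + l \<notin> S} \<inter> {y1..<y + 1} = (if y \<in> S \<and> y + l \<notin> S
      then insert y ({x. x \<in> S \<and> x + l \<notin> S} \<inter> {y1..<y}) else {x. x \<in> S \<and> x + l \<notin> S} \<inter> {y1..<y})"
      using step(1) by (auto simp: order_le_less)
    then show ?thesis by simp
  qed
  show ?case using step(2) e1 unfolding e2 by (auto split: if_splits simp: of_bool_def)
qed simp


lemma defect_window:
  assumes "per S"
  shows "card ({x. x \<in> S \<and> x + g \<notin> S} \<inter> {y..<y + p}) = defect S g"
  unfolding defect_def by (rule msr_window) (use assms in auto)

text \<open>The two drops are charged to disjoint stretches of a single period, hence together to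
  one \<open>defect\<close>.\<close>

lemma two_drops_le_defect:
  assumes S: "per S" and y: "y1 \<le> y2" "y2 \<le> y3" "y3 \<le> y4" "y4 \<le> y1 + p" and "l \<ge> 0"
  shows "card (S \<inter> {y1..<y1 + l}) + card (S \<inter> {y3..<y3 + l})
    \<le> card (S \<inter> {y2..<y2 + l}) + card (S \<inter> {y4..<y4 + l}) + defect S l"
proof -
  define T where "T = {x. x \<in> S \<and> x + l \<notin> S}"
  have "card (T \<inter> {y1..<y2}) + card (T \<inter> {y3..<y4}) = card (T \<inter> {y1..<y2} \<union> T \<inter> {y3..<y4})"
    using y by (subst card_Un_disjoint) auto
  also have "\<dots> \<le> card (T \<inter> {y1..<y1 + p})" using y by (intro card_mono) auto
  also have "\<dots> = defect S l" unfolding T_def by (rule defect_window[OF S])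
  finally show ?thesis
    using window_drop[OF y(1) \<open>l \<ge> 0\<close>, of S] window_drop[OF y(3) \<open>l \<ge> 0\<close>, of S]
    unfolding T_def by linarith
qed

lemma block_sum:
  fixes T :: "int set" and y l :: int and q :: nat
  assumes "l > 0"
  shows "(\<Sum>i<q. card (T \<inter> {y + int i * l..<y + (int i + 1) * l})) = card (T \<inter> {y..<y + int q * l})"
proof (induction q)
  case (Suc q)
  define Q where "Q = int q * l"
  have e: "int q * l = Q" "(int q + 1) * l = Q + l" "int (Suc q) * l = Q + l" "0 \<le> Q"
    using assms by (simp_all add: distrib_right Q_def)
  have "card (T \<inter> {y..<y + Q}) + card (T \<inter> {y + Q..<y + (Q + l)}) =
      card (T \<inter> {y..<y + Q} \<union> T \<inter> {y + Q..<y + (Q + l)})"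
    by (subst card_Un_disjoint) auto
  also have "T \<inter> {y..<y + Q} \<union> T \<inter> {y + Q..<y + (Q + l)} = T \<inter> {y..<y + (Q + l)}"
    using e(4) assms by auto
  finally show ?case using Suc unfolding sum.lessThan_Suc e by simp
qed simp

text \<open>A pair \<open>x \<in> S\<close>, \<open>x + g \<notin> S\<close> inside one block of length \<open>l\<close> has \<open>|g| \<le> l\<close>.\<close>

lemma block_mixing:
  fixes y l :: int and q :: nat
  assumes S: "per S" and l: "l > 0" "int q * l \<le> p"
    and small: "\<And>g. \<bar>g\<bar> \<le> l \<Longrightarrow> 10 * int (defect S g) \<le> 22 * l"
    and s: "\<And>i. s i = int (card (S \<inter> {y + int i * l..<y + (int i + 1) * l}))"
  shows "10 * (\<Sum>i<q. s i * (l - s i)) \<le> 44 * l * l"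
proof -
  define B where "B i = {y + int i * l..<y + (int i + 1) * l}" for i :: nat
  define T where "T g = {x. x \<in> S \<and> x + g \<notin> S}" for g
  define G where "G = {-l..l} - {0}"
  have pairs: "s i * (l - s i) \<le> (\<Sum>g\<in>G. int (card (T g \<inter> B i)))" for i
  proof -
    have fin: "finite (S \<inter> B i)" "finite (B i - S)" by (auto simp: B_def)
    have "card (B i) = nat l" by (simp add: B_def distrib_right)
    moreover have "card (S \<inter> B i) + card (B i - S) = card (B i)"
    proof -
      have "S \<inter> B i \<union> (B i - S) = B i" "S \<inter> B i \<inter> (B i - S) = {}" by auto
      then show ?thesis using card_Un_disjoint[OF fin] by simp
    qed
    ultimately have "l - s i = int (card (B i - S))" using s[of i] l by (simp add: B_def)
    then have "s i * (l - s i) = int (card ((S \<inter> B i) \<times> (B i - S)))"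
      using s[of i] by (simp add: card_cartesian_product B_def)
    also have "card ((S \<inter> B i) \<times> (B i - S)) = card ((\<lambda>(x, z). (z - x, x)) ` ((S \<inter> B i) \<times> (B i - S)))"
      by (rule card_image[symmetric]) (auto simp: inj_on_def)
    also have "\<dots> \<le> card (Sigma G (\<lambda>g. T g \<inter> B i))"
      by (intro card_mono) (auto simp: G_def T_def B_def algebra_simps)
    also have "\<dots> = (\<Sum>g\<in>G. card (T g \<inter> B i))"
      by (rule card_SigmaI) (auto simp: G_def B_def)
    finally show ?thesis by simp
  qed
  have "(\<Sum>i<q. s i * (l - s i)) \<le> (\<Sum>i<q. \<Sum>g\<in>G. int (card (T g \<inter> B i)))"
    by (intro sum_mono pairs)
  also have "\<dots> = (\<Sum>g\<in>G. int (\<Sum>i<q. card (T g \<inter> B i)))"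
    by (subst sum.swap) simp
  also have "\<dots> \<le> (\<Sum>g\<in>G. int (defect S g))"
  proof (rule sum_mono)
    fix g
    have "(\<Sum>i<q. card (T g \<inter> B i)) = card (T g \<inter> {y..<y + q * l})"
      unfolding B_def by (rule block_sum[OF l(1)])
    also have "\<dots> \<le> card (T g \<inter> {y..<y + p})" using l by (intro card_mono) auto
    also have "\<dots> = defect S g" unfolding T_def by (rule defect_window[OF S])
    finally show "int (\<Sum>i<q. card (T g \<inter> B i)) \<le> int (defect S g)" by (rule of_nat_mono)
  qed
  finally have "10 * (\<Sum>i<q. s i * (l - s i)) \<le> (\<Sum>g\<in>G. 10 * int (defect S g))"
    unfolding sum_distrib_left[symmetric] by simp
  also have "\<dots> \<le> (\<Sum>g\<in>G. 22 * l)" by (intro sum_mono small) (auto simp: G_def)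
  also have "\<dots> = 44 * l * l"
  proof -
    have "card G = nat (2 * l)" unfolding G_def using l by (subst card_Diff_subset) auto
    then show ?thesis using l by simp
  qed
  finally show ?thesis .
qed

text \<open>By \<open>block_mixing\<close> most blocks of length l are nearly empty or nearly full.
  Counting from a full block, \<open>two_drops_le_defect\<close> forbids a full block between two
  empty ones. So the blocks from the first to the last nearly empty one form an arc with few
  elements of S; outside it S has few holes, which bounds the length of the arc from below.\<close>

lemma ex_empty_arc:
  assumes S: "per S" and l: "l > 0"
    and d1: "10 * int (defect S l) \<le> 11 * l"
    and d2: "\<And>g. \<bar>g\<bar> \<le> l \<Longrightarrow> 10 * int (defect S g) \<le> 22 * l"
    and size: "int (msr S) > 50 * l" "int (msr S) + 50 * l < p"
  shows "\<exists>c z. 0 < z \<and> z \<le> p \<and> z \<ge> p - int (msr S) - 50 * l \<and> int (card (S \<inter> {c..<c + z})) \<le> 49 * l"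
proof -
  define q where "q = nat (p div l)"
  have q: "int q * l \<le> p" "p < (int q + 1) * l"
  proof -
    have "0 \<le> p div l" using l by (simp add: pos_imp_zdiv_nonneg_iff)
    then have "int q = p div l" by (simp add: q_def)
    then have "int q * l + p mod l = p" by simp
    moreover have "p mod l < l" "0 \<le> p mod l" using l by auto
    moreover have "(int q + 1) * l = int q * l + l" by (simp add: distrib_right)
    ultimately show "int q * l \<le> p" "p < (int q + 1) * l" by linarith+
  qed
  define s where "s y i = int (card (S \<inter> {y + int i * l..<y + (int i + 1) * l}))" for y :: int and i :: nat
  \<comment> \<open>Distance of a block from being empty or full, and l in the intermediate range.
    As 9 l times the cost is at most 100 s (l - s), the total cost is at most 440/9 l < 49
    l.\<close>
  define cost where "cost y i = (if 10 * s y i < l then s y i else if 10 * s y i > 9 * l then l - s y i else l)"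
    for y i
  have s0: "0 \<le> s y i" "s y i \<le> l" for y i
  proof -
    have "card (S \<inter> {y + int i * l..<y + (int i + 1) * l}) \<le> card {y + int i * l..<y + (int i + 1) * l}"
      by (intro card_mono) auto
    then show "s y i \<le> l" using l by (simp add: s_def distrib_right)
  qed (simp add: s_def)
  have cost0: "0 \<le> cost y i" for y i using s0[of y i] l by (simp add: cost_def)
  have cost_le: "9 * l * cost y i \<le> 100 * (s y i * (l - s y i))" for y i
  proof -
    have s: "0 \<le> s y i" "s y i \<le> l" using s0 by auto
    consider "10 * s y i < l" | "10 * s y i > 9 * l" | "l \<le> 10 * s y i" "10 * s y i \<le> 9 * l" by linarith
    then show ?thesis
    proof cases
      case 1
      have "9 * l * s y i \<le> 10 * (l - s y i) * s y i" using 1 s by (intro mult_right_mono) auto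
      moreover have "10 * (l - s y i) * s y i = 10 * (s y i * (l - s y i))" by simp
      moreover have "0 \<le> s y i * (l - s y i)" using s by simp
      moreover have c: "cost y i = s y i" using 1 by (simp add: cost_def)
      ultimately show ?thesis unfolding c by linarith
    next
      case 2
      have "9 * l * (l - s y i) \<le> 10 * s y i * (l - s y i)" using 2 s by (intro mult_right_mono) auto
      moreover have "10 * s y i * (l - s y i) = 10 * (s y i * (l - s y i))" by simp
      moreover have "0 \<le> s y i * (l - s y i)" using s by simp
      moreover have c: "cost y i = l - s y i" using 2 l by (simp add: cost_def)
      ultimately show ?thesis unfolding c by linarith
    next
      case 3
      have "0 \<le> (10 * s y i - l) * (9 * l - 10 * s y i)" using 3 by (intro mult_nonneg_nonneg) auto
      then show ?thesis using 3 by (simp add: cost_def algebra_simps)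
    qed
  qed
  have total: "(\<Sum>i<q. cost y i) \<le> 49 * l" for y
  proof -
    have "9 * l * (\<Sum>i<q. cost y i) \<le> 100 * (\<Sum>i<q. s y i * (l - s y i))"
      unfolding sum_distrib_left by (intro sum_mono cost_le)
    also have "\<dots> \<le> 440 * l * l"
      using block_mixing[OF S l q(1) d2 s_def, of y] by simp
    also have "\<dots> \<le> 9 * l * (49 * l)" using l by simp
    finally show ?thesis using l by simp
  qed
  have sum_s: "(\<Sum>i<q. s y i) \<le> int (msr S)" "int (msr S) \<le> (\<Sum>i<q. s y i) + l" for y
  proof -
    have "(\<Sum>i<q. card (S \<inter> {y + int i * l..<y + (int i + 1) * l})) = card (S \<inter> {y..<y + q * l})"
      by (rule block_sum[OF l])
    from arg_cong[OF this, of int]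
    have e: "(\<Sum>i<q. s y i) = int (card (S \<inter> {y..<y + q * l}))" by (simp add: s_def)
    have m: "msr S = card (S \<inter> {y..<y + p})" by (rule msr_window[OF S, symmetric])
    show "(\<Sum>i<q. s y i) \<le> int (msr S)"
      unfolding e m using q by (intro of_nat_mono card_mono) auto
    have "S \<inter> {y..<y + p} \<subseteq> S \<inter> {y..<y + q * l} \<union> {y + q * l..<y + p}" by auto
    then have "card (S \<inter> {y..<y + p}) \<le> card (S \<inter> {y..<y + q * l} \<union> {y + q * l..<y + p})"
      by (intro card_mono) auto
    also have "\<dots> \<le> card (S \<inter> {y..<y + q * l}) + card {y + q * l..<y + p}" by (rule card_Un_le)
    finally show "int (msr S) \<le> (\<Sum>i<q. s y i) + l"
      unfolding e m using q l by (simp add: distrib_right)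
  qed
  \<comment> \<open>Without a full block every s is at most its cost, and |S| would be at most 50
    l.\<close>
  obtain j where j: "j < q" "10 * s 0 j > 9 * l"
  proof (rule ccontr)
    assume "\<not> thesis"
    then have "\<And>j. j < q \<Longrightarrow> s 0 j \<le> cost 0 j" using that s0 by (force simp: cost_def)
    then have "(\<Sum>i<q. s 0 i) \<le> (\<Sum>i<q. cost 0 i)" by (intro sum_mono) auto
    then show False using total[of 0] sum_s(2)[of 0] size by linarith
  qed
  define y where "y = int j * l"
  have full: "10 * s y 0 > 9 * l" using j by (simp add: s_def y_def distrib_right)
  define E where "E = {i. i < q \<and> 10 * s y i < l}"
  have finE: "finite E" by (simp add: E_def)
  have cost_out: "l - s y i \<le> cost y i" if "i < q" "i \<notin> E" for i
    using that s0[of y i] by (auto simp: cost_def E_def)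
  have "E \<noteq> {}"
  proof
    assume "E = {}"
    then have "(\<Sum>i<q. l - s y i) \<le> (\<Sum>i<q. cost y i)" using cost_out by (intro sum_mono) auto
    then have "int q * l - (\<Sum>i<q. s y i) \<le> 49 * l" using total[of y] by (simp add: sum_subtractf)
    then show False using sum_s(1)[of y] q size by (simp add: distrib_right)
  qed
  define a b where "a = Min E" and "b = Max E"
  have ab: "a \<in> E" "b \<in> E" "\<And>i. i \<in> E \<Longrightarrow> a \<le> i \<and> i \<le> b"
    using finE \<open>E \<noteq> {}\<close> by (auto simp: a_def b_def)
  then have abq: "a \<le> b" "b < q" "a < q" by (auto simp: E_def)
  \<comment> \<open>The cyclic order full, empty, full, empty would make two drops of total size
    above 1.6 l, but the defect at \<open>l\<close> is at most 1.1 l.\<close>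
  have no_full: "10 * s y i \<le> 9 * l" if i: "a \<le> i" "i \<le> b" for i
  proof (rule ccontr)
    assume F: "\<not> 10 * s y i \<le> 9 * l"
    have "int (card (S \<inter> {y..<y + l})) + int (card (S \<inter> {y + int i * l..<y + int i * l + l}))
      \<le> int (card (S \<inter> {y + int a * l..<y + int a * l + l})) + int (card (S \<inter> {y + int b * l..<y + int b * l + l}))
        + int (defect S l)"
    proof -
      have "int a * l \<le> int i * l" "int i * l \<le> int b * l" "0 \<le> int a * l" "int b * l \<le> int q * l"
        using i abq l by (auto intro: mult_right_mono)
      then have "y \<le> y + int a * l" "y + int a * l \<le> y + int i * l" "y + int i * l \<le> y + int b * l" "y + int b * l \<le> y + p"
        using q by linarith+
      then show ?thesis
        using two_drops_le_defect[OF S, of y "y + int a * l" "y + int i * l" "y + int b * l" l] l by linarith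
    qed
    then have "s y 0 + s y i \<le> s y a + s y b + int (defect S l)" by (simp add: s_def distrib_right add.assoc)
    moreover have "10 * s y a < l" "10 * s y b < l" using ab by (auto simp: E_def)
    ultimately show False using full F d1 l by linarith
  qed
  define c z where "c = y + int a * l" and "z = (int b + 1 - int a) * l"
  have "0 < z" using abq l by (simp add: z_def)
  have "z \<le> int q * l" unfolding z_def using abq l by (intro mult_right_mono) auto
  then have "z \<le> p" using q by linarith
  have in_le: "s y i \<le> cost y i" if "i \<in> {a..b}" for i
    using no_full[of i] that s0[of y i] by (auto simp: cost_def)
  have split: "{..<q} = {a..b} \<union> ({..<q} - {a..b})" using abq by auto
  have "int (card (S \<inter> {c..<c + z})) = (\<Sum>i\<in>{a..b}. s y i)"
  proof -
    have "int (\<Sum>i<b + 1 - a. card (S \<inter> {c + int i * l..<c + (int i + 1) * l})) = int (card (S \<inter> {c..<c + int (b + 1 - a) * l}))"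
      by (subst block_sum[OF l]) simp
    moreover have "int (b + 1 - a) * l = z" using abq by (simp add: z_def of_nat_diff)
    moreover have "bij_betw (\<lambda>i. i + a) {..<b + 1 - a} {a..b}"
      by (rule bij_betw_byWitness[where f' = "\<lambda>i. i - a"]) (use abq(1) in auto)
    then have "(\<Sum>i\<in>{a..b}. s y i) = (\<Sum>i<b + 1 - a. s y (i + a))"
      by (rule sum.reindex_bij_betw[symmetric])
    moreover have "s y (i + a) = int (card (S \<inter> {c + int i * l..<c + (int i + 1) * l}))" for i
      by (simp add: s_def c_def algebra_simps)
    ultimately show ?thesis by simp
  qed
  also have "\<dots> \<le> (\<Sum>i\<in>{a..b}. cost y i)" by (intro sum_mono in_le)
  also have "\<dots> \<le> (\<Sum>i<q. cost y i)" using abq cost0 by (intro sum_mono2) auto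
  also have "\<dots> \<le> 49 * l" by (rule total)
  finally have inside: "int (card (S \<inter> {c..<c + z})) \<le> 49 * l" .
  have "(\<Sum>i\<in>{..<q} - {a..b}. l - s y i) \<le> (\<Sum>i\<in>{..<q} - {a..b}. cost y i)"
    using ab by (intro sum_mono cost_out) (auto)
  also have "\<dots> \<le> (\<Sum>i<q. cost y i)" using cost0 by (intro sum_mono2) auto
  also have "\<dots> \<le> 49 * l" by (rule total)
  finally have "int (card ({..<q} - {a..b})) * l \<le> (\<Sum>i\<in>{..<q} - {a..b}. s y i) + 49 * l"
    by (simp add: sum_subtractf)
  also have "(\<Sum>i\<in>{..<q} - {a..b}. s y i) \<le> (\<Sum>i<q. s y i)" using s0 by (intro sum_mono2) auto
  also have "card ({..<q} - {a..b}) = q - (b + 1 - a)" using abq by (subst card_Diff_subset) auto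
  also have "int (q - (b + 1 - a)) = int q - (int b + 1 - int a)" using abq by (simp add: of_nat_diff)
  finally have "int q * l - z \<le> int (msr S) + 49 * l" using sum_s(1)[of y] by (simp add: z_def left_diff_distrib)
  then have "z \<ge> p - int (msr S) - 50 * l" using q by (simp add: distrib_right)
  then show ?thesis using \<open>0 < z\<close> \<open>z \<le> p\<close> inside by blast
qed

end

section \<open>Few translates of sets contained in arcs\<close>

text \<open>With \<open>m = max B - min B\<close>, the translates by \<open>min B\<close> and \<open>max B\<close> add one new element per
  residue class of \<open>A\<close> modulo \<open>m\<close>; a third translate is then found by averaging over the
  elements that leave these residue classes.\<close>

lemma three_translates_int:
  fixes A B :: "int set"
  assumes A: "finite A" and B: "finite B" "B \<noteq> {}"
  shows "\<exists>D\<subseteq>B. card D \<le> 3 \<and> card A + min (card A) (card B - 1) \<le> card {x. \<exists>d\<in>D. x - d \<in> A}"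
proof (cases "card B = 1")
  case True
  then obtain b where b: "B = {b}" by (auto simp: card_1_singleton_iff)
  have "{x. \<exists>d\<in>B. x - d \<in> A} = (\<lambda>x. x + b) ` A" unfolding b by (auto intro!: image_eqI[of _ _ "_ - b"])
  then have "card {x. \<exists>d\<in>B. x - d \<in> A} = card A" by (simp add: card_image)
  then show ?thesis using True by (intro exI[of _ B]) auto
next
  case False
  then have cB: "card B \<ge> 2" using B by (metis One_nat_def Suc_leI card_gt_0_iff le_neq_implies_less numeral_2_eq_2)
  define lo hi m where "lo = Min B" and "hi = Max B" and "m = hi - lo"
  have lohi: "lo \<in> B" "hi \<in> B" "\<And>b. b \<in> B \<Longrightarrow> lo \<le> b \<and> b \<le> hi"
    using B by (auto simp: lo_def hi_def)
  have "m > 0"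
  proof (rule ccontr)
    assume "\<not> m > 0"
    then have "B \<subseteq> {lo}" using lohi by (force simp: m_def)
    then show False using cB card_mono[of "{lo}" B] by simp
  qed
  define U where "U = A \<union> (\<lambda>x. x + m) ` A"
  define V where "V = (\<lambda>x. x mod m) ` A"
  define s where "s = card V"
  have U: "finite U" "card A + s \<le> card U"
    unfolding U_def s_def V_def using A card_Un_shift[OF A \<open>m > 0\<close>] by auto
  have s: "s \<le> card A" unfolding s_def V_def using A by (rule card_image_le)
  define cov where "cov D = {x. \<exists>d\<in>D. x - d \<in> A}" for D
  have cov_fin: "finite (cov D)" if "finite D" for D
  proof -
    have "cov D \<subseteq> (\<lambda>(a, d). a + d) ` (A \<times> D)" by (force simp: cov_def)
    then show ?thesis using A that finite_subset by blast
  qed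
  have covU: "(\<lambda>x. x + lo) ` U \<subseteq> cov {lo, hi}" by (auto simp: U_def cov_def m_def)
  show ?thesis
  proof (cases "card B - 1 \<le> s")
    case True
    have "card U = card ((\<lambda>x. x + lo) ` U)" by (simp add: card_image)
    also have "\<dots> \<le> card (cov {lo, hi})" using covU cov_fin by (intro card_mono) auto
    finally have "card A + min (card A) (card B - 1) \<le> card (cov {lo, hi})" using True U s by linarith
    then show ?thesis using lohi unfolding cov_def
      by (intro exI[of _ "{lo, hi}"]) (auto intro: order_trans[OF card_insert_le_m1])
  next
    case False
    \<comment> \<open>\<open>hi\<close> is dropped because it agrees with \<open>lo\<close> modulo
      m. The other elements are distinct modulo m, so for each a at most s of them leave a within
      the classes of A.\<close>
    define B' where "B' = B - {hi}"
    define k where "k = card B'"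
    have k: "k = card B - 1" using B lohi by (simp add: k_def B'_def)
    have finB': "finite B'" using B by (simp add: B'_def)
    define G where "G b = {a\<in>A. (a + (b - lo)) mod m \<notin> V}" for b
    have count: "card {b\<in>B'. (a + (b - lo)) mod m \<notin> V} \<ge> k - s" for a
    proof -
      have inj: "inj_on (\<lambda>b. (a + (b - lo)) mod m) B'"
      proof (rule inj_onI)
        fix x y assume xy: "x \<in> B'" "y \<in> B'" "(a + (x - lo)) mod m = (a + (y - lo)) mod m"
        then have "m dvd (a + (x - lo)) - (a + (y - lo))" by (simp add: mod_eq_dvd_iff)
        then have "m dvd x - y" by (simp add: algebra_simps)
        moreover have "\<bar>x - y\<bar> < m"
        proof -
          have "lo \<le> x" "x < hi" "lo \<le> y" "y < hi" using xy lohi by (force simp: B'_def)+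
          then show ?thesis by (simp add: m_def)
        qed
        ultimately show "x = y" using zdvd_imp_le[of m "\<bar>x - y\<bar>"] by fastforce
      qed
      have "card {b\<in>B'. (a + (b - lo)) mod m \<in> V} \<le> s"
        unfolding s_def using inj A
        by (intro card_inj_on_le[of "\<lambda>b. (a + (b - lo)) mod m"]) (auto simp: V_def intro: inj_on_subset)
      moreover have "card {b\<in>B'. (a + (b - lo)) mod m \<in> V} + card {b\<in>B'. (a + (b - lo)) mod m \<notin> V} = k"
        unfolding k_def using finB' by (subst card_Un_disjoint[symmetric]) (auto intro: arg_cong[of _ _ card])
      ultimately show ?thesis by linarith
    qed
    have "card A * (k - s) = (\<Sum>a\<in>A. k - s)" by simp
    also have "\<dots> \<le> (\<Sum>a\<in>A. card {b\<in>B'. (a + (b - lo)) mod m \<notin> V})" by (intro sum_mono count)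
    also have "\<dots> = (\<Sum>b\<in>B'. card (G b))"
    proof -
      have "(\<Sum>a\<in>A. card {b\<in>B'. (a + (b - lo)) mod m \<notin> V}) = (\<Sum>a\<in>A. \<Sum>b\<in>B'. of_bool ((a + (b - lo)) mod m \<notin> V))"
        using finB' by (intro sum.cong refl) (simp add: sum_of_bool_eq Int_def)
      also have "\<dots> = (\<Sum>b\<in>B'. \<Sum>a\<in>A. of_bool ((a + (b - lo)) mod m \<notin> V))" by (rule sum.swap)
      also have "\<dots> = (\<Sum>b\<in>B'. card (G b))"
        using A by (intro sum.cong refl) (simp add: sum_of_bool_eq Int_def G_def)
      finally show ?thesis .
    qed
    finally have tot: "card A * (k - s) \<le> (\<Sum>b\<in>B'. card (G b))" .
    have "\<exists>b\<in>B'. card A * (k - s) \<le> k * card (G b)"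
    proof (rule ccontr)
      assume neg: "\<not> ?thesis"
      have "B' \<noteq> {}" using k cB by (auto simp: k_def)
      then have "(\<Sum>b\<in>B'. k * card (G b)) < (\<Sum>b\<in>B'. card A * (k - s))"
        using neg finB' by (intro sum_strict_mono) (auto simp: not_le)
      then have "k * (\<Sum>b\<in>B'. card (G b)) < k * (card A * (k - s))"
        by (simp add: sum_distrib_left k_def)
      then show False using tot by simp
    qed
    then obtain b where b: "b \<in> B'" "card A * (k - s) \<le> k * card (G b)" by auto
    have "(\<lambda>x. x + lo) ` U \<union> (\<lambda>x. x + b) ` G b \<subseteq> cov {lo, hi, b}"
      using covU by (auto simp: cov_def G_def)
    moreover have "(\<lambda>x. x + lo) ` U \<inter> (\<lambda>x. x + b) ` G b = {}"
    proof (rule ccontr)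
      assume "\<not> ?thesis"
      then obtain u g where ug: "u \<in> U" "g \<in> G b" "u + lo = g + b" by auto
      then have "u = g + (b - lo)" by simp
      moreover have "u mod m \<in> V" using ug(1) by (auto simp: U_def V_def)
      ultimately show False using ug(2) by (simp add: G_def)
    qed
    moreover have "finite (G b)" using A by (simp add: G_def)
    ultimately have "card ((\<lambda>x. x + lo) ` U) + card ((\<lambda>x. x + b) ` G b) \<le> card (cov {lo, hi, b})"
      using U cov_fin by (subst card_Un_disjoint[symmetric]) (auto intro!: card_mono)
    then have c: "card U + card (G b) \<le> card (cov {lo, hi, b})" by (simp add: card_image)
    \<comment> \<open>With q = min |A| k, averaging gives q (k - s) <= k |G b|, and q s <= k s; add
      the two and divide by k.\<close>
    have "min (card A) k \<le> s + card (G b)"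
    proof -
      define q where "q = min (card A) k"
      have "q * (k - s) \<le> card A * (k - s)" by (simp add: q_def)
      also have "\<dots> \<le> k * card (G b)" by (rule b)
      finally have "q * (k - s) \<le> k * card (G b)" .
      moreover have "k * q = q * (k - s) + q * s"
        using False k by (simp add: distrib_left[symmetric])
      moreover have "q * s \<le> k * s" by (simp add: q_def)
      moreover have "k * (s + card (G b)) = k * s + k * card (G b)" by (rule distrib_left)
      ultimately have "k * q \<le> k * (s + card (G b))" by linarith
      moreover have "k > 0" using k cB by simp
      ultimately show ?thesis by (simp add: q_def)
    qed
    then have "card A + min (card A) (card B - 1) \<le> card (cov {lo, hi, b})" using c U k by linarith
    then show ?thesis using lohi b unfolding cov_def
      by (intro exI[of _ "{lo, hi, b}"]) (auto simp: B'_def card_insert_if)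
  qed
qed


section \<open>Arcs of Z_p\<close>

context prime_modulus
begin

text \<open>The residues c, ..., c + z - 1. The length is any integer: z <= 0 gives the empty set
  and z >= p everything.\<close>

definition arc :: "int \<Rightarrow> int \<Rightarrow> int set" where
  "arc c z = {x. (x - c) mod p < z}"

lemma per_arc [simp, intro]: "per (arc c z)"
proof (rule perI)
  fix x
  have "(x + p - c) mod p = (x - c) mod p" by (metis diff_add_eq mod_add_self2)
  then show "x + p \<in> arc c z \<longleftrightarrow> x \<in> arc c z" by (simp add: arc_def)
qed

lemma mem_arc_window: "c \<le> x \<Longrightarrow> x < c + p \<Longrightarrow> x \<in> arc c z \<longleftrightarrow> x < c + z"
  by (auto simp: arc_def)

lemma msr_Int_arc:
  assumes "per A" "z \<le> p"
  shows "msr (A \<inter> arc c z) = card (A \<inter> {c..<c + z})"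
proof -
  have "(A \<inter> arc c z) \<inter> {c..<c + p} = A \<inter> {c..<c + z}"
    using assms by (auto simp: mem_arc_window)
  then show ?thesis using msr_window[of "A \<inter> arc c z" c] assms by simp
qed

lemma msr_arc:
  assumes "0 \<le> z" "z \<le> p"
  shows "int (msr (arc c z)) = z"
  using msr_Int_arc[of UNIV z c] assms by simp

lemma arcI: "c \<le> x \<Longrightarrow> x < c + z \<Longrightarrow> z \<le> p \<Longrightarrow> x \<in> arc c z"
  by (simp add: mem_arc_window)

lemma arc_repr:
  assumes "x \<in> arc c z"
  obtains r k where "0 \<le> r" "r < z" "r < p" "x = c + r + k * p"
proof
  show "x = c + (x - c) mod p + ((x - c) div p) * p" by simp
qed (use assms in \<open>auto simp: arc_def\<close>)

lemma arc_add_multiple: "c + r + k * p \<in> arc c z \<longleftrightarrow> c + r \<in> arc c z"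
  using per_multiple[OF per_arc, of "c + r" k] by simp

lemma interval_le_msr:
  assumes "per X" "{u..<u + d} \<subseteq> X" "d \<le> p"
  shows "d \<le> int (msr X)"
proof -
  have "card {u..<u + d} \<le> msr X"
    by (rule card_le_msr) (use assms in auto)
  then show ?thesis by simp
qed

lemma msr_UN_le:
  assumes "\<And>k. k < h \<Longrightarrow> real (msr (W k)) \<le> u"
  shows "real (msr (\<Union>k<h. W k)) \<le> real h * u"
  using assms
proof (induction h)
  case (Suc h)
  have "real (msr (\<Union>k<Suc h. W k)) \<le> real (msr (\<Union>k<h. W k)) + real (msr (W h))"
    using msr_Un_le[of "\<Union>k<h. W k" "W h"] by (simp add: lessThan_Suc Un_commute flip: of_nat_add)
  also have "\<dots> \<le> real h * u + u" using Suc by (intro add_mono) auto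
  finally show ?case by (simp add: algebra_simps)
qed simp

text \<open>A almost avoids U, the union of the arcs of length z that start in T = c - G. Adding an
  interval of length z to T enlarges each cluster of T by z - 1 elements; two separated clusters
  would leave less room than A needs. So the complement of U is one interval, of length at most p -
  (|G| + z - 1), and A lies mostly in it.\<close>

lemma arc_concentration:
  fixes h :: nat and t :: real and c z :: int
  assumes A: "per A" and G: "per G" "G \<noteq> {}" and z: "0 < z" "z \<le> p" "p \<le> int h * z"
    and t: "\<And>b. b \<in> G \<Longrightarrow> real (msr {x. x \<in> A \<and> x + b \<in> arc c z}) \<le> t"
    and big: "real (msr A) > 2 * h * t" "real (msr A) > 2 * h * t + real_of_int (p - 2 * z - int (msr G) + 2)"
  shows "\<exists>i len. 0 \<le> len \<and> len \<le> p \<and> len \<le> p - z - int (msr G) + 1 \<and>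
    real (msr (A - arc i len)) \<le> 2 * h * t"
proof -
  define T where "T = {s. c - s \<in> G}"
  define U where "U = {x. \<exists>s\<in>T. s \<le> x \<and> x < s + z}"
  have perT: "per T" and msrT: "msr T = msr G" using G by (auto simp: T_def)
  have perU: "per U"
  proof (rule perI)
    fix x
    show "x + p \<in> U \<longleftrightarrow> x \<in> U"
    proof
      assume "x + p \<in> U"
      then obtain s where "s \<in> T" "s \<le> x + p" "x + p < s + z" by (auto simp: U_def)
      then have "s - p \<in> T" "s - p \<le> x" "x < s - p + z" using per_multiple[OF perT, of s "-1"] by auto
      then show "x \<in> U" by (auto simp: U_def)
    next
      assume "x \<in> U"
      then obtain s where "s \<in> T" "s \<le> x" "x < s + z" by (auto simp: U_def)
      then have "s + p \<in> T" "s + p \<le> x + p" "x + p < s + p + z" using perT by auto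
      then show "x + p \<in> U" unfolding U_def by blast
    qed
  qed
  have TU: "T \<subseteq> U" using z by (force simp: U_def)
  define W where "W s = {x. x \<in> A \<and> x + (c - s) \<in> arc c z}" for s
  have W_le: "real (msr (W s)) \<le> t" if "s \<in> T" for s using t[of "c - s"] that by (simp add: W_def T_def)
  have W_mem: "x \<in> W s" if "x \<in> A" "s \<le> x" "x < s + z" for x s
    using that z arcI[of c "x + (c - s)" z] by (auto simp: W_def)
  have perW: "per (W s)" for s unfolding W_def using A by auto
  define F where "F k = T \<inter> {int k * z..<(int k + 1) * z}" for k :: nat
  have finF: "finite (F k)" for k by (simp add: F_def)
  \<comment> \<open>The arcs starting in one stretch of length z are covered by those with the
    smallest and the largest start. So each of the h stretches costs at most 2t.\<close>
  define WW where "WW k = (if F k = {} then {} else W (Min (F k)) \<union> W (Max (F k)))" for k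
  have "A \<inter> U \<subseteq> (\<Union>k<h. WW k)"
  proof
    fix x assume x: "x \<in> A \<inter> U"
    then obtain s where s: "s \<in> T" "s \<le> x" "x < s + z" by (auto simp: U_def)
    define s' x' where "s' = s mod p" and "x' = x + (- (s div p)) * p"
    have e: "s' = s + (- (s div p)) * p" by (simp add: s'_def minus_div_mult_eq_mod)
    have "s' \<in> T" unfolding e using s(1) per_multiple[OF perT] by blast
    moreover have "s' \<le> x'" "x' < s' + z" using s unfolding e x'_def by linarith+
    moreover have "0 \<le> s'" "s' < p" by (simp_all add: s'_def)
    ultimately have s': "s' \<in> T" "s' \<le> x'" "x' < s' + z" "0 \<le> s'" "s' < p" by blast+
    have x'A: "x' \<in> A" using x per_multiple[OF A, of x "- (s div p)"] by (simp add: x'_def)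
    define k where "k = nat (s' div z)"
    have kz: "int k = s' div z" using s' z by (simp add: k_def pos_imp_zdiv_nonneg_iff)
    have "s' div z * z + s' mod z = s'" "0 \<le> s' mod z" "s' mod z < z" using z by auto
    then have k: "int k * z \<le> s'" "s' < (int k + 1) * z" unfolding kz by (simp_all only: distrib_right)
    have "int k * z < int h * z" using k s' z by linarith
    then have "k < h" using z by simp
    have Fk: "s' \<in> F k" using s' k by (simp add: F_def)
    then have ne: "F k \<noteq> {}" by auto
    define lo hi where "lo = Min (F k)" and "hi = Max (F k)"
    have lohi: "lo \<le> s'" "s' \<le> hi" using Fk finF by (auto simp: lo_def hi_def)
    have "lo \<in> F k" "hi \<in> F k" using finF ne by (auto simp: lo_def hi_def)
    then have "hi < lo + z" by (auto simp: F_def distrib_right)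
    have "x' \<in> W lo \<or> x' \<in> W hi"
    proof (cases "hi \<le> x'")
      case True
      then have "x' \<in> W hi" using x'A s' lohi by (intro W_mem) auto
      then show ?thesis by simp
    next
      case False
      then have "x' \<in> W lo" using x'A s' lohi \<open>hi < lo + z\<close> by (intro W_mem) auto
      then show ?thesis by simp
    qed
    then have "x \<in> W lo \<or> x \<in> W hi"
      using per_multiple[OF perW, of x "- (s div p)"] by (simp add: x'_def)
    then show "x \<in> (\<Union>k<h. WW k)" using \<open>k < h\<close> ne by (auto simp: WW_def lo_def hi_def)
  qed
  then have "real (msr (A \<inter> U)) \<le> real (msr (\<Union>k<h. WW k))" by (intro of_nat_mono msr_mono)
  also have "\<dots> \<le> real h * (2 * t)"
  proof (rule msr_UN_le)
    fix k
    have t0: "0 \<le> t"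
      using G(2) t order_trans[OF of_nat_0_le_iff] by blast
    show "real (msr (WW k)) \<le> 2 * t"
    proof (cases "F k = {}")
      case False
      then have "Min (F k) \<in> T" "Max (F k) \<in> T" using Min_in[OF finF] Max_in[OF finF] by (auto simp: F_def)
      then have "real (msr (W (Min (F k)))) + real (msr (W (Max (F k)))) \<le> t + t" by (intro add_mono W_le)
      moreover have "real (msr (WW k)) \<le> real (msr (W (Min (F k))) + msr (W (Max (F k))))"
        using False unfolding WW_def by (intro of_nat_mono) (simp add: msr_Un_le)
      ultimately show ?thesis by simp
    qed (use t0 in \<open>simp add: WW_def\<close>)
  qed
  finally have AU: "real (msr (A \<inter> U)) \<le> 2 * h * t" by simp
  have mA: "msr A \<le> msr (A \<inter> U) + msr (- U)"
  proof -
    have "msr (A - U) \<le> msr (- U)" by (rule msr_mono) auto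
    then show ?thesis using msr_Diff[of A U] by simp
  qed
  \<comment> \<open>The last start before v is followed by z - 1 further elements of U, all before v
    because v is not in U.\<close>
  have gap: "card (T \<inter> {u<..<v}) + nat z \<le> card (U \<inter> {u<..<v}) + 1"
    if uv: "v \<notin> U" "T \<inter> {u<..<v} \<noteq> {}" for u v
  proof -
    have fin: "finite (T \<inter> {u<..<v})" by simp
    define m where "m = Max (T \<inter> {u<..<v})"
    have m: "m \<in> T \<inter> {u<..<v}" using uv fin unfolding m_def by (intro Max_in)
    have m_max: "s \<le> m" if "s \<in> T \<inter> {u<..<v}" for s using fin that unfolding m_def by (rule Max_ge)
    have "m + z \<le> v" using uv(1) m by (force simp: U_def)
    moreover have "{m<..<m + z} \<subseteq> U" using m by (auto simp: U_def intro!: bexI[of _ m])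
    ultimately have sub: "T \<inter> {u<..<v} \<union> {m<..<m + z} \<subseteq> U \<inter> {u<..<v}" using TU m by auto
    have "card (T \<inter> {u<..<v}) + card {m<..<m + z} = card (T \<inter> {u<..<v} \<union> {m<..<m + z})"
      using m_max by (subst card_Un_disjoint) force+
    also have "\<dots> \<le> card (U \<inter> {u<..<v})" using sub by (intro card_mono) auto
    finally show ?thesis using z by simp
  qed
  obtain s0 where s0: "s0 \<in> T"
  proof -
    obtain g where "g \<in> G" using G by auto
    then have "c - g \<in> T" by (simp add: T_def)
    then show ?thesis using that by auto
  qed
  define N where "N = - U \<inter> {s0..<s0 + p}"
  have finN: "finite N" by (simp add: N_def)
  have "card N = msr (- U)" unfolding N_def using perU by (intro msr_window) auto
  moreover have "msr (- U) > 0" using mA AU big(1) by linarith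
  ultimately have "N \<noteq> {}" by auto
  define x1 x2 where "x1 = Min N" and "x2 = Max N"
  have xN: "x1 \<in> N" "x2 \<in> N" "\<And>x. x \<in> N \<Longrightarrow> x1 \<le> x \<and> x \<le> x2"
    using finN \<open>N \<noteq> {}\<close> by (auto simp: x1_def x2_def)
  have x12: "x1 \<le> x2" "x1 \<notin> U" "x2 \<notin> U" "x2 < s0 + p" "s0 \<le> x1" using xN by (auto simp: N_def)
  have "s0 \<noteq> x1" using s0 TU x12 by auto
  then have s0x: "s0 < x1" using x12 by simp
  have s0p: "s0 + p \<in> T" using s0 perT by simp
  have v1: "x1 + p \<notin> U" using x12 perU by simp
  have gap2: "card (T \<inter> {x2<..<x1 + p}) + nat z \<le> card (U \<inter> {x2<..<x1 + p}) + 1"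
    using v1 s0p s0x x12 by (intro gap) auto
  have split: "msr X = card (X \<inter> {x1<..<x2}) + card (X \<inter> {x2<..<x1 + p})" if X: "per X" "X \<subseteq> U" for X
  proof -
    have "msr X = card (X \<inter> {x1..<x1 + p})" using msr_window[OF X(1)] by simp
    also have "X \<inter> {x1..<x1 + p} = X \<inter> {x1<..<x2} \<union> X \<inter> {x2<..<x1 + p}"
    proof -
      have "x1 \<notin> X" "x2 \<notin> X" using X(2) x12 by auto
      then have "x < x2 \<or> x2 < x" "x \<noteq> x1" if "x \<in> X" for x using that by (metis linorder_neqE, metis)
      then show ?thesis using x12 s0x by (fastforce simp: order_le_less)
    qed
    also have "card \<dots> = card (X \<inter> {x1<..<x2}) + card (X \<inter> {x2<..<x1 + p})"
      by (rule card_Un_disjoint) auto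
    finally show ?thesis .
  qed
  \<comment> \<open>Starts on both sides would give |U| >= |G| + 2z - 2, and the second bound in
    \<open>big\<close> says that the complement is then too small for A.\<close>
  have empty: "T \<inter> {x1<..<x2} = {}"
  proof (rule ccontr)
    assume "T \<inter> {x1<..<x2} \<noteq> {}"
    then have "card (T \<inter> {x1<..<x2}) + nat z \<le> card (U \<inter> {x1<..<x2}) + 1"
      using x12 by (intro gap) auto
    then have "msr G + 2 * nat z \<le> msr U + 2"
      using gap2 split[OF perT TU] split[OF perU] msrT by simp
    moreover have "msr (- U) + msr U = nat p" by (rule msr_Compl)
    ultimately have "int (msr (- U)) \<le> p - 2 * z - int (msr G) + 2" using z by linarith
    then have "real (msr (- U)) \<le> real_of_int (p - 2 * z - int (msr G) + 2)" by linarith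
    then show False using mA AU big(2) by linarith
  qed
  have Uempty: "U \<inter> {x1<..<x2} = {}"
  proof (rule ccontr)
    assume "U \<inter> {x1<..<x2} \<noteq> {}"
    then obtain y s where ys: "x1 < y" "y < x2" "s \<in> T" "s \<le> y" "y < s + z" by (auto simp: U_def)
    have "x1 < s" using x12(2) ys by (force simp: U_def)
    then show False using empty ys by auto
  qed
  define len where "len = x2 - x1 + 1"
  have "card (U \<inter> {x2<..<x1 + p}) \<le> card {x2<..<x1 + p}" by (intro card_mono) auto
  moreover have "card (T \<inter> {x2<..<x1 + p}) = msr G" using split[OF perT TU] empty msrT by simp
  moreover have "card {x2<..<x1 + p} = nat (x1 + p - x2 - 1)" by simp
  ultimately have "msr G + nat z \<le> nat (x1 + p - x2 - 1) + 1" using gap2 by linarith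
  then have len: "len \<le> p - z - int (msr G) + 1" using x12 s0x z unfolding len_def by linarith
  have "A - arc x1 len \<subseteq> A \<inter> U"
  proof
    fix x assume x: "x \<in> A - arc x1 len"
    have "x \<in> U"
    proof (rule ccontr)
      assume "x \<notin> U"
      define x' where "x' = s0 + (x - s0) mod p"
      have x': "x = x' + ((x - s0) div p) * p" by (simp add: x'_def)
      have "x' \<notin> U" using \<open>x \<notin> U\<close> per_multiple[OF perU, of x' "(x - s0) div p"] x' by simp
      moreover have "s0 \<le> x'" "x' < s0 + p" by (simp_all add: x'_def)
      ultimately have "x' \<in> N" by (simp add: N_def)
      then have "x1 \<le> x'" "x' \<le> x2" using xN by auto
      then have "x' \<in> arc x1 len" using x12 s0x by (intro arcI) (auto simp: len_def)
      then have "x \<in> arc x1 len" using per_multiple[OF per_arc, of x' "(x - s0) div p"] x' by simp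
      then show False using x by simp
    qed
    then show "x \<in> A \<inter> U" using x by simp
  qed
  then have "real (msr (A - arc x1 len)) \<le> real (msr (A \<inter> U))" by (intro of_nat_mono msr_mono)
  then show ?thesis using AU len x12 s0x unfolding len_def
    by (intro exI[of _ x1] exI[of _ "x2 - x1 + 1"]) auto
qed

text \<open>Let t be the offset of b from j. Measured from i + j, the moved arc covers the offsets
  t, ..., t + l1 - 1 and the sum of the arcs covers 0, ..., l1 + l2 - 2. The \<open>\<delta>\<close>
  offsets from max t (l1 + l2 - 1) on lie in the first range only, and end before wrapping
  round.\<close>

lemma arc_escape:
  assumes len: "0 < l1" "0 < l2" "l1 + l2 + \<delta> \<le> p + 1" "0 \<le> \<delta>" "\<delta> \<le> l1"
    and b: "b \<notin> arc (j - \<delta>) (l2 + 2 * \<delta>)"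
  shows "\<delta> \<le> int (msr ({x. x - b \<in> arc i l1} - arc (i + j) (l1 + l2 - 1)))"
proof -
  define r where "r = (b - (j - \<delta>)) mod p"
  have r: "l2 + 2 * \<delta> \<le> r" "r < p" using b by (auto simp: r_def arc_def)
  define t where "t = r - \<delta>"
  have t: "l2 + \<delta> \<le> t" "t + \<delta> < p" using r by (auto simp: t_def)
  have bt: "b = j + t + ((b - (j - \<delta>)) div p) * p"
    unfolding t_def r_def by (simp add: minus_div_mult_eq_mod[symmetric])
  define v where "v = max t (l1 + l2 - 1)"
  have v: "t \<le> v" "l1 + l2 - 1 \<le> v" "v + \<delta> \<le> p" "v + \<delta> \<le> t + l1"
    using t len by (auto simp: v_def)
  have "{i + j + v..<i + j + v + \<delta>} \<subseteq> {x. x - b \<in> arc i l1} - arc (i + j) (l1 + l2 - 1)"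
  proof
    fix x assume x: "x \<in> {i + j + v..<i + j + v + \<delta>}"
    have "x - b = i + (x - i - j - t) + (- ((b - (j - \<delta>)) div p)) * p"
      using bt by simp
    moreover have "i + (x - i - j - t) \<in> arc i l1" using x v len by (intro arcI) auto
    ultimately have "x - b \<in> arc i l1" by (simp only: arc_add_multiple)
    moreover have "x \<notin> arc (i + j) (l1 + l2 - 1)"
      using x v t len by (subst mem_arc_window) auto
    ultimately show "x \<in> {x. x - b \<in> arc i l1} - arc (i + j) (l1 + l2 - 1)" by simp
  qed
  moreover have "\<delta> \<le> p" using v t len by linarith
  ultimately show ?thesis by (intro interval_le_msr) auto
qed

lemma arc_add:
  assumes "x \<in> arc i l1" "y \<in> arc j l2" "l1 + l2 - 1 \<le> p"
  shows "x + y \<in> arc (i + j) (l1 + l2 - 1)"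
proof -
  obtain r k where r: "0 \<le> r" "r < l1" "x = i + r + k * p" using assms(1) by (rule arc_repr)
  obtain s m where s: "0 \<le> s" "s < l2" "y = j + s + m * p" using assms(2) by (rule arc_repr)
  have "x + y = (i + j) + (r + s) + (k + m) * p" unfolding r s by (simp add: algebra_simps)
  moreover have "(i + j) + (r + s) \<in> arc (i + j) (l1 + l2 - 1)"
    using r s assms(3) by (intro arcI) auto
  ultimately show ?thesis by (simp only: arc_add_multiple)
qed

text \<open>The arcs are read as intervals of integers, and l1 + l2 - 1 <= p prevents wrapping.
  Keeping X inside the sum of the arcs makes anything gained outside it disjoint from X.\<close>

lemma three_translates_arc:
  assumes AB: "per A" "per B" and len: "0 \<le> l1" "0 \<le> l2" "l1 + l2 - 1 \<le> p" "l1 \<le> p" "l2 \<le> p"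
    and ne: "B \<inter> arc j l2 \<noteq> {}"
  shows "\<exists>D X. D \<subseteq> B \<and> finite D \<and> card D \<le> 3 \<and> per X \<and> X \<subseteq> sumset A D \<and> X \<subseteq> arc (i + j) (l1 + l2 - 1) \<and>
    msr (A \<inter> arc i l1) + min (msr (A \<inter> arc i l1)) (msr (B \<inter> arc j l2) - 1) \<le> msr X"
proof -
  define AZ BZ where "AZ = A \<inter> {i..<i + l1}" and "BZ = B \<inter> {j..<j + l2}"
  have cards: "card AZ = msr (A \<inter> arc i l1)" "card BZ = msr (B \<inter> arc j l2)"
    unfolding AZ_def BZ_def using AB len by (simp_all add: msr_Int_arc)
  have "msr (B \<inter> arc j l2) \<noteq> 0" using ne AB msr_0_iff[of "B \<inter> arc j l2"] by auto
  then have "finite AZ" "finite BZ" "BZ \<noteq> {}" using cards by (auto simp: AZ_def BZ_def)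
  from three_translates_int[OF this] obtain D where D: "D \<subseteq> BZ" "card D \<le> 3"
    "card AZ + min (card AZ) (card BZ - 1) \<le> card {x. \<exists>d\<in>D. x - d \<in> AZ}" by auto
  have finD: "finite D" using D(1) by (rule finite_subset) (simp add: BZ_def)
  define X where "X = sumset A D \<inter> arc (i + j) (l1 + l2 - 1)"
  define Z where "Z = {x. \<exists>d\<in>D. x - d \<in> AZ}"
  have bounds: "i + j \<le> x \<and> x < i + j + (l1 + l2 - 1)" if x: "x \<in> Z" for x
  proof -
    obtain d where "d \<in> D" "x - d \<in> AZ" using x by (auto simp: Z_def)
    then show ?thesis using D(1) by (force simp: AZ_def BZ_def)
  qed
  then have "Z \<subseteq> {i + j..<i + j + (l1 + l2 - 1)}" by auto
  then have finZ: "finite Z" using finite_subset by blast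
  have "Z \<subseteq> X"
  proof
    fix x assume x: "x \<in> Z"
    have "x \<in> arc (i + j) (l1 + l2 - 1)" using bounds[OF x] len by (intro arcI) auto
    moreover have "x \<in> sumset A D" using x by (auto simp: Z_def AZ_def sumset_def)
    ultimately show "x \<in> X" by (simp add: X_def)
  qed
  moreover have "per X" unfolding X_def using AB by auto
  moreover have "\<bar>x - y\<bar> < p" if "x \<in> Z" "y \<in> Z" for x y
    using bounds[OF that(1)] bounds[OF that(2)] len by linarith
  ultimately have "card Z \<le> msr X" using finZ by (intro card_le_msr)
  then show ?thesis using D finD \<open>per X\<close> unfolding cards Z_def[symmetric]
    by (intro exI[of _ D] exI[of _ X]) (auto simp: X_def BZ_def)
qed

lemma msr_sumset_Diff_le:
  assumes "finite D" "\<And>d. d \<in> D \<Longrightarrow> msr ({x. x - d \<in> A} - Q) \<le> u"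
  shows "msr (sumset A D - Q) \<le> card D * u"
  using assms
proof (induction D)
  case (insert d D)
  have "sumset A (insert d D) - Q = ({x. x - d \<in> A} - Q) \<union> (sumset A D - Q)"
    by (auto simp: sumset_def)
  then have "msr (sumset A (insert d D) - Q) \<le> msr ({x. x - d \<in> A} - Q) + msr (sumset A D - Q)"
    by (simp add: msr_Un_le)
  also have "\<dots> \<le> u + card D * u" using insert by (intro add_mono) auto
  finally show ?case using insert by simp
qed (simp add: sumset_def)

text \<open>An element of \<open>B\<close> far from the arc \<open>J\<close> moves a proportion of \<open>A \<inter> I\<close> off \<open>I + J\<close>.\<close>

lemma all_in_enlarged_arc:
  fixes n :: nat
  assumes AB: "per A" "per B" "msr A = n" "msr B = n" "3 * int n \<le> p" and n: "n \<ge> 1000"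
    and arcs: "0 \<le> l1" "0 \<le> l2" "1000 * l1 \<le> 1001 * int n" "1000 * l2 \<le> 1001 * int n"
      "1000 * msr (A - arc i l1) \<le> n" "1000 * msr (B - arc j l2) \<le> n"
    and no_cover: "\<And>D. D \<subseteq> B \<Longrightarrow> finite D \<Longrightarrow> card D \<le> 23 \<Longrightarrow> msr (sumset A D) \<le> 2 * n - 2"
  shows "\<exists>j' l'. 0 \<le> l' \<and> 1000 * l' \<le> 1013 * int n \<and> B \<subseteq> arc j' l'"
proof -
  define I J where "I = arc i l1" and "J = arc j l2"
  have mI: "1000 * msr (A \<inter> I) \<ge> 999 * n" and mJ: "1000 * msr (B \<inter> J) \<ge> 999 * n"
    using msr_Diff[of A I] msr_Diff[of B J] AB arcs(5,6) unfolding I_def J_def by linarith+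
  \<comment> \<open>The margin n/200, rounded up, exceeds the errors of a few n/1000, yet enlarges
    the arc only to 1013/1000 n.\<close>
  define \<delta> where "\<delta> = (int n * 5 + 999) div 1000"
  have \<delta>: "5 * int n \<le> 1000 * \<delta>" "1000 * \<delta> \<le> 6 * int n" using n unfolding \<delta>_def by linarith+
  have lle: "l1 \<le> p" "l2 \<le> p" using AB arcs n by linarith+
  have "msr (A \<inter> I) \<le> msr I" "msr (B \<inter> J) \<le> msr J" by (auto intro: msr_mono)
  then have lge: "int (msr (A \<inter> I)) \<le> l1" "int (msr (B \<inter> J)) \<le> l2"
    using msr_arc[OF arcs(1) lle(1), of i] msr_arc[OF arcs(2) lle(2), of j] unfolding I_def J_def by linarith+
  have "B \<subseteq> arc (j - \<delta>) (l2 + 2 * \<delta>)"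
  proof
    fix b assume b: "b \<in> B"
    show "b \<in> arc (j - \<delta>) (l2 + 2 * \<delta>)"
    proof (rule ccontr)
      assume out: "b \<notin> arc (j - \<delta>) (l2 + 2 * \<delta>)"
      define Q where "Q = arc (i + j) (l1 + l2 - 1)"
      have esc: "\<delta> \<le> int (msr ({x. x - b \<in> I} - Q))" unfolding I_def Q_def
        using out by (rule arc_escape[rotated -1]) (use lge mI mJ \<delta> n arcs AB in linarith)+
      have "msr (B \<inter> J) > 0" using mJ n by linarith
      then have "B \<inter> arc j l2 \<noteq> {}" unfolding J_def by (metis less_irrefl msr_empty)
      then obtain D X where D: "D \<subseteq> B" "finite D" "card D \<le> 3" "per X" "X \<subseteq> sumset A D" "X \<subseteq> Q"
        "msr (A \<inter> I) + min (msr (A \<inter> I)) (msr (B \<inter> J) - 1) \<le> msr X"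
        using three_translates_arc[OF AB(1,2) arcs(1,2) _ lle, of j i] arcs AB n
        unfolding I_def J_def Q_def by (smt (verit) of_nat_0_le_iff)
      define E where "E = {x. x - b \<in> A \<inter> I} - Q"
      have "msr ({x. x - b \<in> I} - Q) \<le> msr (E \<union> {x. x - b \<in> I - A})"
        by (rule msr_mono) (auto simp: E_def)
      also have "\<dots> \<le> msr E + msr {x. x - b \<in> I - A}" by (rule msr_Un_le)
      also have "msr {x. x - b \<in> I - A} = msr (I - A)" by (rule msr_shift(2)) (use AB in \<open>auto simp: I_def\<close>)
      finally have E: "msr ({x. x - b \<in> I} - Q) \<le> msr E + msr (I - A)" .
      have IA: "msr (I - A) + msr (A \<inter> I) = msr I" using msr_Diff[of I A] by (simp add: Int_commute)
      have "X \<union> E \<subseteq> sumset A (insert b D)" using D(5) by (auto simp: E_def sumset_def)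
      then have "msr (X \<union> E) \<le> msr (sumset A (insert b D))" by (rule msr_mono)
      moreover have "X \<inter> E = {}" using D(6) by (auto simp: E_def)
      then have "msr (X \<union> E) = msr X + msr E" using msr_Un_Int[of X E] by simp
      moreover have "msr (sumset A (insert b D)) \<le> 2 * n - 2"
        using D b by (intro no_cover) (auto simp: card_insert_if)
      ultimately have "msr X + msr E \<le> 2 * n - 2" by linarith
      moreover have "int (msr I) = l1" unfolding I_def using arcs lle by (intro msr_arc)
      \<comment> \<open>X has at least 1.998 n - 1 elements, and b adds at least 0.005 n less the at
        most 0.002 n holes of A in I.\<close>
      ultimately show False using D(7) E IA esc \<delta> mI mJ n arcs by linarith
    qed
  qed
  then show ?thesis using \<delta> arcs by (intro exI[of _ "j - \<delta>"] exI[of _ "l2 + 2 * \<delta>"]) auto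
qed

text \<open>Let e be the number of elements of A outside an enlarged arc. Three translates give 2n -
  1 if e = 0 and 2(n - e) otherwise. The deficit is recovered from the outliers: each moves at least
  n/10 elements of B to new places, so on average over B a further translate gains e/10.\<close>

lemma arcs_contradiction:
  fixes n :: nat
  assumes AB: "per A" "per B" "msr A = n" "msr B = n" "3 * int n \<le> p" and n: "n \<ge> 1000"
    and arcs: "0 \<le> l1" "0 \<le> l2" "1000 * l1 \<le> 1001 * int n" "1000 * l2 \<le> 1001 * int n"
      "1000 * msr (A - arc i l1) \<le> n" "1000 * msr (B - arc j l2) \<le> n"
    and no_cover: "\<And>D. D \<subseteq> B \<Longrightarrow> finite D \<Longrightarrow> card D \<le> 23 \<Longrightarrow> msr (sumset A D) \<le> 2 * n - 2"
  shows False
proof -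
  obtain j' l' where J: "0 \<le> l'" "1000 * l' \<le> 1013 * int n" "B \<subseteq> arc j' l'"
    using all_in_enlarged_arc[OF assms] by blast
  have BJ: "B \<inter> arc j' l' = B" using J by auto
  define \<delta> where "\<delta> = int n div 5"
  have \<delta>: "int n \<le> 5 * \<delta> + 4" "5 * \<delta> \<le> int n" unfolding \<delta>_def by linarith+
  define I where "I = arc (i - \<delta>) (l1 + 2 * \<delta>)"
  define F where "F = A - I"
  define e where "e = msr F"
  have perF: "per F" unfolding F_def I_def using AB by auto
  have lle: "l1 \<le> p" "l' \<le> p" "l1 + 2 * \<delta> \<le> p" "l1 + 2 * \<delta> + l' - 1 \<le> p" using AB arcs J \<delta> n by linarith+
  have lle': "l' + l1 - 1 \<le> p" using lle(4) \<delta> n by linarith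
  have "B \<noteq> {}" using AB n by auto
  then obtain D0 X where D0: "D0 \<subseteq> B" "finite D0" "card D0 \<le> 3" "X \<subseteq> sumset A D0"
    "msr (A \<inter> I) + min (msr (A \<inter> I)) (n - 1) \<le> msr X"
    using three_translates_arc[OF AB(1,2) _ J(1) lle(4,3,2), of j' "i - \<delta>"] arcs(1) \<delta> unfolding I_def BJ AB(4)
    by auto
  have m0: "msr (A \<inter> I) + min (msr (A \<inter> I)) (n - 1) \<le> msr (sumset A D0)"
    using D0 msr_mono[OF D0(4)] by linarith
  have ae: "e + msr (A \<inter> I) = n" using msr_Diff[of A I] AB unfolding e_def F_def by simp
  have "e \<ge> 1"
  proof (rule ccontr)
    assume "\<not> e \<ge> 1"
    then have "2 * n - 1 \<le> msr (sumset A D0)" using m0 ae n by simp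
    moreover have "msr (sumset A D0) \<le> 2 * n - 2" using D0 by (intro no_cover) auto
    ultimately show False using n by linarith
  qed
  then have start: "2 * n \<le> msr (sumset A D0) + 2 * e" using m0 ae by simp
  have "msr (B \<inter> arc j' l') \<le> msr (arc j' l')" by (intro msr_mono) auto
  then have l'n: "int n \<le> l'" unfolding BJ using AB msr_arc[OF J(1) lle(2), of j'] by simp
  have l1n: "999 * int n \<le> 1000 * l1"
  proof -
    have "msr (A \<inter> arc i l1) \<le> msr (arc i l1)" by (intro msr_mono) auto
    then have "int (msr (A \<inter> arc i l1)) \<le> l1" using msr_arc[OF arcs(1) lle(1), of i] by linarith
    then show ?thesis using msr_Diff[of A "arc i l1"] AB arcs by linarith
  qed
  have gain: "\<exists>b\<in>B. e \<le> 10 * msr ({x. x - b \<in> A} - sumset A D)"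
    if D: "D \<subseteq> B" "finite D" "card D \<le> 23" for D
  proof (rule ccontr)
    assume neg: "\<not> ?thesis"
    define SD where "SD = sumset A D"
    define Q where "Q = arc (j' + i) (l' + l1 - 1)"
    have perSD: "per SD" unfolding SD_def using AB by auto
    have SDQ: "1000 * msr (SD - Q) \<le> 23 * n"
    proof -
      have "msr ({x. x - d \<in> A} - Q) \<le> msr (A - arc i l1)" if "d \<in> D" for d
      proof -
        have "{x. x - d \<in> A} - Q \<subseteq> {x. x - d \<in> A - arc i l1}"
        proof
          fix x assume x: "x \<in> {x. x - d \<in> A} - Q"
          have "d \<in> arc j' l'" using that D J by auto
          then have "x - d \<notin> arc i l1"
            using x arc_add[of d j' l' "x - d" i l1] lle' unfolding Q_def by auto
          then show "x \<in> {x. x - d \<in> A - arc i l1}" using x by simp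
        qed
        then have "msr ({x. x - d \<in> A} - Q) \<le> msr {x. x - d \<in> A - arc i l1}" by (rule msr_mono)
        also have "\<dots> = msr (A - arc i l1)" by (rule msr_shift(2)) (use AB in auto)
        finally show ?thesis .
      qed
      then have "msr (SD - Q) \<le> card D * msr (A - arc i l1)"
        unfolding SD_def by (intro msr_sumset_Diff_le[OF D(2)])
      also have "\<dots> \<le> 23 * msr (A - arc i l1)" using D by (intro mult_right_mono) auto
      finally show ?thesis using arcs(5) by linarith
    qed
    \<comment> \<open>Of the about n/5 elements of x + J outside Q, at most 0.013 n come from holes
      of B and at most 0.023 n lie in the union already.\<close>
    have lower: "n \<le> 10 * msr {y. y \<in> B \<and> x + y \<notin> SD}" if x: "x \<in> F" for x
    proof -
      have "x \<notin> arc (i - \<delta>) (l1 + 2 * \<delta>)" using x by (simp add: F_def I_def)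
      then have esc: "\<delta> \<le> int (msr ({z. z - x \<in> arc j' l'} - Q))" unfolding Q_def
        by (rule arc_escape[rotated -1]) (use l'n l1n \<delta> n arcs AB lle in linarith)+
      define E where "E = {z. z - x \<in> B \<and> z \<notin> SD}"
      have "{z. z - x \<in> arc j' l'} - Q \<subseteq> E \<union> ({z. z - x \<in> arc j' l' - B} \<union> (SD - Q))"
        by (auto simp: E_def)
      then have "msr ({z. z - x \<in> arc j' l'} - Q) \<le> msr (E \<union> ({z. z - x \<in> arc j' l' - B} \<union> (SD - Q)))"
        by (rule msr_mono)
      also have "\<dots> \<le> msr E + (msr {z. z - x \<in> arc j' l' - B} + msr (SD - Q))"
        using msr_Un_le[of E] msr_Un_le[of "{z. z - x \<in> arc j' l' - B}" "SD - Q"] by (meson add_left_mono order_trans)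
      also have "msr {z. z - x \<in> arc j' l' - B} = msr (arc j' l' - B)" by (rule msr_shift(2)) (use AB in auto)
      finally have 1: "msr ({z. z - x \<in> arc j' l'} - Q) \<le> msr E + (msr (arc j' l' - B) + msr (SD - Q))" .
      have 2: "int (msr (arc j' l' - B)) + int n = l'"
        using msr_Diff_subset[OF J(3)] AB msr_arc[OF J(1) lle(2), of j'] by linarith
      have "msr {y. x + y \<in> E} = msr E" by (rule msr_shift(5)) (use AB perSD in \<open>auto simp: E_def\<close>)
      then have "msr {y. y \<in> B \<and> x + y \<notin> SD} = msr E" by (simp add: E_def)
      then show ?thesis using 1 2 esc SDQ \<delta> J n by linarith
    qed
    have sw: "misses SD F B = misses SD B F"
      unfolding misses_def by (subst sum.swap) (intro sum.cong refl, auto simp: add.commute)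
    \<comment> \<open>Pairs of an outlier and an element of B with sum outside the union, counted
      both ways.\<close>
    have "real n / 10 * e \<le> real (misses SD F B)"
    proof -
      have "real n / 10 * e = (\<Sum>x\<in>{0..<p}. of_bool (x \<in> F) * (real n / 10))"
        unfolding e_def msr_sum by (simp add: sum_distrib_left mult.commute)
      also have "\<dots> \<le> (\<Sum>x\<in>{0..<p}. of_bool (x \<in> F) * real (msr {y. y \<in> B \<and> y + x \<notin> SD}))"
        using lower by (intro sum_mono) (fastforce simp: add.commute)
      also have "\<dots> = real (misses SD F B)" unfolding sw unfolding misses_fiber by simp
      finally show ?thesis .
    qed
    moreover have "real (misses SD F B) \<le> (real e - 1) / 10 * msr B"
    proof (rule misses_le)
      fix y assume "y \<in> B"
      then have "10 * msr ({x. x - y \<in> A} - SD) < e" using neg unfolding SD_def by auto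
      moreover have "msr {x. x \<in> F \<and> x + y \<notin> SD} = msr {x. x - y \<in> {x. x \<in> F \<and> x + y \<notin> SD}}"
        by (rule msr_shift(2)[symmetric]) (use perF perSD in auto)
      moreover have "msr {x. x - y \<in> {x. x \<in> F \<and> x + y \<notin> SD}} \<le> msr ({x. x - y \<in> A} - SD)"
        by (rule msr_mono) (auto simp: F_def)
      ultimately have "10 * msr {x. x \<in> F \<and> x + y \<notin> SD} + 1 \<le> e" by linarith
      then have "real (10 * msr {x. x \<in> F \<and> x + y \<notin> SD} + 1) \<le> real e" by (rule of_nat_mono)
      then show "real (msr {x. x \<in> F \<and> x + y \<notin> SD}) \<le> (real e - 1) / 10" by simp
    qed
    ultimately have "real n / 10 * e \<le> (real e - 1) / 10 * real n" unfolding AB(4) by linarith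
    then show False using n by (simp add: field_simps)
  qed
  \<comment> \<open>A deficit of 2e at a gain of e/10 per translate takes 20 translates; with the
    first three this is the number 23.\<close>
  have iter: "\<exists>D\<subseteq>B. finite D \<and> card D \<le> 3 + k \<and> 20 * n + k * e \<le> 10 * msr (sumset A D) + 20 * e" if "k \<le> 20" for k
    using that
  proof (induction k)
    case 0
    then show ?case using D0 start by (intro exI[of _ D0]) auto
  next
    case (Suc k)
    then obtain D where D: "D \<subseteq> B" "finite D" "card D \<le> 3 + k" "20 * n + k * e \<le> 10 * msr (sumset A D) + 20 * e"
      by auto
    obtain b where b: "b \<in> B" "e \<le> 10 * msr ({x. x - b \<in> A} - sumset A D)"
      using gain[OF D(1,2)] D Suc.prems by auto
    have eq: "sumset A (insert b D) = ({x. x - b \<in> A} - sumset A D) \<union> sumset A D" by (auto simp: sumset_def)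
    have "({x. x - b \<in> A} - sumset A D) \<inter> sumset A D = {}" by auto
    then have "msr (sumset A (insert b D)) = msr ({x. x - b \<in> A} - sumset A D) + msr (sumset A D)"
      using msr_Un_Int[of "{x. x - b \<in> A} - sumset A D" "sumset A D"] unfolding eq by simp
    then have "20 * n + Suc k * e \<le> 10 * msr (sumset A (insert b D)) + 20 * e" using D b by simp
    then show ?case using D b by (intro exI[of _ "insert b D"]) (auto simp: card_insert_if)
  qed
  obtain D where D: "D \<subseteq> B" "finite D" "card D \<le> 23" "20 * n \<le> 10 * msr (sumset A D)"
    using iter[of 20] by auto
  moreover have "msr (sumset A D) \<le> 2 * n - 2" using D by (intro no_cover)
  ultimately show False using n by linarith
qed

section \<open>Dilations and the choice of a scale\<close>

lemma defect_dilate: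
  assumes "per S" "\<not> p dvd \<mu>"
  shows "defect {y. \<mu> * y \<in> S} g = defect S (\<mu> * g)"
proof -
  have "msr {y. \<mu> * y + 0 \<in> {x. x \<in> S \<and> x + \<mu> * g \<notin> S}} = msr {x. x \<in> S \<and> x + \<mu> * g \<notin> S}"
    by (rule msr_affine) (use assms coprime_of_not_dvd in auto)
  then show ?thesis unfolding defect_def by (simp add: distrib_left)
qed

lemma sumset_dilate:
  "sumset {y. \<mu> * y \<in> A} {y. \<mu> * y \<in> B} \<subseteq> {y. \<mu> * y \<in> sumset A B}"
  by (auto simp: distrib_left elim!: sumsetE intro!: sumsetI)

lemma msr_dilate: "per A \<Longrightarrow> \<not> p dvd \<mu> \<Longrightarrow> msr {y. \<mu> * y \<in> A} = msr A"
  using msr_affine[of A \<mu> 0] coprime_of_not_dvd by simp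

text \<open>\<open>msr_near_upper\<close> for |S| between 1.9 n and 2n. What matters is 27/10 < 3:
  as p >= 3n, balls up to radius n/2 are proper and \<open>msr_near_double\<close> applies.\<close>

lemma msr_near_half:
  fixes n :: nat and w :: real
  assumes S: "per S" "msr S \<le> 2 * n" "19 / 10 * n \<le> msr S" and w: "0 < w" "w \<le> n / 2"
  shows "real (msr (near S w)) \<le> 27 / 10 * n"
proof -
  define s where "s = real (msr S)"
  have s: "19 / 10 * n \<le> s" "s \<le> 2 * n" using S by (auto simp: s_def)
  have n: "real n > 0" using w by linarith
  have "real (msr (near S w)) * (s - n / 2) \<le> real (msr (near S w)) * (s - w)"
    using w by (intro mult_left_mono) auto
  also have "\<dots> \<le> s\<^sup>2" unfolding s_def using S w s n by (intro msr_near_upper) (auto simp: s_def)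
  also have "\<dots> \<le> 27 / 10 * n * (s - n / 2)"
  proof -
    have "0 \<le> (2 * n - s) * (s - 19 / 10 * n)" using s by (intro mult_nonneg_nonneg) auto
    moreover have "(2 * n - s) * (s - 19 / 10 * n) = 39 / 10 * (n * s) - 38 / 10 * (real n * n) - s * s"
      by (simp add: field_simps)
    moreover have "27 / 10 * n * (s - n / 2) = 27 / 10 * (n * s) - 27 / 20 * (real n * n)"
      by (simp add: field_simps)
    moreover have "real n * s \<le> real n * (2 * n)" using s n by (intro mult_left_mono) auto
    then have "real n * s \<le> 2 * (real n * n)" by simp
    moreover have "0 \<le> real n * n" by simp
    ultimately show ?thesis unfolding power2_eq_square by linarith
  qed
  finally show ?thesis using s n by (simp add: mult_le_cancel_right)
qed

text \<open>By Cauchy--Davenport \<open>(|N(2\<^sup>i v)| - 1) / 2\<^sup>i v\<close> is increasing in \<open>i\<close>; it is bounded on both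
  sides, so it is almost constant on some long run of scales.\<close>

lemma ex_good_scale:
  fixes n I m0 :: nat and v :: real
  assumes S: "per S" "msr S \<le> 2 * n" "19 / 10 * n \<le> msr S" and p: "3 * int n \<le> p"
    and v: "v > 0" "2 ^ (m0 * I) * v \<le> n / 2" and low: "19 / 10 * v + 1 \<le> msr (near S v)"
    and m0: "12 \<le> (101 / 100 :: real) ^ m0"
  defines "N \<equiv> \<lambda>i. real (msr (near S (2 ^ i * v))) - 1"
  shows "\<And>i. i < m0 * I \<Longrightarrow> 2 * N i \<le> N (Suc i)"
    and "\<And>i. i \<le> m0 * I \<Longrightarrow> 19 / 10 * (2 ^ i * v) \<le> N i"
    and "\<And>i. i \<le> m0 * I \<Longrightarrow> N i \<le> 108 / 10 * (2 ^ i * v)"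
    and "\<exists>j. j + I \<le> m0 * I \<and> N (j + I) \<le> 101 / 100 * 2 ^ I * N j"
proof -
  have "0 < 2 ^ (m0 * I) * v" using v by simp
  then have "real n > 0" using v(2) by linarith
  then have n: "n > 0" by simp
  have half: "real (msr (near S w)) \<le> 27 / 10 * n" if "0 < w" "w \<le> n / 2" for w
    using msr_near_half[OF S that] .
  \<comment> \<open>The 1 subtracted in \<open>N\<close> absorbs the loss in
    Cauchy-Davenport.\<close>
  have dbl: "2 * N i \<le> N (Suc i)" if i: "2 ^ Suc i * v \<le> n / 2" for i
  proof -
    have "near S (2 ^ Suc i * v) \<noteq> UNIV"
    proof
      assume "near S (2 ^ Suc i * v) = UNIV"
      then have "real (nat p) \<le> 27 / 10 * n" using half[OF _ i] v by simp
      then show False using p n by simp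
    qed
    then have "2 * msr (near S (2 ^ i * v)) \<le> msr (near S (2 * (2 ^ i * v))) + 1"
      using v by (intro msr_near_double) (auto simp: S mult.assoc)
    then show ?thesis unfolding N_def by (simp add: mult.assoc)
  qed
  have "\<exists>t. n / 4 < 2 ^ t * v"
  proof -
    obtain t where "n / 4 / v < 2 ^ t" using real_arch_pow[of 2 "n / 4 / v"] by auto
    then show ?thesis using v by (auto simp: field_simps)
  qed
  \<comment> \<open>The scale with n/4 < 2^t v <= n/2. There the ball has at most 2.7 n <= 10.8 (2^t
    v) elements, and doubling passes this ratio down to all smaller scales.\<close>
  define t where "t = (LEAST t. n / 4 < 2 ^ t * v)"
  have t: "n / 4 < 2 ^ t * v" unfolding t_def using \<open>\<exists>t. _\<close> by (rule LeastI_ex)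
  have thalf: "2 ^ t * v \<le> n / 2 \<or> t = 0"
  proof (cases t)
    case (Suc t')
    then have "\<not> n / 4 < 2 ^ t' * v" using not_less_Least[of t' "\<lambda>t. n / 4 < 2 ^ t * v"] by (simp add: t_def)
    then show ?thesis using Suc by simp
  qed simp
  have v_le: "v \<le> 2 ^ (m0 * I) * v" using v by (simp add: mult_le_cancel_right1)
  have "v \<le> n / 2" using v_le v(2) by linarith
  then have tle: "2 ^ t * v \<le> n / 2" using thalf by auto
  have "m0 * I < Suc t"
  proof (rule ccontr)
    assume "\<not> m0 * I < Suc t"
    then have "(2::real) ^ Suc t \<le> 2 ^ (m0 * I)" by (intro power_increasing) auto
    then have "2 ^ Suc t * v \<le> 2 ^ (m0 * I) * v" using v by (intro mult_right_mono) auto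
    moreover have "2 ^ Suc t * v = 2 * (2 ^ t * v)" by simp
    ultimately show False using t v by linarith
  qed
  then have Jt: "m0 * I \<le> t" by simp
  have dbl_t: "2 * N i \<le> N (Suc i)" if "i < t" for i
  proof (rule dbl)
    have "(2::real) ^ Suc i \<le> 2 ^ t" using that by (intro power_increasing) auto
    then have "2 ^ Suc i * v \<le> 2 ^ t * v" using v by (intro mult_right_mono) auto
    then show "2 ^ Suc i * v \<le> n / 2" using tle by linarith
  qed
  have iter: "2 ^ d * N i \<le> N (i + d)" if "i + d \<le> t" for i d
    using that
  proof (induction d)
    case (Suc d)
    then have "2 * (2 ^ d * N i) \<le> 2 * N (i + d)" by simp
    also have "\<dots> \<le> N (Suc (i + d))" using Suc.prems by (intro dbl_t) simp
    finally show ?case by simp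
  qed simp
  show "2 * N i \<le> N (Suc i)" if "i < m0 * I" for i
    using that Jt by (intro dbl_t) simp
  have N0: "19 / 10 * v \<le> N 0" using low by (simp add: N_def)
  show lower: "19 / 10 * (2 ^ i * v) \<le> N i" if "i \<le> m0 * I" for i
  proof -
    have "2 ^ i * (19 / 10 * v) \<le> 2 ^ i * N 0" using N0 by (intro mult_left_mono) auto
    also have "\<dots> \<le> N i" using iter[of 0 i] that Jt by simp
    finally show ?thesis by simp
  qed
  show upper: "N i \<le> 108 / 10 * (2 ^ i * v)" if "i \<le> m0 * I" for i
  proof -
    have it: "i \<le> t" using that Jt by simp
    have "2 ^ (t - i) * N i \<le> N t" using iter[of i "t - i"] it by simp
    also have "\<dots> \<le> 27 / 10 * n" using half[OF _ tle] v by (simp add: N_def)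
    also have "\<dots> \<le> 108 / 10 * (2 ^ t * v)" using t by linarith
    also have "(2::real) ^ t = 2 ^ (t - i) * 2 ^ i" using it by (simp add: power_add[symmetric])
    finally have "2 ^ (t - i) * N i \<le> 2 ^ (t - i) * (108 / 10 * (2 ^ i * v))" by (simp add: mult_ac)
    then show ?thesis by simp
  qed
  show "\<exists>j. j + I \<le> m0 * I \<and> N (j + I) \<le> 101 / 100 * 2 ^ I * N j"
  proof (rule ccontr)
    assume neg: "\<not> ?thesis"
    \<comment> \<open>If every run of I scales gained a factor 1.01, the ratio of N to the radius
      would rise from 1.9 by 1.01^m0 >= 12, beyond 10.8.\<close>
    have grow: "(101 / 100) ^ k * (2 ^ (k * I) * N 0) \<le> N (k * I)" if "k \<le> m0" for k
      using that
    proof (induction k)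
      case (Suc k)
      have "k * I + I \<le> m0 * I" using Suc.prems by (metis add.commute mult_Suc mult_le_mono1)
      then have "101 / 100 * 2 ^ I * N (k * I) \<le> N (k * I + I)" using neg by (meson less_imp_le not_le)
      moreover have "101 / 100 * 2 ^ I * ((101 / 100) ^ k * (2 ^ (k * I) * N 0)) \<le> 101 / 100 * 2 ^ I * N (k * I)"
        using Suc by (intro mult_left_mono) auto
      moreover have "101 / 100 * 2 ^ I * ((101 / 100) ^ k * (2 ^ (k * I) * N 0)) = (101 / 100) ^ Suc k * (2 ^ (Suc k * I) * N 0)"
        by (simp add: power_add mult_ac)
      ultimately have "(101 / 100) ^ Suc k * (2 ^ (Suc k * I) * N 0) \<le> N (k * I + I)" by linarith
      moreover have "k * I + I = Suc k * I" by simp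
      ultimately show ?case by (simp only:)
    qed simp
    have "12 * (2 ^ (m0 * I) * (19 / 10 * v)) \<le> (101 / 100) ^ m0 * (2 ^ (m0 * I) * N 0)"
      using m0 N0 v by (intro mult_mono) auto
    also have "\<dots> \<le> N (m0 * I)" by (rule grow) simp
    also have "\<dots> \<le> 108 / 10 * (2 ^ (m0 * I) * v)" by (rule upper) simp
    finally have "2 ^ (m0 * I) * v \<le> 0" by (simp add: mult.commute)
    moreover have "0 < 2 ^ (m0 * I) * v" using v by simp
    ultimately show False by linarith
  qed
qed

text \<open>The set \<open>X = near S w\<close> has \<open>|2\<^sup>I X| \<le> 1.01 \<cdot> 2\<^sup>I |X|\<close>; its Fourier bias places
  a dilate of it in a short interval, which it then nearly fills.\<close>

lemma ex_interval_dilation: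
  fixes I :: nat and w \<nu> :: real
  assumes S: "per S" and p2: "p \<noteq> 2" and w: "w > 0"
    and I: "I \<ge> 2" and \<nu>: "0 \<le> \<nu>" "\<nu>\<^sup>2 = 1 - (1 - cos (pi / 9)) / 20" "202 / 100 * 2 ^ I * \<nu> ^ (2 * 2 ^ I - 2) < 1"
    and x: "x = real (msr (near S w))" "x \<ge> 100" "19 / 10 * w \<le> x"
    and dbl: "\<And>i. i < I \<Longrightarrow> 2 * (real (msr (near S (2 ^ i * w))) - 1) \<le> real (msr (near S (2 ^ Suc i * w))) - 1"
    and top: "real (msr (near S (2 ^ I * w))) - 1 \<le> 101 / 100 * 2 ^ I * (x - 1)"
    and small: "2 * real (msr (near S (2 ^ I * w))) \<le> p"
  shows "\<exists>\<mu> l. \<not> p dvd \<mu> \<and> 0 < l \<and> 2 * real_of_int l \<le> 21 / 20 * x + 1 \<and>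
    10 * int (defect {y. \<mu> * y \<in> S} l) \<le> 11 * l \<and>
    (\<forall>g. \<bar>g\<bar> \<le> l \<longrightarrow> 10 * int (defect {y. \<mu> * y \<in> S} g) \<le> 22 * l)"
proof -
  define W where "W i = near S (2 ^ i * w)" for i :: nat
  have perW: "per (W i)" for i using S by (simp add: W_def)
  have W0: "W 0 = near S w" by (simp add: W_def)
  have mW0: "real (msr (W 0)) = x" using x W0 by simp
  have Wsum: "sumset (W i) (W i) \<subseteq> W (Suc i)" for i
  proof -
    have "2 ^ i * w + 2 ^ i * w = 2 ^ Suc i * w" by simp
    then show ?thesis using sumset_near[OF S, of "2 ^ i * w" "2 ^ i * w"] unfolding W_def by metis
  qed
  \<comment> \<open>Doubling bounds the growth from scale i to I below. Since the growth over the
    whole run is at most 1.01 times 2^I, each intermediate ball is close to its minimal size as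
    well.\<close>
  have step: "2 ^ (I - i) * (real (msr (W i)) - 1) \<le> real (msr (W I)) - 1" if "i \<le> I" for i
  proof -
    have "2 ^ d * (real (msr (W i)) - 1) \<le> real (msr (W (i + d))) - 1" if "i + d \<le> I" for d
      using that
    proof (induction d)
      case (Suc d)
      then have "2 * (2 ^ d * (real (msr (W i)) - 1)) \<le> 2 * (real (msr (W (i + d))) - 1)" by simp
      also have "\<dots> \<le> real (msr (W (i + Suc d))) - 1" using dbl[of "i + d"] Suc.prems by (simp add: W_def)
      finally show ?case by simp
    qed simp
    from this[of "I - i"] show ?thesis using that by simp
  qed
  have W_le: "real (msr (W i)) - 1 \<le> 101 / 100 * 2 ^ i * (x - 1)" if "i \<le> I" for i
  proof -
    have "2 ^ (I - i) * (real (msr (W i)) - 1) \<le> 101 / 100 * 2 ^ I * (x - 1)"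
      using step[OF that] top by (simp add: W_def)
    also have "(2::real) ^ I = 2 ^ (I - i) * 2 ^ i" using that by (simp add: power_add[symmetric])
    finally have "2 ^ (I - i) * (real (msr (W i)) - 1) \<le> 2 ^ (I - i) * (101 / 100 * 2 ^ i * (x - 1))"
      by (simp add: mult_ac)
    then show ?thesis by simp
  qed
  have half: "2 * real (msr (W i)) \<le> p" if "i \<le> I" for i
  proof -
    have "(2::real) ^ i \<le> 2 ^ I" using that by (intro power_increasing) auto
    then have "W i \<subseteq> W I" unfolding W_def using w by (intro near_mono mult_right_mono) auto
    then have "real (msr (W i)) \<le> real (msr (W I))" by (intro of_nat_mono msr_mono)
    then show ?thesis using small by (simp add: W_def)
  qed
  have large: "2 * real (msr (W I)) * \<nu> ^ (2 * 2 ^ I - 2) < real (msr (W 0))"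
  proof -
    have "real (msr (W I)) \<le> 101 / 100 * 2 ^ I * x"
    proof -
      have "(1::real) \<le> 2 ^ I" by simp
      moreover have "101 / 100 * 2 ^ I * (x - 1) = 101 / 100 * 2 ^ I * x - 101 / 100 * 2 ^ I"
        by (simp add: right_diff_distrib)
      ultimately show ?thesis using W_le[of I] by linarith
    qed
    then have "2 * real (msr (W I)) * \<nu> ^ (2 * 2 ^ I - 2) \<le> 2 * (101 / 100 * 2 ^ I * x) * \<nu> ^ (2 * 2 ^ I - 2)"
      using \<nu> by (intro mult_right_mono mult_left_mono) auto
    also have "\<dots> = (202 / 100 * 2 ^ I * \<nu> ^ (2 * 2 ^ I - 2)) * x" by simp
    also have "\<dots> < 1 * x" using \<nu> x by (intro mult_strict_right_mono) auto
    finally show ?thesis using mW0 by simp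
  qed
  have sym: "- y \<in> W 0" if "y \<in> W 0" for y using that minus_in_near[OF S] by (simp add: W0)
  have pos: "msr (W 0) > 0" using mW0 x by linarith
  obtain \<mu>0 where \<mu>0: "\<not> p dvd \<mu>0"
    "(\<Sum>y\<in>{0..<p}. of_bool (\<mu>0 * y \<in> W 0) * (1 - cos (2 * pi * y / p))) \<le> 2 * (1 - \<nu>\<^sup>2) * msr (W 0)"
    using ex_concentrating_dilation[of "W 0" W I \<nu>, OF perW pos sym refl Wsum half[OF order_refl] p2 \<nu>(1) large]
    by auto
  define Y where "Y = {y. \<mu>0 * y \<in> W 0}"
  have Y: "per Y" "real (msr Y) = x" using perW \<mu>0 mW0 unfolding Y_def by (auto simp: msr_dilate)
  have YY: "sumset Y Y \<subseteq> {y. \<mu>0 * y \<in> W 1}"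
    using sumset_dilate[of \<mu>0 "W 0" "W 0"] Wsum[of 0] unfolding Y_def by auto
  have "msr (sumset Y Y) \<le> msr (W 1)" using msr_mono[OF YY] \<mu>0 perW by (simp add: msr_dilate)
  then have d1: "real (msr (sumset Y Y)) \<le> 5 / 2 * msr Y" "2 * real (msr (sumset Y Y)) \<le> p"
    using W_le[of 1] half[of 1] I x Y by auto
  \<comment> \<open>Threefold sums do not belong to a dyadic scale. Fourfold sums lie in
    \<open>W 2\<close>, of size about 4.04 x, and by Cauchy-Davenport the fourth summand adds x - 1
    elements, which leaves at most 3.05 x.\<close>
  define T3 where "T3 = sumset (sumset Y Y) Y"
  have T4: "sumset T3 Y \<subseteq> {y. \<mu>0 * y \<in> W 2}"
  proof
    fix z assume "z \<in> sumset T3 Y"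
    then obtain a b where ab: "a \<in> T3" "b \<in> Y" "z = a + b" by (rule sumsetE)
    obtain a1 a2 where a: "a1 \<in> sumset Y Y" "a2 \<in> Y" "a = a1 + a2"
      using ab(1) unfolding T3_def by (rule sumsetE)
    have "a2 + b \<in> sumset Y Y" using a ab by (intro sumsetI)
    then have "\<mu>0 * a1 \<in> W 1" "\<mu>0 * (a2 + b) \<in> W 1" using a YY by auto
    then have "\<mu>0 * a1 + \<mu>0 * (a2 + b) \<in> sumset (W 1) (W 1)" by (intro sumsetI)
    then show "z \<in> {y. \<mu>0 * y \<in> W 2}" using Wsum[of 1] a ab by (auto simp: algebra_simps numeral_2_eq_2)
  qed
  have mT4: "msr (sumset T3 Y) \<le> msr (W 2)" using msr_mono[OF T4] \<mu>0 perW by (simp add: msr_dilate)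
  have Y0: "0 \<in> Y" using w zero_in_near[of w S] by (simp add: Y_def W0)
  have ne: "T3 \<noteq> {}" using sumsetI[OF sumsetI[OF Y0 Y0] Y0] by (auto simp: T3_def)
  have "min (nat p) (msr T3 + msr Y - 1) \<le> msr (sumset T3 Y)"
    using Y Y0 ne by (intro cauchy_davenport) (auto simp: T3_def)
  moreover have "real (msr (sumset T3 Y)) \<le> p / 2" using mT4 half[of 2] I by simp
  then have "msr (sumset T3 Y) < nat p" using p_gt_1 by linarith
  ultimately have "msr T3 + msr Y \<le> msr (W 2) + 1" using mT4 by linarith
  then have d2: "real (msr T3) \<le> 61 / 20 * msr Y" using W_le[of 2] I x Y by simp
  have big: "msr Y \<ge> 100" using x Y by linarith
  have d1': "msr (sumset Y Y) < nat p" using d1(2) p_gt_1 by linarith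
  have conc: "(\<Sum>y\<in>{0..<p}. of_bool (y \<in> Y) * (1 - cos (2 * pi * y / p))) \<le> (1 - cos (pi / 9)) / 10 * msr Y"
  proof -
    \<comment> \<open>The value of \<open>\<nu>\<close> is chosen to meet the tolerance of
      \<open>rectify_concentrated\<close>.\<close>
    have e: "2 * (1 - \<nu>\<^sup>2) = (1 - cos (pi / 9)) / 10" using \<nu>(2) by simp
    show ?thesis using \<mu>0(2) unfolding e mW0 Y(2) by (simp only: Y_def mem_Collect_eq)
  qed
  have symY: "- y \<in> Y" if "y \<in> Y" for y using that sym[of "\<mu>0 * y"] by (simp add: Y_def)
  obtain d l where dl: "\<not> p dvd d" "0 < l" "d * l \<in> Y"
    "\<And>y. d * y \<in> Y \<Longrightarrow> \<exists>z. \<bar>z\<bar> \<le> l \<and> [y = z] (mod p)" "2 * real_of_int l \<le> 21 / 20 * msr Y + 1"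
    using rectify_concentrated[OF Y(1) Y0 symY big conc d1(1) d1' d2[unfolded T3_def]] by blast
  define \<mu> where "\<mu> = \<mu>0 * d"
  have nd: "\<not> p dvd \<mu>" unfolding \<mu>_def using prime_p \<mu>0 dl prime_dvd_mult_iff by blast
  define S' where "S' = {y. \<mu> * y \<in> S}"
  have perS': "per S'" using S by (auto simp: S'_def)
  have S'w: "real (defect S' y) \<le> w" if "d * y \<in> Y" for y
    using that unfolding S'_def defect_dilate[OF S nd] by (simp add: Y_def \<mu>_def W0 near_def mult_ac)
  \<comment> \<open>All x elements of Y are represented in H, while 2l + 1 <= 21/20 x + 2. So
    [-l, l] has at most x/20 + 2 holes.\<close>
  define H where "H = {h\<in>{-l..l}. d * h \<in> Y}"
  have finH: "finite H" by (rule finite_subset[of _ "{-l..l}"]) (auto simp: H_def)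
  have "msr Y \<le> card H"
  proof -
    have "msr {y. d * y \<in> Y} = msr Y" using Y dl by (intro msr_dilate)
    moreover have "{y. d * y \<in> Y} \<inter> {0..<p} \<subseteq> (\<lambda>z. z mod p) ` H"
    proof
      fix y assume y: "y \<in> {y. d * y \<in> Y} \<inter> {0..<p}"
      then obtain z where z: "\<bar>z\<bar> \<le> l" "[y = z] (mod p)" using dl(4) by auto
      then have "d * z \<in> Y" using y per_cong[OF Y(1), of "d * y" "d * z"] by (simp add: cong_scalar_left)
      then have "z \<in> H" using z by (auto simp: H_def)
      moreover have "y = z mod p" using y z by (simp add: cong_def)
      ultimately show "y \<in> (\<lambda>z. z mod p) ` H" by auto
    qed
    then have "msr {y. d * y \<in> Y} \<le> card H"
      unfolding msr_def using finH by (meson card_image_le card_mono finite_imageI order_trans)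
    ultimately show ?thesis by simp
  qed
  then have xH: "x \<le> card H" using Y by simp
  have "card H \<le> card {-l..l}" by (intro card_mono) (auto simp: H_def)
  then have xl: "x \<le> 2 * l + 1" using xH dl(2) by simp
  have w_le: "10 * w \<le> 11 * l" using x xl by linarith
  \<comment> \<open>The endpoint l itself belongs to H, hence the bound w. The weaker 2.2 l of the
    other g could not exclude the two drops in \<open>ex_empty_arc\<close>.\<close>
  have "real (defect S' l) \<le> w" using S'w dl(3) by blast
  then have r1: "10 * int (defect S' l) \<le> 11 * l" using w_le by linarith
  \<comment> \<open>g is a sum of two elements of H by pigeonhole: there are more than l candidates
    u, and at most x/10 + 4 of them fail.\<close>
  have r2_pos: "10 * int (defect S' g) \<le> 22 * l" if g: "0 \<le> g" "g \<le> l" for g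
  proof -
    define R where "R = {g - l..l}"
    have cR: "card R = nat (2 * l + 1 - g)" by (simp add: R_def)
    have miss: "real (card ({-l..l} - H)) \<le> x / 20 + 2"
    proof -
      have "card ({-l..l} - H) = card {-l..l} - card H"
        using finH by (intro card_Diff_subset) (auto simp: H_def)
      moreover have "real (card {-l..l}) = 2 * l + 1" using dl(2) by simp
      ultimately show ?thesis using xH dl(5) Y \<open>card H \<le> card {-l..l}\<close> by (simp add: of_nat_diff)
    qed
    have "R - {u\<in>R. u \<in> H \<and> g - u \<in> H} \<subseteq> ({-l..l} - H) \<union> (\<lambda>u. g - u) ` ({-l..l} - H)"
    proof
      fix u assume u: "u \<in> R - {u\<in>R. u \<in> H \<and> g - u \<in> H}"
      then have "u \<in> {-l..l}" "g - u \<in> {-l..l}" using g by (auto simp: R_def)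
      moreover have "u \<notin> H \<or> g - u \<notin> H" using u by auto
      ultimately show "u \<in> ({-l..l} - H) \<union> (\<lambda>u. g - u) ` ({-l..l} - H)"
        by (auto intro: image_eqI[of _ _ "g - u"])
    qed
    then have "card (R - {u\<in>R. u \<in> H \<and> g - u \<in> H}) \<le> card (({-l..l} - H) \<union> (\<lambda>u. g - u) ` ({-l..l} - H))"
      by (intro card_mono) auto
    also have "\<dots> \<le> card ({-l..l} - H) + card ({-l..l} - H)"
      by (rule order_trans[OF card_Un_le]) (intro add_mono order_refl card_image_le, simp)
    finally have "real (card (R - {u\<in>R. u \<in> H \<and> g - u \<in> H})) \<le> real (card ({-l..l} - H) + card ({-l..l} - H))"
      by (rule of_nat_mono)
    also have "\<dots> \<le> 2 * (x / 20 + 2)" using miss by simp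
    also have "\<dots> < real (card R)"
    proof -
      have "real (card R) = real_of_int (2 * l + 1 - g)" unfolding cR using g by simp
      moreover have "real_of_int (2 * l + 1 - g) \<ge> real_of_int l + 1" using g by simp
      moreover have "x \<le> 2 * real_of_int l + 1" using xl by simp
      moreover have "2 * (y / 20 + 2) < r + 1" if "y \<le> 2 * r + 1" "100 \<le> y" for y r :: real
        using that by (simp add: field_simps)
      ultimately show ?thesis using x(2) by (metis less_le_trans)
    qed
    finally have "R \<noteq> R - {u\<in>R. u \<in> H \<and> g - u \<in> H}" by auto
    then obtain u where "u \<in> H" "g - u \<in> H" by auto
    then have "real (defect S' u) \<le> w" "real (defect S' (g - u)) \<le> w" using S'w by (auto simp: H_def)
    moreover have "defect S' (u + (g - u)) \<le> defect S' u + defect S' (g - u)" by (rule defect_triangle[OF perS'])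
    ultimately show ?thesis using w_le by simp
  qed
  have r2: "10 * int (defect S' g) \<le> 22 * l" if "\<bar>g\<bar> \<le> l" for g
  proof (cases "0 \<le> g")
    case False
    then show ?thesis using r2_pos[of "- g"] that defect_minus[OF perS', of g] by simp
  qed (use r2_pos[of g] that in simp)
  show ?thesis using nd dl r1 r2 Y unfolding S'_def by (intro exI[of _ \<mu>] exI[of _ l]) simp
qed

end

section \<open>Choice of the constants\<close>

text \<open>The factor 2^I is at most the exponent m = 2 (2^I) - 2, and m \<nu>^m tends to
  0.\<close>

lemma ex_fourier_parameters:
  "\<exists>(\<nu>::real) (I::nat). 0 \<le> \<nu> \<and> \<nu>\<^sup>2 = 1 - (1 - cos (pi / 9)) / 20 \<and> I \<ge> 2 \<and> 202 / 100 * 2 ^ I * \<nu> ^ (2 * 2 ^ I - 2) < 1"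
proof -
  define \<gamma> where "\<gamma> = 1 - cos (pi / 9)"
  have "cos (pi / 9) < cos 0" by (rule cos_monotone_0_pi) auto
  then have \<gamma>: "0 < \<gamma>" "\<gamma> \<le> 2" using cos_ge_minus_one[of "pi / 9"] by (simp_all add: \<gamma>_def)
  define \<nu> where "\<nu> = sqrt (1 - \<gamma> / 20)"
  have \<nu>: "0 \<le> \<nu>" "\<nu> < 1" "\<nu>\<^sup>2 = 1 - \<gamma> / 20" using \<gamma> by (simp_all add: \<nu>_def real_sqrt_lt_1_iff)
  have "(\<lambda>n. real n * \<nu> ^ n) \<longlonglongrightarrow> 0" using powser_times_n_limit_0[of \<nu>] \<nu> by simp
  then have "eventually (\<lambda>n. real n * \<nu> ^ n < 1 / 3) sequentially"
    by (rule order_tendstoD(2)) simp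
  then obtain N where N: "\<And>n. n \<ge> N \<Longrightarrow> real n * \<nu> ^ n < 1 / 3"
    by (auto simp: eventually_sequentially)
  define I where "I = N + 2"
  define n where "n = (2::nat) * 2 ^ I - 2"
  have "I < 2 ^ I" by (rule less_exp)
  have "(2::nat) ^ 1 \<le> 2 ^ I" by (intro power_increasing) (auto simp: I_def)
  then have n: "2 ^ I \<le> n" by (simp add: n_def)
  then have "N \<le> n" using \<open>I < 2 ^ I\<close> by (simp add: I_def)
  have "real (2 ^ I) * \<nu> ^ n \<le> real n * \<nu> ^ n"
    using n \<nu> by (intro mult_right_mono of_nat_mono) auto
  then have "202 / 100 * 2 ^ I * \<nu> ^ n \<le> 202 / 100 * (real n * \<nu> ^ n)" by (simp add: mult.commute)
  also have "\<dots> < 1" using N[OF \<open>N \<le> n\<close>] by simp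
  finally show ?thesis using \<nu> by (intro exI[of _ \<nu>] exI[of _ I]) (auto simp: n_def \<gamma>_def I_def)
qed

section \<open>Assembly of the argument\<close>

context prime_modulus
begin

text \<open>The hypotheses record an order of choice. First \<open>\<nu>\<close>, \<open>I\<close>,
  \<open>m0\<close>. Then \<open>\<eta>\<close>, so small that m0 I doublings of the radius 51/50
  \<eta> n stay below n / 10^7. Then \<open>c\<close> and \<open>K\<close>, which bring |B'| down to
  \<eta> n. Then \<open>\<epsilon>\<close>, so small that after K doublings the bad pairs are
  harmless for the transforms and for \<open>near_lower_bound\<close> with \<delta> = 1/100. Finally
  k0 \<epsilon> >= 2 stops the greedy cover, since a union of size 2n contradicts
  \<open>no_cover\<close>.\<close>

lemma no_few_translates_contradiction:
  fixes \<nu> \<eta> c \<epsilon> :: real and I m0 K k0 n :: nat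
  assumes \<nu>: "0 \<le> \<nu>" "\<nu>\<^sup>2 = 1 - (1 - cos (pi / 9)) / 20" "I \<ge> 2" "202 / 100 * 2 ^ I * \<nu> ^ (2 * 2 ^ I - 2) < 1"
    and m0: "12 \<le> (101 / 100 :: real) ^ m0"
    and \<eta>: "0 < \<eta>" "\<eta> \<le> 1 / 2" "2 ^ (m0 * I) * (51 / 50 * \<eta>) \<le> 1 / 10000000"
    and c: "c = \<eta> ^ 4 / 4096" "(1 - c) ^ K \<le> \<eta>"
    and \<epsilon>: "0 < \<epsilon>" "2 ^ K * \<epsilon> \<le> \<eta> ^ 3 / 16" "2 ^ K * \<epsilon> \<le> (c * \<eta>)\<^sup>2 / 10000" "\<epsilon> \<le> 1 / 1000000000"
    and k0: "k0 \<ge> 23" "real k0 * \<epsilon> \<ge> 2"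
    and n: "32 \<le> \<eta>\<^sup>2 * n" "c * \<eta> * n \<ge> 100" "n \<ge> 10000000"
    and AB: "per A" "per B" "msr A = n" "msr B = n" "3 * int n \<le> p"
    and no_cover: "\<And>D. D \<subseteq> B \<Longrightarrow> finite D \<Longrightarrow> card D \<le> k0 \<Longrightarrow> msr (sumset A D) \<le> 2 * n - 2"
  shows False
proof -
  obtain D0 where D0: "D0 \<subseteq> B" "finite D0" "card D0 \<le> k0"
    "(\<forall>b\<in>B. real (msr ({x. x - b \<in> A} - sumset A D0)) \<le> \<epsilon> * n) \<or> real k0 * (\<epsilon> * n) \<le> msr (sumset A D0)"
    using greedy_cover[OF AB(1), of "\<epsilon> * n" B k0] \<epsilon> by auto
  define S where "S = sumset A D0"
  have perS: "per S" unfolding S_def using AB by auto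
  have mS: "msr S \<le> 2 * n - 2" unfolding S_def using D0 by (intro no_cover) auto
  then have mS2: "msr S \<le> 2 * n" by simp
  have "2 * real n \<le> real k0 * (\<epsilon> * n)" using mult_right_mono[OF k0(2), of n] by (simp add: mult.assoc)
  moreover have "real (msr S) < 2 * real n" using mS n by linarith
  ultimately have "\<not> real k0 * (\<epsilon> * n) \<le> real (msr S)" by linarith
  then have close: "\<And>b. b \<in> B \<Longrightarrow> real (msr ({x. x - b \<in> A} - S)) \<le> \<epsilon> * n"
    using D0(4) unfolding S_def[symmetric] by blast
  have missb: "real (msr {x. x \<in> A \<and> x + b \<notin> S}) \<le> \<epsilon> * n" if "b \<in> B" for b
  proof -
    have "msr {x. x - b \<in> {x. x \<in> A \<and> x + b \<notin> S}} = msr {x. x \<in> A \<and> x + b \<notin> S}"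
      by (rule msr_shift(2)) (use AB perS in auto)
    moreover have "{x. x - b \<in> {x. x \<in> A \<and> x + b \<notin> S}} = {x. x - b \<in> A} - S" by auto
    ultimately show ?thesis using close[OF that] by simp
  qed
  have miss: "real (misses S A B) \<le> \<epsilon> * n * n" using misses_le[of B A S "\<epsilon> * n", OF missb] AB(4) by simp
  have "2 ^ K * real (misses S A B) \<le> 2 ^ K * (\<epsilon> * n * n)" using miss by (intro mult_left_mono) auto
  then have missK: "2 ^ K * real (misses S A B) \<le> (2 ^ K * \<epsilon>) * (real n)\<^sup>2" by (simp add: power2_eq_square mult_ac)
  have "(2 ^ K * \<epsilon>) * (real n)\<^sup>2 \<le> (\<eta> ^ 3 / 16) * (real n)\<^sup>2" using \<epsilon> by (intro mult_right_mono) auto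
  moreover have "\<eta> ^ 3 * real (n\<^sup>2) / 16 = (\<eta> ^ 3 / 16) * (real n)\<^sup>2" by simp
  ultimately have missK1: "2 ^ K * real (misses S A B) \<le> \<eta> ^ 3 * n\<^sup>2 / 16" using missK by linarith
  have "3 * n \<le> nat p" using AB by linarith
  from dyson_shrink[OF AB(1,2) perS AB(3,4) mS2 this \<eta>(1,2) n(1) missK1 c(1) order_refl]
  obtain A' B' where A'B': "per A'" "per B'" "msr A' + msr B' = 2 * n" "misses S A' B' \<le> 2 ^ K * misses S A B"
    "c * \<eta> * n \<le> msr B' \<and> msr B' \<le> \<eta> * n \<or> \<eta> * n < msr B' \<and> msr B' \<le> (1 - c) ^ K * n" by blast
  define b where "b = real (msr B')"
  have "(1 - c) ^ K * n \<le> \<eta> * n" using c(2) by (intro mult_right_mono) auto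
  then have b: "c * \<eta> * n \<le> b" "b \<le> \<eta> * n" using A'B'(5) unfolding b_def by linarith+
  have "(1::real) \<le> 2 ^ (m0 * I)" by simp
  then have "1 * (51 / 50 * \<eta>) \<le> 2 ^ (m0 * I) * (51 / 50 * \<eta>)" using \<eta> by (intro mult_right_mono) auto
  then have \<eta>7: "\<eta> \<le> 1 / 10000000" using \<eta>(1,3) by linarith
  have "\<eta> * n \<le> 1 / 10000000 * n" using \<eta>7 by (intro mult_right_mono) auto
  then have bn: "b \<le> 1 / 10000000 * n" using b by linarith
  have b100: "b \<ge> 100" using b n by linarith
  have "real (misses S A' B') \<le> real (2 ^ K * misses S A B)" using A'B'(4) by (rule of_nat_mono)
  also have "\<dots> \<le> (2 ^ K * \<epsilon>) * (real n)\<^sup>2" using missK by (simp only: of_nat_mult of_nat_power of_nat_numeral)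
  also have "\<dots> \<le> (c * \<eta>)\<^sup>2 / 10000 * (real n)\<^sup>2" using \<epsilon> by (intro mult_right_mono) auto
  also have "\<dots> = (1 / 100)\<^sup>2 * (c * \<eta> * n)\<^sup>2" by (simp add: power2_eq_square)
  also have "\<dots> \<le> (1 / 100)\<^sup>2 * b\<^sup>2" using b n by (intro mult_left_mono power_mono) auto
  finally have miss': "real (misses S A' B') \<le> (1 / 100)\<^sup>2 * b\<^sup>2" .
  define v where "v = (1 + 2 * (1 / 100)) * b"
  have v: "v = 51 / 50 * b" by (simp add: v_def)
  have "b > 0" using b100 by simp
  have lower: "real (msr (near S v)) \<ge> min (real_of_int p) (2 * (1 - 1 / 100) * b - 1)"
    and mSl: "real (msr S) \<ge> 2 * n - (1 + 1 / 100) * b"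
    using near_lower_bound[OF A'B'(1,2) perS A'B'(3) mS2 b_def \<open>b > 0\<close> _ _ miss'] unfolding v_def by auto
  have "real_of_int (3 * int n) \<le> real_of_int p" using AB(5) by (rule of_int_le_iff[THEN iffD2])
  then have pn: "3 * real n \<le> real_of_int p" by simp
  have mS19: "19 / 10 * real n \<le> real (msr S)" using mSl bn by simp
  have lowv: "19 / 10 * v + 1 \<le> msr (near S v)"
  proof -
    have "19 / 10 * v + 1 \<le> 2 * (1 - 1 / 100) * b - 1" unfolding v using b100 by simp
    moreover have "2 * (1 - 1 / 100) * b - 1 \<le> real_of_int p" using bn pn b100 by simp
    ultimately show ?thesis using lower by linarith
  qed
  have v0: "v > 0" using v \<open>b > 0\<close> by simp
  have vJ: "2 ^ (m0 * I) * v \<le> 1 / 10000000 * n"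
  proof -
    have "2 ^ (m0 * I) * v \<le> 2 ^ (m0 * I) * (51 / 50 * (\<eta> * n))" unfolding v using b by (intro mult_left_mono) auto
    also have "\<dots> = (2 ^ (m0 * I) * (51 / 50 * \<eta>)) * n" by simp
    also have "\<dots> \<le> 1 / 10000000 * n" using \<eta>(3) by (intro mult_right_mono) auto
    finally show ?thesis .
  qed
  then have vJ2: "2 ^ (m0 * I) * v \<le> real n / 2" using n by linarith
  note good = ex_good_scale[OF perS mS2 mS19 AB(5) v0 vJ2 lowv m0]
  obtain j where j: "j + I \<le> m0 * I"
    "real (msr (near S (2 ^ (j + I) * v))) - 1 \<le> 101 / 100 * 2 ^ I * (real (msr (near S (2 ^ j * v))) - 1)"
    using good(4) by blast
  define w where "w = 2 ^ j * v"
  have w: "w > 0" "v \<le> w" using v0 by (simp_all add: w_def mult_le_cancel_right1)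
  have wi: "2 ^ i * w = 2 ^ (j + i) * v" for i by (simp add: w_def power_add)
  have wle: "2 ^ I * w \<le> 1 / 10000000 * n"
  proof -
    have "(2::real) ^ (j + I) \<le> 2 ^ (m0 * I)" using j(1) by (intro power_increasing) auto
    then have "2 ^ (j + I) * v \<le> 2 ^ (m0 * I) * v" using v0 by (intro mult_right_mono) auto
    then show ?thesis using vJ by (simp add: wi)
  qed
  have "w \<le> 2 ^ I * w" using w by (simp add: mult_le_cancel_right1)
  then have w7: "w \<le> 1 / 10000000 * n" using wle by linarith
  define x where "x = real (msr (near S w))"
  have x: "19 / 10 * w \<le> x - 1" "x - 1 \<le> 108 / 10 * w"
    using good(2,3)[of j] j(1) unfolding x_def w_def by auto
  have x100: "x \<ge> 100" using x w b100 v by linarith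
  have top: "real (msr (near S (2 ^ I * w))) - 1 \<le> 101 / 100 * 2 ^ I * (x - 1)"
    using j(2) unfolding wi x_def unfolding w_def .
  have dbl: "2 * (real (msr (near S (2 ^ i * w))) - 1) \<le> real (msr (near S (2 ^ Suc i * w))) - 1" if "i < I" for i
    using good(1)[of "j + i"] that j(1) unfolding wi by simp
  have small: "2 * real (msr (near S (2 ^ I * w))) \<le> p"
    using good(3)[of "j + I"] j(1) wle pn n(3) unfolding wi by simp
  have "p \<noteq> 2" using AB(5) n(3) by linarith
  have xw: "19 / 10 * w \<le> x" using x by linarith
  obtain \<mu> l where \<mu>: "\<not> p dvd \<mu>" and l: "0 < l" "2 * real_of_int l \<le> 21 / 20 * x + 1"
    "10 * int (defect {y. \<mu> * y \<in> S} l) \<le> 11 * l"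
    "\<And>g. \<bar>g\<bar> \<le> l \<Longrightarrow> 10 * int (defect {y. \<mu> * y \<in> S} g) \<le> 22 * l"
    using ex_interval_dilation[OF perS \<open>p \<noteq> 2\<close> w(1) \<nu>(3,1,2,4) x_def x100 xw dbl top small] by blast
  have n7: "real n \<ge> 10000000" using of_nat_mono[OF n(3), where ?'a = real] by simp
  have l6: "1000000 * real_of_int l \<le> n"
  proof -
    have "real n \<ge> 10000000" using of_nat_mono[OF n(3), where ?'a = real] by simp
    then show ?thesis using l(2) x(2) w7 by simp
  qed
  have li: "1000000 * l \<le> int n" using l6 by linarith
  define S' A2 B2 where "S' = {y. \<mu> * y \<in> S}" and "A2 = {y. \<mu> * y \<in> A}" and "B2 = {y. \<mu> * y \<in> B}"
  have per2: "per S'" "per A2" "per B2" unfolding S'_def A2_def B2_def using perS AB by auto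
  have m2: "msr S' = msr S" "msr A2 = n" "msr B2 = n"
    unfolding S'_def A2_def B2_def using perS AB \<mu> by (simp_all add: msr_dilate)
  have mSi: "19 * int n \<le> 10 * int (msr S)" using mS19 by linarith
  have dl: "10 * int (defect S' l) \<le> 11 * l" "\<And>g. \<bar>g\<bar> \<le> l \<Longrightarrow> 10 * int (defect S' g) \<le> 22 * l"
    unfolding S'_def using l(3,4) by auto
  have sz: "int (msr S') > 50 * l" "int (msr S') + 50 * l < p"
    unfolding m2(1) using mSi mS2 li AB(5) n(3) l(1) by linarith+
  obtain c0 z where z: "0 < z" "z \<le> p" "z \<ge> p - int (msr S) - 50 * l" "int (card (S' \<inter> {c0..<c0 + z})) \<le> 49 * l"
    using ex_empty_arc[OF per2(1) l(1) dl sz] unfolding m2(1) by blast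
  have SC: "int (msr (S' \<inter> arc c0 z)) \<le> 49 * l" using msr_Int_arc[OF per2(1) z(2)] z(4) by simp
  \<comment> \<open>The arc has length at least p - 2n - 50 l, more than p/4 because p >= 3n; so h =
    4 in \<open>arc_concentration\<close>.\<close>
  have z4: "p \<le> int 4 * z" using z(3) mS2 li AB(5) by linarith
  have missA: "real (msr {x. x \<in> A2 \<and> x + y \<notin> S'}) \<le> \<epsilon> * n" if "y \<in> B2" for y
  proof -
    have "msr {x. \<mu> * x + 0 \<in> {x. x \<in> A \<and> x + \<mu> * y \<notin> S}} = msr {x. x \<in> A \<and> x + \<mu> * y \<notin> S}"
      by (rule msr_affine) (use AB perS \<mu> coprime_of_not_dvd in auto)
    moreover have "\<mu> * y \<in> B" using that by (simp add: B2_def)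
    ultimately show ?thesis using missb[of "\<mu> * y"] by (simp add: A2_def S'_def distrib_left)
  qed
  have arc_bound: "real (msr {x. x \<in> X \<and> x + y \<in> arc c0 z}) \<le> u + 49 * real_of_int l"
    if "real (msr {x. x \<in> X \<and> x + y \<notin> S'}) \<le> u" for X y u
  proof -
    have "msr {x. x \<in> X \<and> x + y \<in> arc c0 z} \<le> msr ({x. x \<in> X \<and> x + y \<notin> S'} \<union> {x. x + y \<in> S' \<inter> arc c0 z})"
      by (rule msr_mono) auto
    also have "\<dots> \<le> msr {x. x \<in> X \<and> x + y \<notin> S'} + msr {x. x + y \<in> S' \<inter> arc c0 z}" by (rule msr_Un_le)
    also have "msr {x. x + y \<in> S' \<inter> arc c0 z} = msr (S' \<inter> arc c0 z)" by (rule msr_shift(1)) (use per2 in auto)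
    finally show ?thesis using that SC by linarith
  qed
  have \<epsilon>n: "\<epsilon> * n \<le> 1 / 1000000000 * n" using \<epsilon>(4) by (intro mult_right_mono) auto
  have ne: "B2 \<noteq> {}" using m2 n by auto
  have arith1: "8 * (e + 49 * r) < N" "q \<le> 102 * r \<Longrightarrow> 8 * (e + 49 * r) + q < N"
    if "e \<le> 1 / 1000000000 * N" "1000000 * r \<le> N" "10000000 \<le> N" for e r q N :: real
    using that by (simp_all add: field_simps)
  have arith2: "8 * (N / 16000 + 49 * r) < N"
    "q \<le> 102 * r + N / 5000 \<Longrightarrow> 8 * (N / 16000 + 49 * r) + q < N"
    if "1000000 * r \<le> N" "10000000 \<le> N" for r q N :: real
    using that by (simp_all add: field_simps)
  have arith3: "1000 * u \<le> N"
    if "u \<le> real (2 * 4) * (e + 49 * r)" "e \<le> 1 / 1000000000 * N" "1000000 * r \<le> N" "10000000 \<le> N" for u e r N :: real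
    using that by (simp add: field_simps)
  have arith4: "1000 * u \<le> N"
    if "u \<le> real (2 * 4) * (N / 16000 + 49 * r)" "1000000 * r \<le> N" "10000000 \<le> N" for u r N :: real
    using that by (simp add: field_simps)
  obtain i1 len1 where I1: "0 \<le> len1" "len1 \<le> p - z - int n + 1" "real (msr (A2 - arc i1 len1)) \<le> real (2 * 4) * (\<epsilon> * n + 49 * real_of_int l)"
  proof -
    have "p - 2 * z - int (msr B2) + 2 \<le> 102 * l"
      using z(3) mS2 AB(5) m2(3) l(1) by linarith
    then have "real_of_int (p - 2 * z - int (msr B2) + 2) \<le> real_of_int (102 * l)" by (rule of_int_le_iff[THEN iffD2])
    moreover have "real (msr A2) = real n" using m2(2) by simp
    ultimately have "real (2 * 4) * (\<epsilon> * n + 49 * real_of_int l) < real (msr A2)"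
      "real (2 * 4) * (\<epsilon> * n + 49 * real_of_int l) + real_of_int (p - 2 * z - int (msr B2) + 2) < real (msr A2)"
      using arith1[OF \<epsilon>n _ n7, of "real_of_int l"] l6 by auto
    from arc_concentration[OF per2(2,3) ne z(1,2) z4 arc_bound[OF missA] this]
    show ?thesis using that unfolding m2(3) by blast
  qed
  \<comment> \<open>For the translates of B by elements of A closeness to S is known only on
    average. The threshold n/16000 is small enough for the final error n/1000 and large enough that
    Markov's inequality discards at most 16000 \<epsilon> n <= n/10000 elements.\<close>
  define G where "G = {a. a \<in> A2 \<and> real (msr {y. y \<in> B2 \<and> y + a \<notin> S'}) \<le> n / 16000}"
  have perG: "per G"
    using per2 unfolding G_def per_def by (simp add: add.assoc[symmetric])
  have "msr (A2 - G) * (real n / 16000) \<le> \<epsilon> * n * n"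
  proof -
    have "msr (A2 - G) * (real n / 16000) = (\<Sum>a\<in>{0..<p}. of_bool (a \<in> A2 - G) * (real n / 16000))"
      unfolding msr_sum by (simp add: sum_distrib_right)
    also have "\<dots> \<le> (\<Sum>a\<in>{0..<p}. of_bool (a \<in> A2) * real (msr {y. y \<in> B2 \<and> y + a \<notin> S'}))"
      by (intro sum_mono) (auto simp: G_def)
    also have "\<dots> = real (misses S' B2 A2)" unfolding misses_fiber by simp
    also have "misses S' B2 A2 = misses S' A2 B2"
      unfolding misses_def by (subst sum.swap) (intro sum.cong refl, auto simp: add.commute)
    also have "real \<dots> \<le> \<epsilon> * n * msr B2" by (rule misses_le) (rule missA)
    finally show ?thesis using m2 by simp
  qed
  then have AG: "real (msr (A2 - G)) \<le> 16000 * (\<epsilon> * n)" using n(3) by (simp add: field_simps)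
  have mG: "msr (A2 - G) + msr G = n" using msr_Diff_subset[of G A2] m2 by (auto simp: G_def)
  then have mG': "real n \<le> real (msr G) + 1 / 10000 * n" using AG \<epsilon>n by linarith
  have mGi: "int (msr G) \<ge> int n - int n div 5000" "msr G \<le> n" using mG' mG n(3) by linarith+
  have missG: "real (msr {y. y \<in> B2 \<and> y + a \<notin> S'}) \<le> real n / 16000" if "a \<in> G" for a
    using that by (simp add: G_def)
  have neG: "G \<noteq> {}" using mGi n(3) by force
  obtain i2 len2 where I2: "0 \<le> len2" "len2 \<le> p - z - int (msr G) + 1" "real (msr (B2 - arc i2 len2)) \<le> real (2 * 4) * (real n / 16000 + 49 * real_of_int l)"
  proof -
    have "p - 2 * z - int (msr G) + 2 \<le> 102 * l + int n div 5000"
      using z(3) mS2 AB(5) mGi l(1) by linarith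
    then have "real_of_int (p - 2 * z - int (msr G) + 2) \<le> real_of_int (102 * l + int n div 5000)" by (rule of_int_le_iff[THEN iffD2])
    moreover have "real_of_int (int n div 5000) \<le> real n / 5000" by linarith
    moreover have "real (msr B2) = real n" using m2(3) by simp
    ultimately have "real (2 * 4) * (real n / 16000 + 49 * real_of_int l) < real (msr B2)"
      "real (2 * 4) * (real n / 16000 + 49 * real_of_int l) + real_of_int (p - 2 * z - int (msr G) + 2) < real (msr B2)"
      using arith2(1)[OF l6 n7] arith2(2)[OF l6 n7, of "real_of_int (p - 2 * z - int (msr G) + 2)"] by auto
    from arc_concentration[OF per2(3) perG neG z(1,2) z4 arc_bound[OF missG] this]
    show ?thesis using that by blast
  qed
  have nc: "msr (sumset A2 D) \<le> 2 * n - 2" if D: "D \<subseteq> B2" "finite D" "card D \<le> 23" for D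
  proof -
    have "sumset A2 D \<subseteq> {y. \<mu> * y \<in> sumset A ((\<lambda>x. \<mu> * x) ` D)}"
      by (auto simp: sumset_def A2_def right_diff_distrib)
    then have "msr (sumset A2 D) \<le> msr {y. \<mu> * y \<in> sumset A ((\<lambda>x. \<mu> * x) ` D)}" by (rule msr_mono)
    also have "\<dots> = msr (sumset A ((\<lambda>x. \<mu> * x) ` D))" using AB \<mu> by (intro msr_dilate) auto
    also have "\<dots> \<le> 2 * n - 2"
      using D k0(1) card_image_le[OF D(2), of "\<lambda>x. \<mu> * x"] by (intro no_cover) (auto simp: B2_def)
    finally show ?thesis .
  qed
  show False
  proof (rule arcs_contradiction[OF per2(2,3) m2(2,3) AB(5) _ I1(1) I2(1) _ _ _ _ nc])
    show "1000 \<le> n" using n(3) by simp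
    \<comment> \<open>Since z >= p - |S| - 50 l and |S| <= 2n - 2, the length is at most about n +
      50 l.\<close>
    show "1000 * len1 \<le> 1001 * int n" using I1(2) z(3) mS2 li n(3) by linarith
    show "1000 * len2 \<le> 1001 * int n" using I2(2) z(3) mS2 li n(3) mGi by linarith
    have "1000 * real (msr (A2 - arc i1 len1)) \<le> real n" by (rule arith3[OF I1(3) \<epsilon>n l6 n7])
    then show "1000 * msr (A2 - arc i1 len1) \<le> n" by linarith
    have "1000 * real (msr (B2 - arc i2 len2)) \<le> real n" by (rule arith4[OF I2(3) l6 n7])
    then show "1000 * msr (B2 - arc i2 len2) \<le> n" by linarith
  qed
qed

end

text \<open>The constants must not depend on p, so they are chosen outside the locale; hence the
  qualified names.\<close>

lemma ex_cover_constants: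
  "\<exists>k n0 :: nat. 0 < k \<and> (\<forall>p A B. \<forall>n::nat. prime_modulus p \<longrightarrow> prime_modulus.per p A \<longrightarrow> prime_modulus.per p B \<longrightarrow>
    prime_modulus.msr p A = n \<longrightarrow> prime_modulus.msr p B = n \<longrightarrow> 3 * int n \<le> p \<longrightarrow> n0 \<le> n \<longrightarrow>
    (\<exists>D\<subseteq>B. finite D \<and> card D \<le> k \<and> 2 * n - 2 < prime_modulus.msr p (prime_modulus.sumset A D)))"
proof -
  obtain \<nu> :: real and I :: nat where \<nu>: "0 \<le> \<nu>" "\<nu>\<^sup>2 = 1 - (1 - cos (pi / 9)) / 20" "I \<ge> 2"
    "202 / 100 * 2 ^ I * \<nu> ^ (2 * 2 ^ I - 2) < 1"
    using ex_fourier_parameters by blast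
  obtain m0 where m0: "12 < (101 / 100 :: real) ^ m0"
    using real_arch_pow[of "101 / 100" 12] by auto
  \<comment> \<open>Makes the third property an equality.\<close>
  define \<eta> :: real where "\<eta> = 1 / (2 ^ (m0 * I) * 102 / 100 * 10000000)"
  have \<eta>: "0 < \<eta>" "\<eta> \<le> 1 / 2" "2 ^ (m0 * I) * (51 / 50 * \<eta>) \<le> 1 / 10000000"
  proof -
    have "(1::real) \<le> 2 ^ (m0 * I)" by simp
    then have "2 \<le> (2::real) ^ (m0 * I) * 102 / 100 * 10000000" by linarith
    then show "\<eta> \<le> 1 / 2" unfolding \<eta>_def by (rule divide_left_mono) simp_all
  qed (simp_all add: \<eta>_def field_simps)
  define c :: real where "c = \<eta> ^ 4 / 4096"
  have c: "0 < c" "c < 1"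
  proof -
    have "\<eta> ^ 4 \<le> 1 ^ 4" using \<eta> by (intro power_mono) auto
    then show "c < 1" by (simp add: c_def)
  qed (use \<eta> in \<open>simp add: c_def\<close>)
  obtain K where K: "(1 - c) ^ K < \<eta>" using real_arch_pow_inv[of \<eta> "1 - c"] \<eta> c by auto
  define \<epsilon> where "\<epsilon> = min (min (\<eta> ^ 3 / 16 / 2 ^ K) ((c * \<eta>)\<^sup>2 / 10000 / 2 ^ K)) (1 / 1000000000)"
  have \<epsilon>: "0 < \<epsilon>" "2 ^ K * \<epsilon> \<le> \<eta> ^ 3 / 16" "2 ^ K * \<epsilon> \<le> (c * \<eta>)\<^sup>2 / 10000" "\<epsilon> \<le> 1 / 1000000000"
  proof -
    show "0 < \<epsilon>" using \<eta> c by (simp add: \<epsilon>_def)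
    have "2 ^ K * \<epsilon> \<le> 2 ^ K * (\<eta> ^ 3 / 16 / 2 ^ K)" by (intro mult_left_mono) (auto simp: \<epsilon>_def)
    then show "2 ^ K * \<epsilon> \<le> \<eta> ^ 3 / 16" by simp
    have "2 ^ K * \<epsilon> \<le> 2 ^ K * ((c * \<eta>)\<^sup>2 / 10000 / 2 ^ K)" by (intro mult_left_mono) (auto simp: \<epsilon>_def)
    then show "2 ^ K * \<epsilon> \<le> (c * \<eta>)\<^sup>2 / 10000" by simp
  qed (simp add: \<epsilon>_def)
  obtain k1 :: nat where k1: "2 / \<epsilon> \<le> k1" using real_arch_simple by blast
  define k0 where "k0 = max 23 k1"
  have "2 / \<epsilon> \<le> real k0" using k1 by (simp add: k0_def)
  then have k0: "k0 \<ge> 23" "real k0 * \<epsilon> \<ge> 2" using \<epsilon>(1) by (simp_all add: k0_def field_simps)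
  obtain n1 n2 :: nat where n12: "32 / \<eta>\<^sup>2 \<le> n1" "100 / (c * \<eta>) \<le> n2" using real_arch_simple by blast
  define n0 where "n0 = max 10000000 (max n1 n2)"
  show ?thesis
  proof (rule exI[of _ k0], rule exI[of _ n0], intro conjI allI impI)
    show "0 < k0" using k0 by simp
    fix p A B n
    assume pm: "prime_modulus p" and A: "prime_modulus.per p A" "prime_modulus.msr p A = n"
      and B: "prime_modulus.per p B" "prime_modulus.msr p B = n" and n: "3 * int n \<le> p" "n0 \<le> n"
    interpret prime_modulus p by (rule pm)
    have "real n0 \<le> real n" using n(2) by simp
    moreover have "real n1 \<le> real n0" "real n2 \<le> real n0" by (simp_all add: n0_def)
    ultimately have "32 / \<eta>\<^sup>2 \<le> n" "100 / (c * \<eta>) \<le> n" using n12 by linarith+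
    then have n': "32 \<le> \<eta>\<^sup>2 * n" "c * \<eta> * n \<ge> 100" using \<eta>(1) c(1) by (simp_all add: field_simps)
    have n7: "n \<ge> 10000000" using n(2) by (simp add: n0_def)
    show "\<exists>D\<subseteq>B. finite D \<and> card D \<le> k0 \<and> 2 * n - 2 < msr (sumset A D)"
    proof (rule ccontr)
      assume "\<not> ?thesis"
      then have "\<And>D. D \<subseteq> B \<Longrightarrow> finite D \<Longrightarrow> card D \<le> k0 \<Longrightarrow> msr (sumset A D) \<le> 2 * n - 2"
        by (auto simp: not_less)
      from no_few_translates_contradiction[OF \<nu> less_imp_le[OF m0] \<eta> c_def less_imp_le[OF K] \<epsilon> k0 n' n7 A(1) B(1) A(2) B(2) n(1) this]
      show False .
    qed
  qed
qed

section \<open>Transfer to the group \<open>integer_mod_group\<close>\<close>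

lemma ex_enumeration:
  assumes "finite D" "D \<noteq> {}" "card D \<le> c"
  shows "\<exists>b :: nat \<Rightarrow> 'a. b ` {1..c} = D"
proof -
  obtain h where h: "bij_betw h {1..card D} D"
    using assms by (metis card_atLeastAtMost diff_Suc_1 finite_atLeastAtMost finite_same_card_bij)
  have "card D \<ge> 1" using assms by (simp add: Suc_leI card_gt_0_iff)
  \<comment> \<open>The enumeration is padded to exactly \<open>c\<close> terms by repeating one
    element.\<close>
  define b where "b i = (if i \<le> card D then h i else h 1)" for i
  have "b ` {1..c} = h ` {1..card D}"
    using assms \<open>card D \<ge> 1\<close> by (force simp: b_def)
  then show ?thesis using h by (auto simp: bij_betw_def)
qed

lemma (in prime_modulus) card_set_mult:
  assumes p: "p = int q" and A: "A \<subseteq> {0..<p}" and X: "X \<subseteq> {0..<p}"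
  shows "card (A <#>\<^bsub>integer_mod_group q\<^esub> X) = msr (sumset {x. x mod p \<in> A} X)"
proof -
  have "q > 0" using p p_gt_1 by linarith
  have eq: "A <#>\<^bsub>integer_mod_group q\<^esub> X = (\<lambda>(a, x). (a + x) mod p) ` (A \<times> X)"
    using p \<open>q > 0\<close> by (auto simp: set_mult_def mult_integer_mod_group)
  also have "\<dots> = sumset {x. x mod p \<in> A} X \<inter> {0..<p}"
  proof (intro equalityI subsetI)
    fix y assume "y \<in> (\<lambda>(a, x). (a + x) mod p) ` (A \<times> X)"
    then obtain a x where ax: "a \<in> A" "x \<in> X" "y = (a + x) mod p" by auto
    have "(y - x) mod p = a mod p" unfolding ax(3) by (simp add: mod_diff_left_eq)
    also have "a mod p = a" using ax A by auto
    finally show "y \<in> sumset {x. x mod p \<in> A} X \<inter> {0..<p}" using ax by (auto simp: sumset_def intro!: bexI[of _ x])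
  next
    fix y assume y: "y \<in> sumset {x. x mod p \<in> A} X \<inter> {0..<p}"
    then obtain x where x: "x \<in> X" "(y - x) mod p \<in> A" by (auto simp: sumset_def)
    have "((y - x) mod p + x) mod p = y" using y by (simp add: mod_add_left_eq)
    then show "y \<in> (\<lambda>(a, x). (a + x) mod p) ` (A \<times> X)" using x by (intro image_eqI[of _ _ "((y - x) mod p, x)"]) auto
  qed
  finally show ?thesis by (simp add: msr_def)
qed

lemma (in prime_modulus) lift_mod:
  assumes "A \<subseteq> {0..<p}"
  shows "per {x. x mod p \<in> A}" "msr {x. x mod p \<in> A} = card A"
proof -
  show "per {x. x mod p \<in> A}" by (simp add: per_def)
  have "{x. x mod p \<in> A} \<inter> {0..<p} = A" using assms by force
  then show "msr {x. x mod p \<in> A} = card A" by (simp add: msr_def)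
qed

text \<open>Lets translates found in the periodic lift of B be replaced by their representatives in
  B.\<close>

lemma (in prime_modulus) sumset_mod_right:
  assumes "per A"
  shows "sumset A ((\<lambda>x. x mod p) ` D) = sumset A D"
proof -
  have "x - d mod p \<in> A \<longleftrightarrow> x - d \<in> A" for x d
    by (rule per_cong[OF assms]) (simp add: cong_def mod_diff_right_eq)
  then show ?thesis by (auto simp: sumset_def)
qed

theorem theorem3:
  shows "\<exists>c::nat. c > 0 \<and>
    (\<forall>p::nat. \<forall>A B :: int set.
      Factorial_Ring.prime p \<longrightarrow>
      A \<subseteq> carrier (integer_mod_group p) \<longrightarrow> B \<subseteq> carrier (integer_mod_group p) \<longrightarrow>
      A \<noteq> {} \<longrightarrow> B \<noteq> {} \<longrightarrow>
      card A = card B \<longrightarrow> real (card B) \<le> real p / 3 \<longrightarrow>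
      (\<exists>b :: nat \<Rightarrow> int. (\<forall>i\<in>{1..c}. b i \<in> B) \<and>
        int (card (A <#>\<^bsub>integer_mod_group p\<^esub> (b ` {1..c}))) \<ge> int (card A) + int (card B) - 1))"
proof -
  obtain k n0 where kn: "0 < k" "\<And>p A B n. prime_modulus p \<Longrightarrow> prime_modulus.per p A \<Longrightarrow> prime_modulus.per p B \<Longrightarrow>
    prime_modulus.msr p A = n \<Longrightarrow> prime_modulus.msr p B = n \<Longrightarrow> 3 * int n \<le> p \<Longrightarrow> n0 \<le> n \<Longrightarrow>
    \<exists>D\<subseteq>B. finite D \<and> card D \<le> k \<and> 2 * n - 2 < prime_modulus.msr p (prime_modulus.sumset A D)"
    using ex_cover_constants by metis
  \<comment> \<open>For n < n0 the set B has fewer than \<open>c\<close> elements and is used as a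
    whole; Cauchy-Davenport then gives 2n - 1, as 2n - 1 < p.\<close>
  define c where "c = max k n0"
  show ?thesis
  proof (intro exI[of _ c] conjI allI impI)
    show "c > 0" using kn(1) by (simp add: c_def)
    fix q :: nat and A B :: "int set"
    assume q: "Factorial_Ring.prime q" and AB: "A \<subseteq> carrier (integer_mod_group q)" "B \<subseteq> carrier (integer_mod_group q)"
      "A \<noteq> {}" "B \<noteq> {}" "card A = card B" and size: "real (card B) \<le> real q / 3"
    define p where "p = int q"
    interpret prime_modulus p using q by unfold_locales (simp add: p_def)
    have "q > 0" using q prime_gt_0_nat by blast
    then have A: "A \<subseteq> {0..<p}" and B: "B \<subseteq> {0..<p}" using AB by (auto simp: carrier_integer_mod_group p_def)
    have finB: "finite B" using B finite_subset by blast
    define n where "n = card B"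
    have "n > 0" using finB AB by (simp add: n_def card_gt_0_iff)
    have n3: "3 * int n \<le> p" using size unfolding n_def p_def by linarith
    define A' B' where "A' = {x. x mod p \<in> A}" and "B' = {x. x mod p \<in> B}"
    have A': "per A'" "msr A' = n" and B': "per B'" "msr B' = n"
      unfolding A'_def B'_def using lift_mod[OF A] lift_mod[OF B] AB by (simp_all add: n_def)
    have "\<exists>D\<subseteq>B. D \<noteq> {} \<and> card D \<le> c \<and> 2 * n - 1 \<le> msr (sumset A' D)"
    proof (cases "n0 \<le> n")
      case True
      then obtain D where D: "D \<subseteq> B'" "finite D" "card D \<le> k" "2 * n - 2 < msr (sumset A' D)"
        using kn(2)[OF prime_modulus_axioms A'(1) B'(1) A'(2) B'(2) n3] by blast
      have "D \<noteq> {}" using D(4) by (auto simp: sumset_def)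
      moreover have "(\<lambda>x. x mod p) ` D \<subseteq> B" using D(1) by (auto simp: B'_def)
      moreover have "card ((\<lambda>x. x mod p) ` D) \<le> c"
        using card_image_le[OF D(2)] D(3) unfolding c_def by (metis le_max_iff_disj order_trans)
      moreover have "2 * n - 1 \<le> msr (sumset A' ((\<lambda>x. x mod p) ` D))"
        using D(4) sumset_mod_right[OF A'(1)] by simp
      ultimately show ?thesis by (metis image_is_empty)
    next
      case False
      have "sumset A' B = sumset A' B'"
      proof -
        have "(\<lambda>x. x mod p) ` B' = B"
        proof (intro equalityI subsetI)
          fix x assume x: "x \<in> B"
          then have "x mod p = x" using B by auto
          then show "x \<in> (\<lambda>x. x mod p) ` B'" using x by (intro image_eqI[of _ _ x]) (auto simp: B'_def)
        qed (auto simp: B'_def)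
        then show ?thesis using sumset_mod_right[OF A'(1), of B'] by simp
      qed
      moreover have "min (nat p) (msr A' + msr B' - 1) \<le> msr (sumset A' B')"
        using A' B' \<open>n > 0\<close> by (intro cauchy_davenport) auto
      ultimately have "2 * n - 1 \<le> msr (sumset A' B)" using A' B' n3 \<open>n > 0\<close> by (simp add: min_def split: if_splits)
      then show ?thesis using False AB by (intro exI[of _ B]) (auto simp: c_def n_def)
    qed
    then obtain D where D: "D \<subseteq> B" "D \<noteq> {}" "card D \<le> c" "2 * n - 1 \<le> msr (sumset A' D)" by blast
    obtain b where b: "b ` {1..c} = D" using ex_enumeration[OF finite_subset[OF D(1) finB] D(2,3)] by blast
    have "card (A <#>\<^bsub>integer_mod_group q\<^esub> D) = msr (sumset A' D)"
      unfolding A'_def using D B A p_def by (intro card_set_mult) auto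
    then have "int (card (A <#>\<^bsub>integer_mod_group q\<^esub> (b ` {1..c}))) \<ge> int (card A) + int (card B) - 1"
      using D(4) AB(5) \<open>n > 0\<close> unfolding b n_def by linarith
    then show "\<exists>b :: nat \<Rightarrow> int. (\<forall>i\<in>{1..c}. b i \<in> B) \<and>
        int (card (A <#>\<^bsub>integer_mod_group q\<^esub> (b ` {1..c}))) \<ge> int (card A) + int (card B) - 1"
      using b D(1) by (intro exI[of _ b]) blast
  qed
qed

end
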